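(* Let $p\in\,]1,\infty[$, $\alpha>-1$, $X=H^p$ or $X=A^p_\alpha$, and let $g_t\in H^\infty$ for $t\in\,]0,1[$ be such that the family $\{M_{g_t}:t\in\,]0,1[\}$ satisfies $W(X)$. Then \[ \sup_{(f_n)\in W_0(\partial B_X)}\limsup_n\Big\|\int_0^1 M_{g_t}f_n\,dt\Big\|_X\le\int_0^1\sup_{(f_n)\in W_0(\partial B_X)}\limsup_n\|M_{g_t}f_n\|_X\,dt \] holds with equality if and only if there is a weakly null sequence $(\phi_n)\subset X$ with $\|\phi_n\|_X=1$ for all $n$ such that \[ \lim_n\Big\|\int_0^1 M_{g_t}\phi_n\,dt\Big\|_X=\lim_n\int_0^1\|M_{g_t}\phi_n\|_X\,dt \] and \[ \liminf_n\|M_{g_t}\phi_n\|_X=\sup_{(f_n)\in W_0(\partial B_X)}\limsup_n\|M_{g_t}f_n\|_X\quad\text{for almost every } t\in\,]0,1[. \] Moreover, $(\phi_n)$ can be chosen to be an approximate evaluation map.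
   Context: $\mathbb{D}$ is the open unit disk, $m$ normalized arc length on $\partial\mathbb{D}$, $A$ normalized area measure on $\mathbb{D}$. $H^p$ is the Hardy space of analytic $f$ on $\mathbb{D}$ with $\|f\|_{H^p}=\lim_{r\to1}(\int_{\partial\mathbb{D}}|f(rz)|^p\,dm(z))^{1/p}<\infty$; $A^p_\alpha$ is the weighted Bergman space of analytic $f$ on $\mathbb{D}$ with $\|f\|_{A^p_\alpha}=(\int_{\mathbb{D}}|f(z)|^p(\alpha+1)(1-|z|^2)^\alpha\,dA(z))^{1/p}<\infty$. $H^\infty$ is the space of bounded analytic functions on $\mathbb{D}$ with $\|g\|_\infty=\sup_{z\in\mathbb{D}}|g(z)|$; $M_gf=gf$. A family $\{S_t:t\in\,]0,1[\}$ of bounded operators on $X$ satisfies $W(X)$ if for every $f\in X$ the map $t\mapsto S_tf$ is norm continuous on $]0,1[$ and $\int_0^1\|S_tf\|_X\,dt<\infty$; then $\int_0^1 S_t\,dt$ denotes the bounded operator $f\mapsto\int_0^1 S_tf\,dt$ (vector-valued integral). $B_X$ is the closed unit ball of $X$, $\partial B_X$ the unit sphere, and $W_0(\partial B_X)$ the set of sequences in $\partial B_X$ converging weakly to $0$. An approximate evaluation map is a sequence $(\phi_n)\subset\partial B_X$ for which there is $\xi\in\partial\mathbb{D}$ with $\lim_n\sup_{z\in\mathbb{D}\setminus B(\xi,\varepsilon)}|\phi_n(z)|=0$ for every $\varepsilon>0$. *)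

theory Defs
  imports "HOL-Analysis.Analysis"
begin

text \<open>Functions on the disk are represented as complex => complex; only values on
  the open unit disk (ball 0 1) matter.  A space X is given by a carrier set and a norm.\<close>

definition Hp_mean :: "real \<Rightarrow> (complex \<Rightarrow> complex) \<Rightarrow> real \<Rightarrow> real" where
  "Hp_mean p f r = integral {0..2*pi} (\<lambda>\<theta>. norm (f (complex_of_real r * cis \<theta>)) powr p) / (2*pi)"

definition Hp_space :: "real \<Rightarrow> (complex \<Rightarrow> complex) set" where
  "Hp_space p = {f. f holomorphic_on ball 0 1 \<and> (\<exists>L. (Hp_mean p f \<longlongrightarrow> L) (at_left 1))}"

definition Hp_norm :: "real \<Rightarrow> (complex \<Rightarrow> complex) \<Rightarrow> real" where
  "Hp_norm p f = (Lim (at_left 1) (Hp_mean p f)) powr (1/p)"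

definition Ap_integrand :: "real \<Rightarrow> real \<Rightarrow> (complex \<Rightarrow> complex) \<Rightarrow> complex \<Rightarrow> real" where
  "Ap_integrand p \<alpha> f z = norm (f z) powr p * ((\<alpha> + 1) * (1 - (norm z)\<^sup>2) powr \<alpha>) / pi"

definition Ap_space :: "real \<Rightarrow> real \<Rightarrow> (complex \<Rightarrow> complex) set" where
  "Ap_space p \<alpha> = {f. f holomorphic_on ball 0 1 \<and> Ap_integrand p \<alpha> f integrable_on ball 0 1}"

definition Ap_norm :: "real \<Rightarrow> real \<Rightarrow> (complex \<Rightarrow> complex) \<Rightarrow> real" where
  "Ap_norm p \<alpha> f = (integral (ball 0 1) (Ap_integrand p \<alpha> f)) powr (1/p)"

definition Hinf :: "(complex \<Rightarrow> complex) set" where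
  "Hinf = {g. g holomorphic_on ball 0 1 \<and> (\<exists>B. \<forall>z\<in>ball 0 1. norm (g z) \<le> B)}"

definition bounded_functional ::
    "(complex \<Rightarrow> complex) set \<Rightarrow> ((complex \<Rightarrow> complex) \<Rightarrow> real) \<Rightarrow> ((complex \<Rightarrow> complex) \<Rightarrow> complex) \<Rightarrow> bool" where
  "bounded_functional X N L \<longleftrightarrow>
     (\<forall>f\<in>X. \<forall>h\<in>X. \<forall>a b. L (\<lambda>z. a * f z + b * h z) = a * L f + b * L h) \<and>
     (\<exists>C. \<forall>f\<in>X. norm (L f) \<le> C * N f)"

definition weakly_null ::
    "(complex \<Rightarrow> complex) set \<Rightarrow> ((complex \<Rightarrow> complex) \<Rightarrow> real) \<Rightarrow> (nat \<Rightarrow> complex \<Rightarrow> complex) \<Rightarrow> bool" where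
  "weakly_null X N f \<longleftrightarrow> (\<forall>n. f n \<in> X) \<and>
     (\<forall>L. bounded_functional X N L \<longrightarrow> (\<lambda>n. L (f n)) \<longlonglongrightarrow> 0)"

definition W0_sphere ::
    "(complex \<Rightarrow> complex) set \<Rightarrow> ((complex \<Rightarrow> complex) \<Rightarrow> real) \<Rightarrow> (nat \<Rightarrow> complex \<Rightarrow> complex) set" where
  "W0_sphere X N = {f. weakly_null X N f \<and> (\<forall>n. N (f n) = 1)}"

definition wn_sup ::
    "(complex \<Rightarrow> complex) set \<Rightarrow> ((complex \<Rightarrow> complex) \<Rightarrow> real) \<Rightarrow>
     ((complex \<Rightarrow> complex) \<Rightarrow> (complex \<Rightarrow> complex)) \<Rightarrow> ennreal" where
  "wn_sup X N T = (SUP f\<in>W0_sphere X N. limsup (\<lambda>n. ennreal (N (T (f n)))))"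

definition mult_op :: "(complex \<Rightarrow> complex) \<Rightarrow> (complex \<Rightarrow> complex) \<Rightarrow> (complex \<Rightarrow> complex)" where
  "mult_op g f = (\<lambda>z. g z * f z)"

definition W_cond ::
    "(complex \<Rightarrow> complex) set \<Rightarrow> ((complex \<Rightarrow> complex) \<Rightarrow> real) \<Rightarrow> (real \<Rightarrow> complex \<Rightarrow> complex) \<Rightarrow> bool" where
  "W_cond X N g \<longleftrightarrow> (\<forall>f\<in>X.
     (\<forall>t\<in>{0<..<1}. mult_op (g t) f \<in> X) \<and>
     (\<forall>t0\<in>{0<..<1}. ((\<lambda>t. N (\<lambda>z. mult_op (g t) f z - mult_op (g t0) f z)) \<longlongrightarrow> 0)
                       (at t0 within {0<..<1})) \<and>
     (\<lambda>t. N (mult_op (g t) f)) integrable_on {0<..<1})"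

text \<open>The vector-valued integral (int_0^1 M_{g t} dt) f, evaluated pointwise
  (point evaluations are continuous on X, so this is the value of the X-valued integral).\<close>
definition int_mult_op :: "(real \<Rightarrow> complex \<Rightarrow> complex) \<Rightarrow> (complex \<Rightarrow> complex) \<Rightarrow> (complex \<Rightarrow> complex)" where
  "int_mult_op g f = (\<lambda>z. integral {0<..<1} (\<lambda>t. mult_op (g t) f z))"

definition approx_eval_map ::
    "(complex \<Rightarrow> complex) set \<Rightarrow> ((complex \<Rightarrow> complex) \<Rightarrow> real) \<Rightarrow> (nat \<Rightarrow> complex \<Rightarrow> complex) \<Rightarrow> bool" where
  "approx_eval_map X N \<phi> \<longleftrightarrow> (\<forall>n. \<phi> n \<in> X \<and> N (\<phi> n) = 1) \<and>
     (\<exists>\<xi>. norm \<xi> = 1 \<and> (\<forall>\<epsilon>>0.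
        (\<lambda>n. SUP z\<in>ball 0 1 - ball \<xi> \<epsilon>. ennreal (norm (\<phi> n z))) \<longlonglongrightarrow> 0))"

end

theory Submission
  imports Defs "HOL-Complex_Analysis.Complex_Analysis" "HOL-Real_Asymp.Real_Asymp"
begin

text \<open>
  Write \<open>G z\<close> for the integral of \<open>g t z\<close> over \<open>t\<close>, so that the integrated operator is
  multiplication by \<open>G\<close>. For a bounded analytic \<open>h\<close>, the supremum of \<open>limsup\<close> of \<open>N (h f\<^sub>n)\<close> over
  weakly null sequences in the sphere is the sup norm of \<open>h\<close>, so the inequality reads
  \<open>sup |G| \<le> \<integral> sup |g t| dt\<close>.

  Let \<open>D a\<close> be the norm of the evaluation at \<open>a\<close>. If \<open>N \<phi> = 1\<close> and \<open>|\<phi> a|\<close> is close to \<open>D a\<close>, then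
  \<open>|h a \<phi> a| \<le> D a N (h \<phi>)\<close> gives \<open>N (h \<phi>) \<ge> (1 - o(1)) |h a|\<close> simultaneously for all multipliers \<open>h\<close>.
  After a dilation and multiplication by a peaking exponential such functions concentrate at a boundary
  point as \<open>a\<close> tends to it, and then they are weakly null. In the case of equality, choose \<open>a\<^sub>k\<close> tending
  to the boundary with \<open>|G a\<^sub>k| \<rightarrow> sup |G|\<close>. Then \<open>|g t a\<^sub>k| \<rightarrow> sup |g t|\<close> in the mean, hence almost
  everywhere along a subsequence, and the functions \<open>\<phi>\<^sub>k\<close> belonging to \<open>a\<^sub>k\<close> are as required. The
  converse is Fatou's lemma. Equality with both sides infinite is excluded because \<open>G\<close> is bounded by the
  uniform boundedness principle.

  Only a few properties of the norm are needed, which both spaces share: it is a supremum of \<open>L\<^sup>p\<close> norms over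
  measures on the disk, dilations are contractive, and evaluations grow polynomially at the boundary.
\<close>

section \<open>Spaces of analytic functions with an \<open>L\<^sup>p\<close>-type norm\<close>

text \<open>The condition for equality asks for one sequence that is almost extremal for uncountably
  many multipliers at once, so sequences chosen for each \<open>g t\<close> separately do not help.
  Evaluations do, because the loss in their estimate is the same for every multiplier. No formula
  for extremal functions enters: explicit kernels would call for their norm and decay in each space,
  so an arbitrary almost extremal function is localised by force. It may grow like a power of
  \<open>1 / (1 - norm z)\<close> along the whole boundary. An exponential peak cannot suppress this
  directly; it can once a dilation has bounded the function by a power of
  \<open>1 / (1 - norm a)\<close>. The dual spaces are not described either: weak nullness rests on
  the fact that p-th powers of norms nearly add up for functions living on nearly disjoint sets.
  Finally, \<open>int_mult_op\<close> is a pointwise integral, so it is not known at the outset that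
  \<open>G\<close> maps the space into itself. Boundedness of \<open>G\<close> is extracted from
  pointwise bounds in terms of evaluation norms.\<close>

lemma powr_add_le_weighted:
  fixes a b s p :: real
  assumes "1 < p" "0 < s" "s < 1" "0 \<le> a" "0 \<le> b"
  shows "(a + b) powr p \<le> (1 - s) powr (1 - p) * a powr p + s powr (1 - p) * b powr p"
proof -
  have w: "1 \<le> t powr (1 - p)" if "0 < t" "t < 1" for t
    using that assms powr_mono'[of "1 - p" 0 t] by simp
  have div: "t * (x / t) powr p = t powr (1 - p) * x powr p" if "0 < t" "0 \<le> x" for t x
    using that by (simp add: powr_divide powr_diff)
  consider "a = 0" | "b = 0" | "a > 0" "b > 0"
    using assms by linarith
  then show ?thesis
  proof cases
    case 1
    have "1 * b powr p \<le> s powr (1 - p) * b powr p"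
      using w[of s] assms by (intro mult_right_mono) auto
    then show ?thesis using 1 assms by simp
  next
    case 2
    have "1 * a powr p \<le> (1 - s) powr (1 - p) * a powr p"
      using w[of "1 - s"] assms by (intro mult_right_mono) auto
    then show ?thesis using 2 assms by simp
  next
    case 3
    \<comment> \<open>Convexity of the p-th power at \<open>a / (1 - s)\<close> and
      \<open>b / s\<close>, whose mean with weights \<open>1 - s\<close> and \<open>s\<close> is
      \<open>a + b\<close>. A small \<open>s\<close> shifts the cost to \<open>b\<close>, which
      suits a negligible \<open>b\<close>; a balanced \<open>s\<close> yields Minkowski's
      inequality.\<close>
    have "((1 - s) * (a / (1 - s)) + s * (b / s)) powr p
        \<le> (1 - s) * (a / (1 - s)) powr p + s * (b / s) powr p"
      using convex_onD[OF powr_convex[of p], of s "a / (1 - s)" "b / s"] assms 3 by simp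
    then show ?thesis
      using div[of "1 - s" a] div[of s b] assms 3 by simp
  qed
qed

lemma measurable_powr_ball:
  assumes "f holomorphic_on ball 0 R"
  shows "(\<lambda>z. ennreal (norm (f z) powr p) * indicator (ball 0 R) z) \<in> borel_measurable borel"
proof -
  have "continuous_on (ball 0 R) f"
    using assms holomorphic_on_imp_continuous_on by blast
  then have "(\<lambda>z. indicator (ball 0 R) z *\<^sub>R f z) \<in> borel_measurable borel"
    by (intro borel_measurable_continuous_on_indicator) auto
  then have "(\<lambda>z. ennreal (norm (indicator (ball 0 R) z *\<^sub>R f z) powr p)) \<in> borel_measurable borel"
    by measurable
  also have "(\<lambda>z. ennreal (norm (indicator (ball 0 R) z *\<^sub>R f z) powr p))
      = (\<lambda>z. ennreal (norm (f z) powr p) * indicator (ball 0 R) z)"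
    by (auto simp: indicator_def)
  finally show ?thesis .
qed

lemma holomorphic_dilation:
  assumes f: "f holomorphic_on ball 0 1" and \<rho>: "0 < \<rho>" "\<rho> < 1"
  shows "(\<lambda>z. f (of_real \<rho> * z)) holomorphic_on ball 0 1"
proof -
  have \<rho>z: "norm (of_real \<rho> * z) \<le> norm z" for z :: complex
    using \<rho> by (simp add: norm_mult mult_left_le_one_le)
  have "(f \<circ> (\<lambda>z. of_real \<rho> * z)) holomorphic_on ball 0 1"
  proof (rule holomorphic_on_compose_gen[OF _ f])
    show "(\<lambda>z. complex_of_real \<rho> * z) ` ball 0 1 \<subseteq> ball 0 1"
      using order_le_less_trans[OF \<rho>z] by auto
  qed (intro holomorphic_intros)
  then show ?thesis by (simp add: o_def)
qed

text \<open>The Schwarz lemma, rescaled to \<open>ball a R\<close>. An estimate against the centre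
  with an explicit constant serves twice: for the error made by a dilation and for dominating the
  difference quotients of \<open>G\<close>.\<close>

lemma holomorphic_lipschitz_center:
  assumes "f holomorphic_on ball a R" "\<And>z. z \<in> ball a R \<Longrightarrow> norm (f z) \<le> B" "w \<in> ball a R" "0 < R"
  shows "norm (f w - f a) \<le> 2 * B * norm (w - a) / R"
proof (rule field_le_epsilon)
  fix e :: real assume e: "0 < e"
  \<comment> \<open>The Schwarz lemma wants values strictly inside the unit disk; the extra
    \<open>e\<close> ensures this, also when \<open>B = 0\<close>, and is removed by letting it tend
    to 0.\<close>
  define B' where "B' = 2 * B + e"
  have "0 \<le> B" using assms(2)[OF assms(3)] norm_ge_zero[of "f w"] by linarith
  then have B': "0 < B'" using e by (simp add: B'_def)
  define g where "g = (\<lambda>z. (f (a + of_real R * z) - f a) / of_real B')"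
  have im: "a + of_real R * z \<in> ball a R" if "norm z < 1" for z
    using that assms(4) by (simp add: dist_norm norm_mult)
  have "(f \<circ> (\<lambda>z. a + of_real R * z)) holomorphic_on ball 0 1"
    using im by (intro holomorphic_on_compose_gen[OF _ assms(1)] holomorphic_intros) auto
  then have "g holomorphic_on ball 0 1"
    unfolding g_def o_def using B' by (intro holomorphic_intros) auto
  moreover have "norm (g z) < 1" if "norm z < 1" for z
  proof -
    have "norm (f (a + of_real R * z) - f a) \<le> B + B"
      using norm_triangle_ineq4 assms(2)[OF im[OF that]] assms(2)[of a] assms(4)
      by (smt (verit, best) centre_in_ball)
    then have "norm (f (a + of_real R * z) - f a) < B'" using e by (simp add: B'_def)
    then show ?thesis using B' by (simp add: g_def norm_divide)
  qed
  moreover have "norm ((w - a) / of_real R) < 1" using assms(3,4) by (simp add: dist_norm norm_divide norm_minus_commute)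
  ultimately have "norm (g ((w - a) / of_real R)) \<le> norm ((w - a) / of_real R)"
    by (intro Schwarz_Lemma(1)) (auto simp: g_def)
  then have "norm (f w - f a) \<le> B' * norm (w - a) / R"
    using B' assms(4) by (simp add: g_def norm_divide field_simps)
  also have "\<dots> = 2 * B * norm (w - a) / R + e * (norm (w - a) / R)"
    using assms(4) by (simp add: B'_def field_simps)
  also have "\<dots> \<le> 2 * B * norm (w - a) / R + e"
    using assms(3,4) e by (simp add: dist_norm norm_minus_commute field_simps)
  finally show "norm (f w - f a) \<le> 2 * B * norm (w - a) / R + e" .
qed

section \<open>The common setting: p-th power masses and the norm they induce\<close>

definition Lp_mass :: "real \<Rightarrow> 'i set \<Rightarrow> ('i \<Rightarrow> complex measure) \<Rightarrow> (complex \<Rightarrow> complex) \<Rightarrow> ennreal" where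
  "Lp_mass p I M f = (SUP i\<in>I. \<integral>\<^sup>+z\<in>ball 0 1. ennreal (norm (f z) powr p) \<partial>M i)"

text \<open>Bergman norms come from a single measure, a weighted area. Hardy norms come from the
  normalised arc lengths of all circles of radius below 1; the supremum over them avoids boundary
  values. Smallness of mass near a boundary point is uniform in \<open>i\<close> in order to survive
  this supremum. The norm is tied to the mass only where the mass is finite, since the limit or
  integral behind \<open>N\<close> may fail to exist elsewhere.\<close>

locale disk_space =
  fixes p :: real and I :: "'i set" and M :: "'i \<Rightarrow> complex measure"
    and N :: "(complex \<Rightarrow> complex) \<Rightarrow> real"
  assumes p: "1 < p"
    and sets_M [measurable_cong]: "\<And>i. sets (M i) = sets borel"
    and finite_mass: "\<exists>K::real. \<forall>i\<in>I. emeasure (M i) (ball 0 1) \<le> ennreal K"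
    and small_mass: "\<And>\<xi> \<eta>. norm \<xi> = 1 \<Longrightarrow> 0 < \<eta> \<Longrightarrow>
      \<exists>\<epsilon>>0. \<forall>i\<in>I. emeasure (M i) (ball 0 1 \<inter> ball \<xi> \<epsilon>) \<le> ennreal \<eta>"
    and evaluation: "\<exists>C s. 0 < C \<and> (\<forall>f z. f holomorphic_on ball 0 1 \<longrightarrow> z \<in> ball 0 1 \<longrightarrow>
      ennreal (norm (f z) powr p) \<le> ennreal (C * (1 - norm z) powr (- s)) * Lp_mass p I M f)"
    and dilation: "\<And>f \<rho>. f holomorphic_on ball 0 1 \<Longrightarrow> 0 < \<rho> \<Longrightarrow> \<rho> < 1 \<Longrightarrow>
      Lp_mass p I M (\<lambda>z. f (of_real \<rho> * z)) \<le> Lp_mass p I M f"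
    and N_eq: "\<And>f. f holomorphic_on ball 0 1 \<Longrightarrow> Lp_mass p I M f < \<infinity> \<Longrightarrow>
      N f = enn2real (Lp_mass p I M f) powr (1 / p)"
begin

abbreviation "mass \<equiv> Lp_mass p I M"

definition X :: "(complex \<Rightarrow> complex) set" where
  "X = {f. f holomorphic_on ball 0 1 \<and> mass f < \<infinity>}"

lemma holo_X: "f \<in> X \<Longrightarrow> f holomorphic_on ball 0 1"
  by (simp add: X_def)

lemma mass_cong:
  assumes "\<And>z. norm z < 1 \<Longrightarrow> f z = h z"
  shows "mass f = mass h"
  unfolding Lp_mass_def by (intro SUP_cong nn_integral_cong refl) (auto simp: assms indicator_def)

text \<open>The pointwise bound is integrated against each \<open>M i\<close> before the supremum is
  taken. The last two terms are for perturbations: one bounded on a set \<open>A\<close> of small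
  mass, one small on the whole disk.\<close>

lemma mass_le:
  assumes "f holomorphic_on ball 0 1" "h holomorphic_on ball 0 1" "0 \<le> a" "0 \<le> b" "0 \<le> c" "0 \<le> d"
    and A: "A \<in> sets borel" "\<And>i. i \<in> I \<Longrightarrow> emeasure (M i) (ball 0 1 \<inter> A) \<le> ennreal \<eta>"
    and K: "\<And>i. i \<in> I \<Longrightarrow> emeasure (M i) (ball 0 1) \<le> ennreal K"
    and le: "\<And>z. norm z < 1 \<Longrightarrow> norm (u z) powr p \<le>
      a * norm (f z) powr p + b * norm (h z) powr p + c * indicator A z + d"
  shows "mass u \<le> ennreal a * mass f + ennreal b * mass h + ennreal c * ennreal \<eta> + ennreal d * ennreal K"
  unfolding Lp_mass_def
proof (rule SUP_least)
  fix i assume i: "i \<in> I"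
  have m: "(\<lambda>z. ennreal (norm (u z) powr p) * indicator (ball 0 1) z) \<in> borel_measurable (M i)"
    if "u holomorphic_on ball 0 1" for u
    using measurable_powr_ball[OF that] measurable_cong_sets[OF sets_M refl] by blast
  note m = assms(1,2)[THEN m]
  let ?B = "indicator (ball 0 1) :: complex \<Rightarrow> ennreal"
  have "(\<integral>\<^sup>+z\<in>ball 0 1. ennreal (norm (u z) powr p) \<partial>M i) \<le>
    (\<integral>\<^sup>+z. ennreal a * (ennreal (norm (f z) powr p) * ?B z) + ennreal b * (ennreal (norm (h z) powr p) * ?B z)
       + ennreal c * indicator (ball 0 1 \<inter> A) z + ennreal d * ?B z \<partial>M i)"
  proof (intro nn_integral_mono)
    fix z assume "z \<in> space (M i)"
    show "ennreal (norm (u z) powr p) * ?B z \<le> ennreal a * (ennreal (norm (f z) powr p) * ?B z) + ennreal b * (ennreal (norm (h z) powr p) * ?B z)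
       + ennreal c * indicator (ball 0 1 \<inter> A) z + ennreal d * ?B z"
    proof (cases "norm z < 1")
      case True
      have "ennreal (norm (u z) powr p) \<le> ennreal (a * norm (f z) powr p + b * norm (h z) powr p + c * indicator A z + d)"
        using le[OF True] by (rule ennreal_leI)
      also have "\<dots> = ennreal a * ennreal (norm (f z) powr p) + ennreal b * ennreal (norm (h z) powr p)
         + ennreal c * indicator A z + ennreal d"
        using assms(3-6) by (simp add: ennreal_plus ennreal_mult indicator_def)
      finally show ?thesis using True by (auto simp: indicator_def)
    qed auto
  qed
  also have "\<dots> = ennreal a * (\<integral>\<^sup>+z. ennreal (norm (f z) powr p) * ?B z \<partial>M i)
      + ennreal b * (\<integral>\<^sup>+z. ennreal (norm (h z) powr p) * ?B z \<partial>M i)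
       + ennreal c * emeasure (M i) (ball 0 1 \<inter> A) + ennreal d * emeasure (M i) (ball 0 1)"
  proof -
    define F where "F = (\<lambda>z. ennreal (norm (f z) powr p) * ?B z)"
    define H where "H = (\<lambda>z. ennreal (norm (h z) powr p) * ?B z)"
    have [measurable]: "F \<in> borel_measurable (M i)" "H \<in> borel_measurable (M i)"
      "ball 0 1 \<inter> A \<in> sets (M i)" "ball 0 1 \<in> sets (M i)"
      using m A(1) by (auto simp: F_def H_def sets_M)
    have "(\<integral>\<^sup>+z. ennreal a * F z + ennreal b * H z + ennreal c * indicator (ball 0 1 \<inter> A) z + ennreal d * ?B z \<partial>M i)
      = ennreal a * (\<integral>\<^sup>+z. F z \<partial>M i) + ennreal b * (\<integral>\<^sup>+z. H z \<partial>M i)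
       + ennreal c * emeasure (M i) (ball 0 1 \<inter> A) + ennreal d * emeasure (M i) (ball 0 1)"
      by (simp add: nn_integral_add nn_integral_cmult nn_integral_cmult_indicator)
    then show ?thesis by (simp add: F_def H_def)
  qed
  also have "\<dots> \<le> ennreal a * mass f + ennreal b * mass h + ennreal c * ennreal \<eta> + ennreal d * ennreal K"
    unfolding Lp_mass_def
    by (intro add_mono mult_left_mono A(2) K i SUP_upper) auto
  finally show "(\<integral>\<^sup>+z\<in>ball 0 1. ennreal (norm (u z) powr p) \<partial>M i) \<le>
    ennreal a * (SUP i\<in>I. \<integral>\<^sup>+z\<in>ball 0 1. ennreal (norm (f z) powr p) \<partial>M i) +
    ennreal b * (SUP i\<in>I. \<integral>\<^sup>+z\<in>ball 0 1. ennreal (norm (h z) powr p) \<partial>M i) +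
    ennreal c * ennreal \<eta> + ennreal d * ennreal K"
    unfolding Lp_mass_def .
qed

lemma mass_le2:
  assumes "f holomorphic_on ball 0 1" "h holomorphic_on ball 0 1" "0 \<le> a" "0 \<le> b"
    and "\<And>z. norm z < 1 \<Longrightarrow> norm (u z) powr p \<le> a * norm (f z) powr p + b * norm (h z) powr p"
  shows "mass u \<le> ennreal a * mass f + ennreal b * mass h"
proof -
  obtain K where "\<forall>i\<in>I. emeasure (M i) (ball 0 1) \<le> ennreal K"
    using finite_mass by blast
  then show ?thesis
    using mass_le[of f h a b 0 0 "{}" 0 K u] assms by simp
qed

lemma X_I:
  assumes "u holomorphic_on ball 0 1" "mass u \<le> ennreal c"
  shows "u \<in> X"
  using assms by (auto simp: X_def top_unique less_top[symmetric])

lemma N_nonneg: "f \<in> X \<Longrightarrow> 0 \<le> N f"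
  by (simp add: X_def N_eq)

lemma mass_eq: "f \<in> X \<Longrightarrow> mass f = ennreal (N f powr p)"
  using p by (simp add: X_def N_eq powr_powr less_top[symmetric])

lemma N_le_I:
  assumes "u holomorphic_on ball 0 1" "mass u \<le> ennreal (c powr p)" "0 \<le> c"
  shows "u \<in> X" "N u \<le> c"
proof -
  show "u \<in> X" using X_I assms by blast
  then have "ennreal (N u powr p) \<le> ennreal (c powr p)"
    using assms mass_eq by metis
  then have "N u powr p \<le> c powr p" by (simp add: ennreal_le_iff)
  then show "N u \<le> c" using p assms(3) N_nonneg[OF \<open>u \<in> X\<close>]
    by (meson not_le order_less_trans powr_less_mono2 p zero_less_one linorder_not_less)
qed

lemma N_cong:
  assumes "f \<in> X" "h holomorphic_on ball 0 1" "\<And>z. norm z < 1 \<Longrightarrow> h z = f z"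
  shows "h \<in> X" "N h = N f"
  using assms mass_cong[of h f] by (auto simp: X_def N_eq)

lemma mult_X:
  assumes "f \<in> X" "h holomorphic_on ball 0 1" "\<And>z. norm z < 1 \<Longrightarrow> norm (h z) \<le> B" "0 \<le> B"
  shows "(\<lambda>z. h z * f z) \<in> X" "N (\<lambda>z. h z * f z) \<le> B * N f"
proof -
  have hol: "(\<lambda>z. h z * f z) holomorphic_on ball 0 1"
    using assms holo_X by (intro holomorphic_intros) auto
  have "mass (\<lambda>z. h z * f z) \<le> ennreal (B powr p) * mass f + ennreal 0 * mass f"
    using assms p
    by (intro mass_le2) (auto simp: holo_X norm_mult powr_mult intro!: mult_right_mono powr_mono2)
  then have "mass (\<lambda>z. h z * f z) \<le> ennreal ((B * N f) powr p)"
    using assms by (simp add: mass_eq powr_mult N_nonneg ennreal_mult)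
  from N_le_I[OF hol this] show "(\<lambda>z. h z * f z) \<in> X" "N (\<lambda>z. h z * f z) \<le> B * N f"
    using assms N_nonneg by auto
qed

lemma scale_X:
  assumes "f \<in> X"
  shows "(\<lambda>z. c * f z) \<in> X" "N (\<lambda>z. c * f z) = norm c * N f"
proof -
  show X: "(\<lambda>z. c * f z) \<in> X" by (rule mult_X(1)[OF assms, of _ "norm c"]) auto
  have le: "N (\<lambda>z. c * h z) \<le> norm c * N h" if "h \<in> X" for h c
    by (rule mult_X(2)[OF that]) auto
  show "N (\<lambda>z. c * f z) = norm c * N f"
  proof (cases "c = 0")
    case True
    then show ?thesis using le[OF assms, of c] N_nonneg[OF X] by auto
  next
    case False
    then have "N f \<le> norm (1 / c) * N (\<lambda>z. c * f z)"
      using le[OF X, of "1 / c"] by simp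
    then have "norm c * N f \<le> norm c * (norm (1 / c) * N (\<lambda>z. c * f z))"
      by (intro mult_left_mono) auto
    then show ?thesis using le[OF assms, of c] False by (simp add: norm_divide)
  qed
qed

lemma N_zero_imp:
  assumes "f \<in> X" "N f = 0" "norm z < 1" shows "f z = 0"
proof -
  obtain C s where "\<And>f z. f holomorphic_on ball 0 1 \<Longrightarrow> z \<in> ball 0 1 \<Longrightarrow>
      ennreal (norm (f z) powr p) \<le> ennreal (C * (1 - norm z) powr (- s)) * mass f"
    using evaluation by blast
  from this[of f z] assms show ?thesis
    by (simp add: holo_X mass_eq ennreal_eq_0_iff)
qed

text \<open>Minkowski's inequality. The weight \<open>s\<close> chosen below minimises the bound
  obtained from \<open>powr_add_le_weighted\<close>. One \<open>s\<close> serves all measures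
  \<open>M i\<close>, because only the masses of \<open>f\<close> and \<open>h\<close>, which are
  already suprema, enter it. The minimiser lies strictly between 0 and 1 only for positive norms,
  hence the separate cases.\<close>

lemma add_X:
  assumes "f \<in> X" "h \<in> X"
  shows "(\<lambda>z. f z + h z) \<in> X" "N (\<lambda>z. f z + h z) \<le> N f + N h"
proof -
  have hol: "(\<lambda>z. f z + h z) holomorphic_on ball 0 1"
    using assms holo_X by (intro holomorphic_intros) auto
  consider "N f = 0" | "N h = 0" | "N f > 0" "N h > 0"
    using N_nonneg assms by fastforce
  then have "(\<lambda>z. f z + h z) \<in> X \<and> N (\<lambda>z. f z + h z) \<le> N f + N h"
  proof cases
    case 1
    then show ?thesis using N_cong[OF assms(2) hol] N_zero_imp[OF assms(1)] by simp
  next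
    case 2
    then show ?thesis using N_cong[OF assms(1) hol] N_zero_imp[OF assms(2)] by simp
  next
    case 3
    define s where "s = N h / (N f + N h)"
    have s: "0 < s" "s < 1" "1 - s = N f / (N f + N h)"
      using 3 by (auto simp: s_def field_simps)
    have eq: "(x / (x + y)) powr (1 - p) * x powr p = x * (x + y) powr (p - 1)" if "x > 0" "y > 0" for x y
    proof -
      have "(x + y) * (x + y) powr (p - 1) = (x + y) powr p"
        using that by (simp add: powr_mult_base)
      then show ?thesis
        using that by (simp add: powr_divide powr_diff[of _ 1 p]) (simp add: powr_diff divide_simps)
    qed
    have "mass (\<lambda>z. f z + h z) \<le> ennreal ((1 - s) powr (1 - p)) * mass f + ennreal (s powr (1 - p)) * mass h"
    proof (intro mass_le2)
      fix z :: complex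
      have "norm (f z + h z) powr p \<le> (norm (f z) + norm (h z)) powr p"
        using p by (intro powr_mono2 norm_triangle_ineq) auto
      also have "\<dots> \<le> (1 - s) powr (1 - p) * norm (f z) powr p + s powr (1 - p) * norm (h z) powr p"
        using p s(1,2) by (intro powr_add_le_weighted) auto
      finally show "norm (f z + h z) powr p \<le> (1 - s) powr (1 - p) * norm (f z) powr p + s powr (1 - p) * norm (h z) powr p" .
    qed (use assms holo_X in auto)
    also have "\<dots> = ennreal ((1 - s) powr (1 - p) * N f powr p + s powr (1 - p) * N h powr p)"
      using assms by (simp add: mass_eq ennreal_mult ennreal_plus)
    also have "(1 - s) powr (1 - p) * N f powr p + s powr (1 - p) * N h powr p = (N f + N h) powr p"
    proof -
      have "(1 - s) powr (1 - p) * N f powr p = N f * (N f + N h) powr (p - 1)"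
        unfolding s(3) using 3 by (rule eq)
      moreover have "s powr (1 - p) * N h powr p = N h * (N f + N h) powr (p - 1)"
        unfolding s_def using eq[OF 3(2,1)] by (simp add: add.commute)
      ultimately show ?thesis
        using 3 powr_mult_base[of "N f + N h" "p - 1"] by (simp add: distrib_right)
    qed
    finally show ?thesis using N_le_I[OF hol] 3 by simp
  qed
  then show "(\<lambda>z. f z + h z) \<in> X" "N (\<lambda>z. f z + h z) \<le> N f + N h" by auto
qed

lemma diff_X:
  assumes "f \<in> X" "h \<in> X"
  shows "(\<lambda>z. f z - h z) \<in> X" "N (\<lambda>z. f z - h z) \<le> N f + N h" "\<bar>N f - N h\<bar> \<le> N (\<lambda>z. f z - h z)"
proof -
  have m: "(\<lambda>z. - u z) \<in> X" "N (\<lambda>z. - u z) = N u" if "u \<in> X" for u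
    using scale_X[OF that, of "-1"] by auto
  have d: "(\<lambda>z. u z - v z) \<in> X" "N (\<lambda>z. u z - v z) \<le> N u + N v" if "u \<in> X" "v \<in> X" for u v
    using add_X[OF that(1) m(1)[OF that(2)]] m(2)[OF that(2)] by auto
  have "N f \<le> N (\<lambda>z. f z - h z) + N h"
    using add_X(2)[OF d(1)[OF assms] assms(2)] by simp
  moreover have "N h \<le> N f + N (\<lambda>z. f z - h z)"
    using d(2)[OF assms(1) d(1)[OF assms]] by simp
  ultimately show "(\<lambda>z. f z - h z) \<in> X" "N (\<lambda>z. f z - h z) \<le> N f + N h" "\<bar>N f - N h\<bar> \<le> N (\<lambda>z. f z - h z)" using d assms by auto
qed

lemma const_X: "(\<lambda>z. c) \<in> X"
proof -
  obtain K where K: "\<forall>i\<in>I. emeasure (M i) (ball 0 1) \<le> ennreal K"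
    using finite_mass by blast
  have "mass (\<lambda>z. c) \<le> ennreal (norm c powr p) * ennreal K"
    unfolding Lp_mass_def
    using K by (intro SUP_least) (auto simp: nn_integral_cmult_indicator sets_M intro!: mult_left_mono)
  then have "mass (\<lambda>z. c) \<le> ennreal (norm c powr p * K)"
    by (simp add: ennreal_mult')
  then show ?thesis by (intro X_I) auto
qed

text \<open>Fatou's lemma for each \<open>M i\<close>. In the gliding hump argument this takes the
  place of completeness.\<close>

lemma limit_X:
  assumes "\<And>n. f n \<in> X" "\<And>n. N (f n) \<le> c" "\<And>z. norm z < 1 \<Longrightarrow> (\<lambda>n. f n z) \<longlonglongrightarrow> h z"
    and hol: "h holomorphic_on ball 0 1"
  shows "h \<in> X"
proof (rule X_I[OF hol])
  show "mass h \<le> ennreal (c powr p)"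
    unfolding Lp_mass_def
  proof (rule SUP_least)
    fix i assume i: "i \<in> I"
    note [measurable] = assms(1)[THEN holo_X, THEN measurable_powr_ball]
    let ?u = "\<lambda>f z. ennreal (norm (f z) powr p) * indicator (ball (0::complex) 1) z"
    have lim: "(\<lambda>n. ?u (f n) z) \<longlonglongrightarrow> ?u h z" for z
    proof (cases "norm z < 1")
      case True
      then show ?thesis using assms(3)[OF True] p
        by (auto intro!: tendsto_intros tendsto_powr')
    qed auto
    have "(\<integral>\<^sup>+z. ?u h z \<partial>M i) = (\<integral>\<^sup>+z. liminf (\<lambda>n. ?u (f n) z) \<partial>M i)"
      using lim_imp_Liminf[OF _ lim] by simp
    also have "\<dots> \<le> liminf (\<lambda>n. \<integral>\<^sup>+z. ?u (f n) z \<partial>M i)"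
      by (intro nn_integral_liminf) measurable
    also have "\<dots> \<le> liminf (\<lambda>n. ennreal (c powr p))"
    proof (intro Liminf_mono always_eventually allI)
      fix n
      have "(\<integral>\<^sup>+z. ?u (f n) z \<partial>M i) \<le> mass (f n)"
        unfolding Lp_mass_def using i by (rule SUP_upper)
      also have "\<dots> \<le> ennreal (c powr p)"
        using assms(1,2)[of n] p N_nonneg[of "f n"] by (simp add: mass_eq powr_mono2)
      finally show "(\<integral>\<^sup>+z. ?u (f n) z \<partial>M i) \<le> ennreal (c powr p)" .
    qed
    finally show "(\<integral>\<^sup>+z. ?u h z \<partial>M i) \<le> ennreal (c powr p)" by (simp add: Liminf_const)
  qed
qed

lemma growth: "\<exists>C s. 0 < C \<and> 0 \<le> s \<and> (\<forall>f\<in>X. \<forall>z. norm z < 1 \<longrightarrow> norm (f z) \<le> C * (1 - norm z) powr (- s) * N f)"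
proof -
  obtain C s where C: "0 < C" and *: "\<And>f z. f holomorphic_on ball 0 1 \<Longrightarrow> z \<in> ball 0 1 \<Longrightarrow>
      ennreal (norm (f z) powr p) \<le> ennreal (C * (1 - norm z) powr (- s)) * mass f"
    using evaluation by blast
  \<comment> \<open>The exponent supplied by \<open>evaluation\<close> may have either sign; its
    absolute value makes the bound nondecreasing in \<open>norm z\<close>, as later comparisons of
    radii require.\<close>
  have "norm (f z) \<le> C powr (1 / p) * (1 - norm z) powr (- (\<bar>s\<bar> / p)) * N f" if f: "f \<in> X" and z: "norm z < 1" for f z
  proof -
    have "ennreal (norm (f z) powr p) \<le> ennreal (C * (1 - norm z) powr (- s) * N f powr p)"
      using *[OF holo_X[OF f], of z] z C by (simp add: mass_eq[OF f] ennreal_mult)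
    then have "norm (f z) powr p \<le> C * (1 - norm z) powr (- s) * N f powr p"
      using C by (subst (asm) ennreal_le_iff) auto
    also have "\<dots> \<le> C * (1 - norm z) powr (- \<bar>s\<bar>) * N f powr p"
      using C z by (intro mult_right_mono mult_left_mono powr_mono') auto
    finally have "(norm (f z) powr p) powr (1 / p) \<le> (C * (1 - norm z) powr (- \<bar>s\<bar>) * N f powr p) powr (1 / p)"
      using p by (intro powr_mono2) auto
    also have "\<dots> = C powr (1 / p) * (1 - norm z) powr (- (\<bar>s\<bar> / p)) * N f"
      using p C z N_nonneg[OF f] by (simp add: powr_mult powr_powr)
    finally show ?thesis using p by (simp add: powr_powr)
  qed
  then show ?thesis using C p
    by (intro exI[of _ "C powr (1 / p)"] exI[of _ "\<bar>s\<bar> / p"]) auto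
qed

lemma dilation_X:
  assumes "f \<in> X" "0 < \<rho>" "\<rho> < 1"
  shows "(\<lambda>z. f (of_real \<rho> * z)) \<in> X" "N (\<lambda>z. f (of_real \<rho> * z)) \<le> N f"
proof -
  have hol: "(\<lambda>z. f (of_real \<rho> * z)) holomorphic_on ball 0 1"
    by (rule holomorphic_dilation[OF holo_X[OF assms(1)] assms(2,3)])
  have "mass (\<lambda>z. f (of_real \<rho> * z)) \<le> ennreal (N f powr p)"
    using dilation[OF holo_X[OF assms(1)] assms(2,3)] mass_eq[OF assms(1)] by simp
  from N_le_I[OF hol this N_nonneg[OF assms(1)]]
  show "(\<lambda>z. f (of_real \<rho> * z)) \<in> X" "N (\<lambda>z. f (of_real \<rho> * z)) \<le> N f" .
qed

section \<open>Norms of evaluations and peak functions\<close>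

definition D :: "complex \<Rightarrow> real" where
  "D a = (SUP f\<in>{f \<in> X. N f \<le> 1}. norm (f a))"

lemma zero_X: "(\<lambda>z. 0) \<in> X" "N (\<lambda>z. 0) = 0"
  using scale_X[OF const_X[of 1], of 0] by auto

lemma bdd_D: "norm a < 1 \<Longrightarrow> bdd_above ((\<lambda>f. norm (f a)) ` {f \<in> X. N f \<le> 1})"
proof -
  assume a: "norm a < 1"
  obtain C s where C: "0 < C" and *: "\<forall>f\<in>X. \<forall>z. norm z < 1 \<longrightarrow> norm (f z) \<le> C * (1 - norm z) powr (- s) * N f"
    using growth by blast
  have "norm (f a) \<le> C * (1 - norm a) powr (- s)" if "f \<in> X" "N f \<le> 1" for f
  proof -
    have "norm (f a) \<le> C * (1 - norm a) powr (- s) * N f" using * that a by blast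
    also have "\<dots> \<le> C * (1 - norm a) powr (- s) * 1" using C that by (intro mult_left_mono) auto
    finally show ?thesis by simp
  qed
  then show ?thesis by (auto intro!: bdd_aboveI2)
qed

lemma D_upper: "norm a < 1 \<Longrightarrow> f \<in> X \<Longrightarrow> N f \<le> 1 \<Longrightarrow> norm (f a) \<le> D a"
  unfolding D_def by (rule cSUP_upper[OF _ bdd_D]) auto

lemma D_least: "(\<And>f. f \<in> X \<Longrightarrow> N f \<le> 1 \<Longrightarrow> norm (f a) \<le> c) \<Longrightarrow> D a \<le> c"
  unfolding D_def by (rule cSUP_least) (use zero_X in auto)

lemma evaluation_le_D:
  assumes "norm a < 1" "f \<in> X" shows "norm (f a) \<le> D a * N f"
proof (cases "N f = 0")
  case True
  then show ?thesis using N_zero_imp assms by simp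
next
  case False
  then have pos: "N f > 0" using N_nonneg[OF assms(2)] by linarith
  have "norm (of_real (1 / N f) * f a) \<le> D a"
    using scale_X[OF assms(2), of "of_real (1 / N f)"] pos assms
    by (intro D_upper[of a "\<lambda>z. of_real (1 / N f) * f z"]) (auto simp: norm_divide)
  then show ?thesis using pos by (simp add: norm_mult norm_divide field_simps)
qed

lemma D_pos: assumes "norm a < 1" shows "0 < D a"
proof -
  have "1 \<le> D a * N (\<lambda>z. 1)"
    using evaluation_le_D[OF assms const_X[of 1]] by simp
  then show ?thesis using N_nonneg[OF const_X[of 1]]
    by (smt (verit) mult_nonpos_nonneg)
qed

lemma D_approx:
  assumes "norm a < 1" "c < 1"
  obtains f where "f \<in> X" "N f \<le> 1" "c * D a \<le> norm (f a)"
proof -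
  have "c * D a < D a" using assms D_pos[OF assms(1)] by simp
  then obtain f where "f \<in> {f \<in> X. N f \<le> 1}" "c * D a < norm (f a)"
    unfolding D_def using less_cSUP_iff[OF _ bdd_D[OF assms(1)]] zero_X
    by (metis (mono_tags, lifting) empty_iff mem_Collect_eq zero_le_one)
  then show ?thesis using that by auto
qed

text \<open>A function almost extremal for the evaluation at \<open>a\<close> almost attains the supremum of every
  multiplier there; dilation and the exponential factor localise it near \<open>a / norm a\<close>. The dilation by
  \<open>1 - x powr (s + 2)\<close> keeps the function of polynomial size and changes its value at \<open>a\<close> by \<open>O(x)\<close> only.\<close>
lemma peak_function:
  assumes C: "0 < C" "0 \<le> s" "\<forall>f\<in>X. \<forall>z. norm z < 1 \<longrightarrow> norm (f z) \<le> C * (1 - norm z) powr (- s) * N f"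
    and a: "norm a < 1"
  defines "x \<equiv> 1 - norm a"
  defines "E \<equiv> 1 + 4 * C * 2 powr s * N (\<lambda>z. 1)"
  defines "\<kappa> \<equiv> (1 - E * x) * exp (- sqrt x)"
  assumes small: "x < 1 / 2" "E * x < 1"
  shows "\<exists>\<phi>. \<phi> \<in> X \<and> N \<phi> = 1 \<and>
    (\<forall>h. (\<lambda>z. h z * \<phi> z) \<in> X \<longrightarrow> \<kappa> * norm (h a) \<le> N (\<lambda>z. h z * \<phi> z)) \<and>
    (\<forall>z. norm z < 1 \<longrightarrow> norm (\<phi> z) \<le>
      C * (x powr (s + 2)) powr (- s) * exp (- ((norm (z - a / of_real (norm a)))\<^sup>2 / 2) / sqrt x) / \<kappa>)"
proof -
  define \<rho> where "\<rho> = 1 - x powr (s + 2)"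
  define \<zeta> where "\<zeta> = a / of_real (norm a)"
  have x: "0 < x" "x < 1" using a small by (auto simp: x_def)
  have a0: "a \<noteq> 0" using small by (auto simp: x_def)
  have \<kappa>: "0 < \<kappa>" using x small by (simp add: \<kappa>_def)
  have "x powr (s + 2) \<le> x powr 2" using x C(2) by (intro powr_mono') auto
  also have "\<dots> = x * x" using x by (simp add: powr_numeral power2_eq_square)
  also have "\<dots> < x * (1 / 2)" using x small by (intro mult_strict_left_mono) auto
  finally have xs: "x powr (s + 2) < x / 2" by simp
  have \<rho>: "0 < \<rho>" "\<rho> < 1" "1 - \<rho> = x powr (s + 2)" using xs x by (auto simp: \<rho>_def)
  have \<zeta>: "norm \<zeta> = 1" "cnj \<zeta> * a = of_real (norm a)"
    using a0 by (auto simp: \<zeta>_def norm_divide complex_norm_square[symmetric] field_simps power2_eq_square)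
  obtain f where f: "f \<in> X" "N f \<le> 1" "(1 - x) * D a \<le> norm (f a)"
    using D_approx[OF a, of "1 - x"] x by auto
  \<comment> \<open>The constant \<open>E\<close> collects two losses: 1 from the factor
    \<open>1 - x\<close> of almost extremality, the rest from the dilation. The latter is an
    absolute error, turned into a multiple of \<open>D a\<close> by
    \<open>1 \<le> D a * N (\<lambda>z. 1)\<close>.\<close>
  have fb: "(1 - E * x) * D a \<le> norm (f (of_real \<rho> * a))"
  proof -
    let ?B = "C * (x / 2) powr (- s)"
    have "norm (of_real \<rho> * a - a) = norm (of_real (1 - \<rho>) * a)"
      by (simp add: algebra_simps norm_minus_commute)
    also have "\<dots> = x powr (s + 2) * norm a"
      using \<rho> by (simp only: norm_mult norm_of_real)
    also have "\<dots> \<le> x powr (s + 2)" using a by (simp add: mult_left_le)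
    finally have d: "norm (of_real \<rho> * a - a) \<le> x powr (s + 2)" .
    have sub: "norm z < 1 - x / 2" if "z \<in> ball a (x / 2)" for z
      using that norm_triangle_ineq2[of z a] by (simp add: dist_norm norm_minus_commute x_def field_simps)
    have "norm (f (of_real \<rho> * a) - f a) \<le> 2 * ?B * norm (of_real \<rho> * a - a) / (x / 2)"
    proof (rule holomorphic_lipschitz_center)
      show "f holomorphic_on ball a (x / 2)"
        by (rule holomorphic_on_subset[OF holo_X[OF f(1)]]) (use sub x in force)
      show "of_real \<rho> * a \<in> ball a (x / 2)"
        using d xs by (simp add: dist_norm norm_minus_commute)
      show "norm (f z) \<le> ?B" if "z \<in> ball a (x / 2)" for z
      proof -
        have "norm (f z) \<le> C * (1 - norm z) powr (- s) * N f" using C(3) f(1) sub[OF that] x by auto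
        also have "\<dots> \<le> C * (x / 2) powr (- s) * 1"
          using sub[OF that] x C f N_nonneg by (intro mult_mono powr_mono2') auto
        finally show ?thesis by simp
      qed
    qed (use x in auto)
    also have "\<dots> \<le> 2 * ?B * x powr (s + 2) / (x / 2)"
      using d x C by (intro divide_right_mono mult_left_mono) auto
    \<comment> \<open>The size \<open>x powr (- s)\<close> of \<open>f\<close> near
      \<open>a\<close>, the displacement \<open>x powr (s + 2)\<close> and the radius
      \<open>x / 2\<close> combine to a multiple of \<open>x\<close>; this dictates the exponent
      \<open>s + 2\<close>.\<close>
    also have "\<dots> = 4 * C * 2 powr s * x"
      using x by (simp add: powr_divide powr_minus powr_add field_simps powr_numeral power2_eq_square)
    finally have "norm (f a) \<le> norm (f (of_real \<rho> * a)) + 4 * C * 2 powr s * x"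
      using norm_triangle_ineq3[of "f (of_real \<rho> * a)" "f a"] by linarith
    moreover have "1 \<le> D a * N (\<lambda>z. 1)"
      using evaluation_le_D[OF a const_X[of 1]] by simp
    then have "4 * C * 2 powr s * x * 1 \<le> 4 * C * 2 powr s * x * (D a * N (\<lambda>z. 1))"
      using C x by (intro mult_left_mono) auto
    ultimately show ?thesis using f(3) by (simp add: E_def algebra_simps)
  qed
  \<comment> \<open>The real part of \<open>1 - cnj \<zeta> * z\<close> equals \<open>x\<close> at
    \<open>a\<close> and is at least half the squared distance from \<open>z\<close> to
    \<open>\<zeta>\<close>. Division by the intermediate scale \<open>sqrt x\<close> gives modulus
    \<open>exp (- sqrt x)\<close>, nearly 1, at \<open>a\<close>, but at most
    \<open>exp (- c / sqrt x)\<close> away from \<open>\<zeta>\<close>, which beats every power of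
    \<open>1 / x\<close>.\<close>
  define e where "e = (\<lambda>z. exp (- (1 - cnj \<zeta> * z) / of_real (sqrt x)))"
  define \<phi>0 where "\<phi>0 = (\<lambda>z. e z * f (of_real \<rho> * z))"
  have e_hol: "e holomorphic_on ball 0 1"
    unfolding e_def using x by (intro holomorphic_intros) auto
  have norm_e: "norm (e z) = exp (- Re (1 - cnj \<zeta> * z) / sqrt x)" for z
    by (simp add: e_def Re_divide_of_real)
  have e_le: "norm (e z) \<le> exp (- ((norm (z - \<zeta>))\<^sup>2 / 2) / sqrt x)" if "norm z < 1" for z
  proof -
    define w where "w = cnj \<zeta> * z"
    have w: "norm w < 1" using that \<zeta> by (simp add: w_def norm_mult)
    have "norm (1 - w) = norm (cnj \<zeta> * (\<zeta> - z))"
      using \<zeta> by (simp add: w_def algebra_simps complex_norm_square[symmetric] mult.commute)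
    then have "norm (1 - w) = norm (z - \<zeta>)"
      using \<zeta> by (simp add: norm_mult norm_minus_commute)
    moreover have "(norm (1 - w))\<^sup>2 = 1 - 2 * Re w + (norm w)\<^sup>2"
      unfolding cmod_power2 by (simp add: power2_eq_square algebra_simps)
    moreover have "(norm w)\<^sup>2 \<le> 1" using w by (intro power_le_one) auto
    ultimately have "(norm (z - \<zeta>))\<^sup>2 / 2 \<le> Re (1 - w)" by simp
    then show ?thesis
      unfolding norm_e w_def[symmetric] exp_le_cancel_iff using x by (intro divide_right_mono) auto
  qed
  have e_le1: "norm (e z) \<le> 1" if "norm z < 1" for z
    using e_le[OF that] x by (smt (verit, best) divide_nonneg_nonneg exp_le_one_iff minus_divide_left real_sqrt_ge_zero zero_le_power2)
  have \<phi>0: "\<phi>0 \<in> X" "N \<phi>0 \<le> 1"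
    using mult_X[OF dilation_X(1)[OF f(1) \<rho>(1,2)] e_hol e_le1] dilation_X(2)[OF f(1) \<rho>(1,2)] f(2)
    by (auto simp: \<phi>0_def)
  have "exp (- sqrt x) = norm (e a)"
    unfolding norm_e \<zeta>(2) using x by (simp add: x_def[symmetric] real_div_sqrt)
  moreover have "norm (\<phi>0 a) = norm (e a) * norm (f (of_real \<rho> * a))"
    by (simp add: \<phi>0_def norm_mult)
  ultimately have \<phi>0a: "\<kappa> * D a \<le> norm (\<phi>0 a)"
    using mult_left_mono[OF fb, of "norm (e a)"] by (simp add: \<kappa>_def mult_ac)
  have "\<kappa> * D a \<le> D a * N \<phi>0" using \<phi>0a evaluation_le_D[OF a \<phi>0(1)] by linarith
  then have N\<phi>0: "\<kappa> \<le> N \<phi>0" using D_pos[OF a] by (simp add: mult.commute)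
  define \<phi> where "\<phi> = (\<lambda>z. of_real (1 / N \<phi>0) * \<phi>0 z)"
  have pos: "N \<phi>0 > 0" using N\<phi>0 \<kappa> by linarith
  have \<phi>: "\<phi> \<in> X" "N \<phi> = 1"
    using scale_X[OF \<phi>0(1), of "of_real (1 / N \<phi>0)"] pos by (auto simp: \<phi>_def norm_divide)
  have "\<kappa> * norm (h a) \<le> N (\<lambda>z. h z * \<phi> z)" if h: "(\<lambda>z. h z * \<phi> z) \<in> X" for h
  proof -
    have "\<kappa> * D a \<le> norm (\<phi>0 a) / 1" using \<phi>0a by simp
    also have "\<dots> \<le> norm (\<phi>0 a) / N \<phi>0" using pos \<phi>0 by (intro divide_left_mono) auto
    also have "\<dots> = norm (\<phi> a)" using pos by (simp add: \<phi>_def norm_divide)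
    finally have "norm (h a) * (\<kappa> * D a) \<le> norm (h a) * norm (\<phi> a)"
      by (intro mult_left_mono) auto
    also have "\<dots> \<le> D a * N (\<lambda>z. h z * \<phi> z)"
      using evaluation_le_D[OF a h] by (simp add: norm_mult)
    finally have "D a * (\<kappa> * norm (h a)) \<le> D a * N (\<lambda>z. h z * \<phi> z)" by (simp add: mult_ac)
    then show ?thesis using D_pos[OF a] by simp
  qed
  moreover have "norm (\<phi> z) \<le> C * (x powr (s + 2)) powr (- s) * exp (- ((norm (z - a / of_real (norm a)))\<^sup>2 / 2) / sqrt x) / \<kappa>"
    if z: "norm z < 1" for z
  proof -
    have \<rho>z: "norm (of_real \<rho> * z) \<le> \<rho>" using z \<rho> by (simp add: norm_mult mult_left_le)
    have "norm (f (of_real \<rho> * z)) \<le> C * (1 - norm (of_real \<rho> * z)) powr (- s) * N f"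
      using C(3) f(1) \<rho>z \<rho> by auto
    also have "\<dots> \<le> C * (x powr (s + 2)) powr (- s) * 1"
    proof (intro mult_mono)
      show "(1 - norm (of_real \<rho> * z)) powr (- s) \<le> (x powr (s + 2)) powr (- s)"
        using C(2) \<rho>z \<rho> x by (intro powr_mono2') auto
    qed (use C f N_nonneg in auto)
    finally have 1: "norm (f (of_real \<rho> * z)) \<le> C * (x powr (s + 2)) powr (- s)" by simp
    have "norm (\<phi>0 z) \<le> exp (- ((norm (z - \<zeta>))\<^sup>2 / 2) / sqrt x) * (C * (x powr (s + 2)) powr (- s))"
      unfolding \<phi>0_def norm_mult using e_le[OF z] 1 by (intro mult_mono) auto
    moreover have "norm (\<phi> z) = norm (\<phi>0 z) / N \<phi>0" using pos by (simp add: \<phi>_def norm_divide)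
    ultimately have "norm (\<phi> z) \<le> exp (- ((norm (z - \<zeta>))\<^sup>2 / 2) / sqrt x) * (C * (x powr (s + 2)) powr (- s)) / \<kappa>"
      using frac_le[of _ "norm (\<phi>0 z)" \<kappa> "N \<phi>0"] C(1) \<kappa> N\<phi>0 by simp
    then show ?thesis by (simp add: \<zeta>_def mult_ac)
  qed
  ultimately show ?thesis using \<phi> by blast
qed

section \<open>Sequences concentrating at a boundary point\<close>

definition concentrates :: "(nat \<Rightarrow> complex \<Rightarrow> complex) \<Rightarrow> complex \<Rightarrow> bool" where
  "concentrates \<phi> \<xi> \<longleftrightarrow> (\<forall>\<epsilon>>0. \<forall>\<delta>>0. \<forall>\<^sub>F k in sequentially.
     \<forall>z. norm z < 1 \<longrightarrow> \<epsilon> \<le> dist \<xi> z \<longrightarrow> norm (\<phi> k z) \<le> \<delta>)"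

text \<open>The loss \<open>\<kappa> k\<close> does not depend on the multiplier \<open>h\<close>,
  which later lets one sequence serve all \<open>t\<close>. The shift by \<open>m\<close> skips the
  initial points that are not yet close enough to the boundary to carry a peak function.\<close>

lemma peak_sequence:
  assumes a: "\<And>k. norm (a k) < 1" "a \<longlonglongrightarrow> \<xi>" "norm \<xi> = 1"
  obtains \<phi> \<kappa> and m :: nat where "\<And>k. \<phi> k \<in> X" "\<And>k. N (\<phi> k) = 1"
    "\<And>k. \<exists>B. \<forall>z. norm z < 1 \<longrightarrow> norm (\<phi> k z) \<le> B"
    "concentrates \<phi> \<xi>" "\<kappa> \<longlonglongrightarrow> 1" "\<And>k. 0 < \<kappa> k"
    "\<And>k h. (\<lambda>z. h z * \<phi> k z) \<in> X \<Longrightarrow> \<kappa> k * norm (h (a (k + m))) \<le> N (\<lambda>z. h z * \<phi> k z)"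
proof -
  obtain C s where C: "0 < C" "0 \<le> s" "\<forall>f\<in>X. \<forall>z. norm z < 1 \<longrightarrow> norm (f z) \<le> C * (1 - norm z) powr (- s) * N f"
    using growth by blast
  define E where "E = 1 + 4 * C * 2 powr s * N (\<lambda>z. 1)"
  have "(\<lambda>k. 1 - norm (a k)) \<longlonglongrightarrow> 1 - norm \<xi>" using a by (intro tendsto_intros)
  then have lim0: "(\<lambda>k. 1 - norm (a k)) \<longlonglongrightarrow> 0" using a(3) by simp
  then have "(\<lambda>k. E * (1 - norm (a k))) \<longlonglongrightarrow> E * 0" by (intro tendsto_intros)
  then have "\<forall>\<^sub>F k in sequentially. 1 - norm (a k) < 1 / 2 \<and> E * (1 - norm (a k)) < 1"
    using order_tendstoD(2)[OF lim0, of "1 / 2"] order_tendstoD(2)[of "\<lambda>k. E * (1 - norm (a k))" 0 _ 1]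
    by (auto intro: eventually_conj)
  then obtain m where m: "\<And>k. m \<le> k \<Longrightarrow> 1 - norm (a k) < 1 / 2 \<and> E * (1 - norm (a k)) < 1"
    unfolding eventually_sequentially by blast
  define b where "b = (\<lambda>k. a (k + m))"
  have b: "norm (b k) < 1" "b \<longlonglongrightarrow> \<xi>" for k
    using a by (auto simp: b_def LIMSEQ_ignore_initial_segment)
  define x where "x = (\<lambda>k. 1 - norm (b k))"
  define \<kappa> where "\<kappa> = (\<lambda>k. (1 - E * x k) * exp (- sqrt (x k)))"
  have xpos: "0 < x k" "x k < 1 / 2" "E * x k < 1" for k using b(1)[of k] m[of "k + m"] by (auto simp: x_def b_def)
  have \<kappa>pos: "0 < \<kappa> k" for k using xpos[of k] by (simp add: \<kappa>_def)
  have "\<exists>\<phi>. \<phi> \<in> X \<and> N \<phi> = 1 \<and> (\<forall>h. (\<lambda>z. h z * \<phi> z) \<in> X \<longrightarrow> \<kappa> k * norm (h (b k)) \<le> N (\<lambda>z. h z * \<phi> z)) \<and>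
    (\<forall>z. norm z < 1 \<longrightarrow> norm (\<phi> z) \<le>
      C * (x k powr (s + 2)) powr (- s) * exp (- ((norm (z - b k / of_real (norm (b k))))\<^sup>2 / 2) / sqrt (x k)) / \<kappa> k)" for k
    unfolding \<kappa>_def x_def E_def by (rule peak_function[OF C b(1)]) (use xpos[of k] in \<open>auto simp: x_def E_def\<close>)
  then have "\<exists>\<phi>. \<forall>k. \<phi> k \<in> X \<and> N (\<phi> k) = 1 \<and> (\<forall>h. (\<lambda>z. h z * \<phi> k z) \<in> X \<longrightarrow> \<kappa> k * norm (h (b k)) \<le> N (\<lambda>z. h z * \<phi> k z)) \<and>
    (\<forall>z. norm z < 1 \<longrightarrow> norm (\<phi> k z) \<le>
      C * (x k powr (s + 2)) powr (- s) * exp (- ((norm (z - b k / of_real (norm (b k))))\<^sup>2 / 2) / sqrt (x k)) / \<kappa> k)"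
    by (intro choice allI)
  then obtain \<phi> where \<phi>: "\<And>k. \<phi> k \<in> X" "\<And>k. N (\<phi> k) = 1"
    "\<And>k h. (\<lambda>z. h z * \<phi> k z) \<in> X \<Longrightarrow> \<kappa> k * norm (h (b k)) \<le> N (\<lambda>z. h z * \<phi> k z)"
    and bd: "\<And>k z. norm z < 1 \<Longrightarrow> norm (\<phi> k z) \<le>
      C * (x k powr (s + 2)) powr (- s) * exp (- ((norm (z - b k / of_real (norm (b k))))\<^sup>2 / 2) / sqrt (x k)) / \<kappa> k"
    by blast
  have "x \<longlonglongrightarrow> 0" using LIMSEQ_ignore_initial_segment[OF lim0, of m] by (simp add: x_def b_def)
  then have x0: "filterlim x (at_right 0) sequentially"
    using xpos(1) by (simp add: filterlim_at less_imp_neq[symmetric])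
  have \<kappa>lim: "\<kappa> \<longlonglongrightarrow> 1"
  proof -
    have "((\<lambda>x. (1 - E * x) * exp (- sqrt x)) \<longlongrightarrow> 1) (at_right 0)" by real_asymp
    from filterlim_compose[OF this x0] show ?thesis unfolding \<kappa>_def .
  qed
  have "concentrates \<phi> \<xi>"
    unfolding concentrates_def
  proof (intro allI impI)
    fix \<epsilon> \<delta> :: real assume pos: "0 < \<epsilon>" "0 < \<delta>"
    \<comment> \<open>The peak of \<open>\<phi> k\<close> sits at \<open>b k / norm (b k)\<close>
      instead of \<open>\<xi>\<close>, which costs half of \<open>\<epsilon>\<close>; then
      \<open>c\<close> is half the square of \<open>\<epsilon> / 2\<close>.\<close>
    define c where "c = \<epsilon>\<^sup>2 / 8"
    have c: "0 < c" using pos by (simp add: c_def)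
    define B where "B = (\<lambda>x. C * (x powr (s + 2)) powr (- s) * exp (- c / sqrt x) / ((1 - E * x) * exp (- sqrt x)))"
    \<comment> \<open>Up to factors with finite limits, \<open>B\<close> is a power of
      \<open>1 / x\<close> times \<open>exp (- c / sqrt x)\<close>.\<close>
    have "(B \<longlongrightarrow> 0) (at_right 0)" unfolding B_def using c C by real_asymp
    from filterlim_compose[OF this x0] have "(\<lambda>k. B (x k)) \<longlonglongrightarrow> 0" .
    then have ev1: "\<forall>\<^sub>F k in sequentially. B (x k) < \<delta>"
      using order_tendstoD(2) pos by blast
    have "(\<lambda>k. b k / of_real (norm (b k))) \<longlonglongrightarrow> \<xi> / of_real (norm \<xi>)"
      using a(3) b(2) by (intro tendsto_intros) auto
    then have "(\<lambda>k. b k / of_real (norm (b k))) \<longlonglongrightarrow> \<xi>" using a(3) by simp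
    then have ev2: "\<forall>\<^sub>F k in sequentially. dist (b k / of_real (norm (b k))) \<xi> < \<epsilon> / 2"
      using pos by (intro tendstoD) auto
    show "\<forall>\<^sub>F k in sequentially. \<forall>z. norm z < 1 \<longrightarrow> \<epsilon> \<le> dist \<xi> z \<longrightarrow> norm (\<phi> k z) \<le> \<delta>"
      using ev1 ev2
    proof eventually_elim
      case (elim k)
      show ?case
      proof (intro allI impI)
        fix z :: complex assume z: "norm z < 1" "\<epsilon> \<le> dist \<xi> z"
        let ?d = "norm (z - b k / of_real (norm (b k)))"
        have "\<epsilon> / 2 \<le> ?d"
          using elim(2) z(2) dist_triangle[of \<xi> z "b k / of_real (norm (b k))"]
          by (simp add: dist_norm norm_minus_commute)
        then have "(\<epsilon> / 2)\<^sup>2 \<le> ?d\<^sup>2" using pos by (intro power_mono) auto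
        then have "c \<le> ?d\<^sup>2 / 2" by (simp add: c_def power2_eq_square)
        then have "- (?d\<^sup>2 / 2) / sqrt (x k) \<le> - c / sqrt (x k)"
          using xpos[of k] by (intro divide_right_mono) auto
        then have "C * (x k powr (s + 2)) powr (- s) * exp (- (?d\<^sup>2 / 2) / sqrt (x k)) / \<kappa> k \<le> B (x k)"
          unfolding B_def \<kappa>_def using xpos[of k] C by (intro divide_right_mono mult_left_mono) auto
        with bd[OF z(1), of k] elim(1) show "norm (\<phi> k z) \<le> \<delta>" by linarith
      qed
    qed
  qed
  moreover have "\<exists>B. \<forall>z. norm z < 1 \<longrightarrow> norm (\<phi> k z) \<le> B" for k
  proof (intro exI allI impI)
    fix z :: complex assume z: "norm z < 1"
    have "- ((norm (z - b k / of_real (norm (b k))))\<^sup>2 / 2) / sqrt (x k) \<le> 0"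
      using xpos[of k] by (simp add: divide_nonneg_pos)
    then have "C * (x k powr (s + 2)) powr (- s) * exp (- ((norm (z - b k / of_real (norm (b k))))\<^sup>2 / 2) / sqrt (x k)) / \<kappa> k
      \<le> C * (x k powr (s + 2)) powr (- s) * 1 / \<kappa> k"
      using \<kappa>pos[of k] C xpos[of k] by (intro divide_right_mono mult_left_mono) auto
    with bd[OF z, of k] show "norm (\<phi> k z) \<le> C * (x k powr (s + 2)) powr (- s) * 1 / \<kappa> k" by linarith
  qed
  ultimately show ?thesis using that[of \<phi> \<kappa> m] \<phi> \<kappa>lim \<kappa>pos unfolding b_def by blast
qed

text \<open>Near \<open>\<xi>\<close> the bounded function \<open>S\<close> carries little mass, and
  away from \<open>\<xi>\<close> the function \<open>\<phi> k\<close> is uniformly small, so p-th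
  powers of the norms nearly add. The exact increment would be 1; the second unit absorbs the
  errors, which come to 1/2, 1/4 and 1/4.\<close>

lemma concentrates_add:
  assumes S: "S \<in> X" "\<And>z. norm z < 1 \<Longrightarrow> norm (S z) \<le> B"
    and \<phi>: "\<And>k. \<phi> k \<in> X" "\<And>k. N (\<phi> k) \<le> 1" "concentrates \<phi> \<xi>" "norm \<xi> = 1"
  shows "\<forall>\<^sub>F k in sequentially. \<forall>c. norm c = 1 \<longrightarrow> N (\<lambda>z. S z + c * \<phi> k z) powr p \<le> N S powr p + 2"
proof -
  have B: "0 \<le> B" using S(2)[of 0] norm_ge_zero[of "S 0"] by (simp del: norm_ge_zero)
  define n where "n = N S powr p"
  have n: "0 \<le> n" by (simp add: n_def)
  have "((\<lambda>s. (1 - s) powr (1 - p)) \<longlongrightarrow> (1 - 0) powr (1 - p)) (at_right 0)"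
    by (intro tendsto_intros) auto
  \<comment> \<open>With this threshold \<open>a * (n + 1)\<close> exceeds \<open>n + 1\<close> by
    at most 1/2.\<close>
  then have "\<forall>\<^sub>F s in at_right 0. (1 - s) powr (1 - p) < 1 + 1 / (2 * (n + 1))"
    using n by (intro order_tendstoD(2)) auto
  moreover have "\<forall>\<^sub>F s in at_right (0::real). s < 1"
    by real_asymp
  moreover have "\<forall>\<^sub>F s in at_right (0::real). 0 < s"
    by (rule eventually_at_right_less)
  ultimately have "\<forall>\<^sub>F s in at_right 0. (1 - s) powr (1 - p) < 1 + 1 / (2 * (n + 1)) \<and> s < 1 \<and> 0 < s"
    by eventually_elim auto
  then obtain s where s: "(1 - s) powr (1 - p) < 1 + 1 / (2 * (n + 1))" "s < 1" "0 < s"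
    using eventually_happens'[OF trivial_limit_at_right_real] by blast
  define a where "a = (1 - s) powr (1 - p)"
  define q where "q = s powr (1 - p)"
  have q: "0 < q" and a: "0 \<le> a" using s by (auto simp: q_def a_def)
  obtain K0 where K0: "\<forall>i\<in>I. emeasure (M i) (ball 0 1) \<le> ennreal K0"
    using finite_mass by blast
  define K where "K = \<bar>K0\<bar> + 1"
  have K: "0 < K" "\<And>i. i \<in> I \<Longrightarrow> emeasure (M i) (ball 0 1) \<le> ennreal K"
  proof -
    fix i assume "i \<in> I"
    with K0 have "emeasure (M i) (ball 0 1) \<le> ennreal K0" by blast
    also have "\<dots> \<le> ennreal K" by (intro ennreal_leI) (simp add: K_def)
    finally show "emeasure (M i) (ball 0 1) \<le> ennreal K" .
  qed (simp add: K_def)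
  \<comment> \<open>\<open>\<eta>\<close> and, below, \<open>\<delta>\<close> are tuned so that
    \<open>S\<close> near \<open>\<xi>\<close> and \<open>\<phi> k\<close> away from it contribute
    at most 1/4 each. The summand 1 keeps the denominator positive and the bound valid when
    \<open>B = 0\<close>.\<close>
  define \<eta> where "\<eta> = 1 / (4 * (q * B powr p + 1))"
  have \<eta>: "0 < \<eta>" using q by (simp add: \<eta>_def add_nonneg_pos)
  have c\<eta>: "q * B powr p * \<eta> \<le> 1 / 4"
    using q unfolding \<eta>_def by (simp add: divide_simps add_nonneg_pos)
  obtain \<epsilon> where \<epsilon>: "0 < \<epsilon>" "\<And>i. i \<in> I \<Longrightarrow> emeasure (M i) (ball 0 1 \<inter> ball \<xi> \<epsilon>) \<le> ennreal \<eta>"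
    using small_mass[OF \<phi>(4) \<eta>] by blast
  define \<delta> where "\<delta> = (1 / (4 * q * K)) powr (1 / p)"
  have \<delta>: "0 < \<delta>" "\<delta> powr p = 1 / (4 * q * K)" using q K p by (auto simp: \<delta>_def powr_powr)
  have d\<delta>: "q * \<delta> powr p * K = 1 / 4" using q K by (simp add: \<delta>(2))
  have "\<forall>\<^sub>F k in sequentially. \<forall>z. norm z < 1 \<longrightarrow> \<epsilon> \<le> dist \<xi> z \<longrightarrow> norm (\<phi> k z) \<le> \<delta>"
    using \<phi>(3) \<epsilon>(1) \<delta>(1) unfolding concentrates_def by blast
  then show ?thesis
  proof eventually_elim
    case (elim k)
    show ?case
    proof (intro allI impI)
      fix c :: complex assume c: "norm c = 1"
      let ?u = "\<lambda>z. S z + c * \<phi> k z"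
      have uX: "?u \<in> X" using add_X(1)[OF S(1) scale_X(1)[OF \<phi>(1)]] .
      have ineq: "norm (v + w) powr p \<le> a * norm v powr p + q * b powr p" if "norm w \<le> b" for v w :: complex and b
      proof -
        have "norm (v + w) powr p \<le> (norm v + b) powr p"
          using p that norm_triangle_ineq[of v w] by (intro powr_mono2) auto
        also have "\<dots> \<le> a * norm v powr p + q * b powr p"
          unfolding a_def q_def using p s order_trans[OF norm_ge_zero that] by (intro powr_add_le_weighted) auto
        finally show ?thesis .
      qed
      have "mass ?u \<le> ennreal a * mass S + ennreal a * mass (\<phi> k) + ennreal (q * B powr p) * ennreal \<eta>
          + ennreal (q * \<delta> powr p) * ennreal K"
      proof (rule mass_le[where A = "ball \<xi> \<epsilon>"])
        fix z :: complex assume z: "norm z < 1"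
        show "norm (?u z) powr p \<le> a * norm (S z) powr p + a * norm (\<phi> k z) powr p
          + q * B powr p * indicator (ball \<xi> \<epsilon>) z + q * \<delta> powr p"
        \<comment> \<open>Near \<open>\<xi>\<close> the term with \<open>\<phi> k\<close> is the
          main one and \<open>S\<close> the perturbation; elsewhere the roles are exchanged.\<close>
        proof (cases "z \<in> ball \<xi> \<epsilon>")
          case True
          have "norm (c * \<phi> k z + S z) powr p \<le> a * norm (c * \<phi> k z) powr p + q * B powr p"
            by (rule ineq[OF S(2)[OF z]])
          moreover have "0 \<le> a * norm (S z) powr p" "0 \<le> q * \<delta> powr p" using a q by auto
          ultimately show ?thesis using True c by (simp add: norm_mult add.commute)
        next
          case False
          then have "norm (c * \<phi> k z) \<le> \<delta>" using elim z c by (simp add: norm_mult)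
          then have "norm (S z + c * \<phi> k z) powr p \<le> a * norm (S z) powr p + q * \<delta> powr p"
            by (rule ineq)
          moreover have "0 \<le> a * norm (\<phi> k z) powr p" using a by auto
          ultimately show ?thesis using False by simp
        qed
      qed (use S \<phi> a q \<epsilon>(2) K(2) holo_X in auto)
      also have "\<dots> = ennreal (a * n + a * N (\<phi> k) powr p + q * B powr p * \<eta> + q * \<delta> powr p * K)"
        using a n q \<eta> K(1) S(1) \<phi>(1)[of k] by (simp add: mass_eq ennreal_plus ennreal_mult n_def)
      finally have "N ?u powr p \<le> a * n + a * N (\<phi> k) powr p + q * B powr p * \<eta> + q * \<delta> powr p * K"
        unfolding mass_eq[OF uX] using a n q \<eta> K(1) by (subst (asm) ennreal_le_iff) auto
      also have "\<dots> \<le> a * n + a * 1 + 1 / 4 + 1 / 4"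
        using c\<eta> d\<delta> a \<phi>(2)[of k] p N_nonneg[OF \<phi>(1)[of k]] powr_le1[of p "N (\<phi> k)"]
        by (intro add_mono mult_left_mono) auto
      also have "\<dots> \<le> (1 + 1 / (2 * (n + 1))) * (n + 1) + 1 / 2"
        using s(1) n mult_right_mono[of a "1 + 1 / (2 * (n + 1))" "n + 1"] by (simp add: a_def algebra_simps)
      also have "\<dots> = n + 2" using n by (simp add: field_simps)
      finally show "N ?u powr p \<le> N S powr p + 2" by (simp add: n_def)
    qed
  qed
qed

text \<open>Since the \<open>\<phi> k\<close> have asymptotically disjoint supports, a functional that is not small on them
  would grow like \<open>m\<close> on a sum of \<open>m\<close> terms, whose norm is only of order \<open>m powr (1 / p)\<close>.\<close>
lemma concentrates_imp_weakly_null: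
  assumes \<phi>: "\<And>k. \<phi> k \<in> X" "\<And>k. N (\<phi> k) \<le> 1" "concentrates \<phi> \<xi>" "norm \<xi> = 1"
    and bdd: "\<And>k. \<exists>B. \<forall>z. norm z < 1 \<longrightarrow> norm (\<phi> k z) \<le> B"
  shows "weakly_null X N \<phi>"
  unfolding weakly_null_def
proof (intro conjI allI impI \<phi>(1))
  fix L assume L: "bounded_functional X N L"
  then have lin: "\<And>f h a b. f \<in> X \<Longrightarrow> h \<in> X \<Longrightarrow> L (\<lambda>z. a * f z + b * h z) = a * L f + b * L h"
    unfolding bounded_functional_def by blast
  obtain C where C: "\<And>f. f \<in> X \<Longrightarrow> norm (L f) \<le> C * N f"
    using L unfolding bounded_functional_def by blast
  show "(\<lambda>n. L (\<phi> n)) \<longlonglongrightarrow> 0"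
  proof (rule ccontr)
    assume "\<not> ?thesis"
    then obtain d where d: "0 < d" and fr: "\<not> (\<forall>\<^sub>F k in sequentially. norm (L (\<phi> k)) < d)"
      unfolding tendsto_iff by (auto simp: dist_norm)
    have step: "\<exists>S\<in>X. (\<exists>B. \<forall>z. norm z < 1 \<longrightarrow> norm (S z) \<le> B) \<and> N S powr p \<le> 2 * real m \<and>
        (\<exists>l. L S = of_real l \<and> real m * d \<le> l)" for m :: nat
    proof (induction m)
      case 0
      have "L (\<lambda>z. 0) = 0" using C[OF zero_X(1)] zero_X(2) by simp
      then show ?case using zero_X by (intro bexI[of _ "\<lambda>z. 0"]) auto
    next
      case (Suc m)
      then obtain S B l where S: "S \<in> X" "\<And>z. norm z < 1 \<Longrightarrow> norm (S z) \<le> B" "N S powr p \<le> 2 * real m"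
        "L S = of_real l" "real m * d \<le> l" by blast
      \<comment> \<open>Values of modulus at least \<open>d\<close> occur for infinitely many
        \<open>k\<close>, while the norm estimate holds for all but finitely many.\<close>
      have "\<exists>k. d \<le> norm (L (\<phi> k)) \<and> (\<forall>c. norm c = 1 \<longrightarrow> N (\<lambda>z. S z + c * \<phi> k z) powr p \<le> N S powr p + 2)"
      proof (rule ccontr)
        assume neg: "\<not> ?thesis"
        have "\<forall>\<^sub>F k in sequentially. \<forall>c. norm c = 1 \<longrightarrow> N (\<lambda>z. S z + c * \<phi> k z) powr p \<le> N S powr p + 2"
          by (rule concentrates_add[OF S(1) _ \<phi>]) (use S(2) in auto)
        then have "\<forall>\<^sub>F k in sequentially. norm (L (\<phi> k)) < d"
          by eventually_elim (use neg in force)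
        then show False using fr by blast
      qed
      then obtain k where k: "d \<le> norm (L (\<phi> k))"
        "\<And>c. norm c = 1 \<Longrightarrow> N (\<lambda>z. S z + c * \<phi> k z) powr p \<le> N S powr p + 2" by blast
      \<comment> \<open>This phase turns \<open>L (\<phi> k)\<close> into its modulus, so the
        contributions to \<open>L S\<close> cannot cancel. It depends on \<open>k\<close>, hence the
        uniformity in \<open>c\<close> of the norm estimate.\<close>
      define c where "c = cnj (sgn (L (\<phi> k)))"
      have ne: "L (\<phi> k) \<noteq> 0" using k(1) d by auto
      have c: "norm c = 1" "c * L (\<phi> k) = of_real (norm (L (\<phi> k)))"
        using ne complex_norm_square[of "L (\<phi> k)"]
        by (simp_all add: c_def norm_sgn sgn_eq norm_divide field_simps power2_eq_square)
      obtain B' where B': "\<And>z. norm z < 1 \<Longrightarrow> norm (\<phi> k z) \<le> B'" using bdd by blast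
      have "L (\<lambda>z. 1 * S z + c * \<phi> k z) = 1 * L S + c * L (\<phi> k)" by (rule lin[OF S(1) \<phi>(1)])
      then have "L (\<lambda>z. S z + c * \<phi> k z) = of_real (l + norm (L (\<phi> k)))" using c S(4) by simp
      moreover have "real (Suc m) * d \<le> l + norm (L (\<phi> k))" using S(5) k(1) by (simp add: algebra_simps)
      moreover have "norm (S z + c * \<phi> k z) \<le> B + B'" if "norm z < 1" for z
        using norm_triangle_ineq[of "S z" "c * \<phi> k z"] S(2)[OF that] B'[OF that] c by (simp add: norm_mult)
      moreover have "N (\<lambda>z. S z + c * \<phi> k z) powr p \<le> 2 * real (Suc m)"
        using k(2)[OF c(1)] S(3) by simp
      ultimately show ?case
        using add_X(1)[OF S(1) scale_X(1)[OF \<phi>(1)]]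
        by (intro bexI[of _ "\<lambda>z. S z + c * \<phi> k z"] conjI exI[of _ "B + B'"] exI[of _ "l + norm (L (\<phi> k))"]) auto
    qed
    have bound: "real m * d \<le> \<bar>C\<bar> * (2 * real m) powr (1 / p)" for m
    proof -
      obtain S l where S: "S \<in> X" "N S powr p \<le> 2 * real m" "L S = of_real l" "real m * d \<le> l"
        using step[of m] by blast
      have "N S = (N S powr p) powr (1 / p)" using p N_nonneg[OF S(1)] by (simp add: powr_powr)
      also have "\<dots> \<le> (2 * real m) powr (1 / p)" using S(2) p by (intro powr_mono2) auto
      finally have NS: "N S \<le> (2 * real m) powr (1 / p)" .
      have "real m * d \<le> norm (L S)" using S(3,4) by simp
      also have "\<dots> \<le> C * N S" by (rule C[OF S(1)])
      also have "\<dots> \<le> \<bar>C\<bar> * N S" using N_nonneg[OF S(1)] by (intro mult_right_mono) auto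
      also have "\<dots> \<le> \<bar>C\<bar> * (2 * real m) powr (1 / p)" using NS by (intro mult_left_mono) auto
      finally show ?thesis .
    qed
    have p1: "1 / p < 1" using p by simp
    have "((\<lambda>m. \<bar>C\<bar> * (2 * real m) powr (1 / p) / real m) \<longlongrightarrow> 0) sequentially"
      using p1 p by real_asymp
    then have "\<forall>\<^sub>F m in sequentially. \<bar>C\<bar> * (2 * real m) powr (1 / p) / real m < d"
      using d by (intro order_tendstoD(2)) auto
    moreover have "\<forall>\<^sub>F m in sequentially. 0 < m" by (rule eventually_gt_at_top)
    ultimately have "\<forall>\<^sub>F m in sequentially. False"
      by eventually_elim (use bound in \<open>simp add: field_simps not_less[symmetric]\<close>)
    then show False by simp
  qed
qed

end

section \<open>Multiplication operators\<close>

definition sup_disk :: "(complex \<Rightarrow> complex) \<Rightarrow> real" where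
  "sup_disk h = (SUP z\<in>ball 0 1. norm (h z))"

lemma Hinf_bdd: "h \<in> Hinf \<Longrightarrow> bdd_above ((\<lambda>z. norm (h z)) ` ball 0 1)"
  unfolding Hinf_def by (auto intro: bdd_aboveI2)

lemma norm_le_sup_disk: "h \<in> Hinf \<Longrightarrow> norm z < 1 \<Longrightarrow> norm (h z) \<le> sup_disk h"
  unfolding sup_disk_def by (rule cSUP_upper[OF _ Hinf_bdd]) auto

lemma sup_disk_nonneg: "h \<in> Hinf \<Longrightarrow> 0 \<le> sup_disk h"
  using norm_le_sup_disk[of h 0] norm_ge_zero order_trans by (metis norm_zero zero_less_one)

text \<open>Points where \<open>norm (h z)\<close> is nearly maximal may lie deep inside the disk.
  By the maximum principle every larger circle contains a point with the same lower bound, so the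
  points can be moved to the boundary; compactness makes them converge.\<close>

lemma Hinf_boundary_sequence:
  assumes h: "h \<in> Hinf"
  obtains a \<xi> where "\<And>k. norm (a k) < 1" "a \<longlonglongrightarrow> \<xi>" "norm \<xi> = 1"
    "(\<lambda>k. norm (h (a k))) \<longlonglongrightarrow> sup_disk h"
proof -
  have hol: "h holomorphic_on ball 0 1" using h by (simp add: Hinf_def)
  \<comment> \<open>The summand 2 keeps the tolerance below 1 from the start, so that the radii
    \<open>r\<close> below are positive.\<close>
  let ?e = "\<lambda>k::nat. 1 / (real k + 2)"
  have "\<exists>z. norm z < 1 \<and> 1 - ?e k \<le> norm z \<and> sup_disk h - ?e k \<le> norm (h z)" for k :: nat
  proof -
    have e: "0 < ?e k" "?e k < 1" by auto
    then have "sup_disk h - ?e k < sup_disk h" by linarith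
    then obtain w where w: "norm w < 1" "sup_disk h - ?e k < norm (h w)"
      unfolding sup_disk_def using less_cSUP_iff[OF _ Hinf_bdd[OF h]] by fastforce
    define r where "r = max (norm w) (1 - ?e k)"
    have r: "0 < r" "r < 1" "norm w \<le> r" "1 - ?e k \<le> r" using w(1) e by (auto simp: r_def less_max_iff_disj simp del: divide_less_eq_1_pos)
    have "\<exists>z. norm z = r \<and> sup_disk h - ?e k \<le> norm (h z)"
    proof (rule ccontr)
      assume neg: "\<not> ?thesis"
      have "norm (h w) \<le> sup_disk h - ?e k"
      proof (rule maximum_modulus_frontier[of h "cball 0 r"])
        show "h holomorphic_on interior (cball 0 r)"
          using r by (intro holomorphic_on_subset[OF hol]) auto
        show "continuous_on (closure (cball 0 r)) h"
          using r by (intro continuous_on_subset[OF holomorphic_on_imp_continuous_on[OF hol]]) auto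
      qed (use neg r in \<open>auto simp: not_le dest: less_imp_le\<close>)
      then show False using w by linarith
    qed
    then show ?thesis using r by auto
  qed
  then obtain z where z: "\<And>k. norm (z k) < 1" "\<And>k. 1 - ?e k \<le> norm (z k)" "\<And>k. sup_disk h - ?e k \<le> norm (h (z k))"
    by metis
  have e0: "?e \<longlonglongrightarrow> 0" by real_asymp
  have "\<And>k. z k \<in> cball 0 1" using z(1) by (auto intro: less_imp_le)
  then obtain \<xi> r where r: "strict_mono r" "(z \<circ> r) \<longlonglongrightarrow> \<xi>"
    using compact_cball[of "0::complex" 1] unfolding compact_def by metis
  have "(\<lambda>k. norm (z k)) \<longlonglongrightarrow> 1"
  proof (rule tendsto_sandwich[OF _ _ _ tendsto_const])
    show "(\<lambda>k. 1 - ?e k) \<longlonglongrightarrow> 1" using tendsto_diff[OF tendsto_const[of "1::real"] e0] by simp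
  qed (use z in \<open>auto intro!: always_eventually less_imp_le\<close>)
  then have "((\<lambda>k. norm (z k)) \<circ> r) \<longlonglongrightarrow> 1" by (rule LIMSEQ_subseq_LIMSEQ[OF _ r(1)])
  moreover have "((\<lambda>k. norm (z k)) \<circ> r) \<longlonglongrightarrow> norm \<xi>" using tendsto_norm[OF r(2)] by (simp add: o_def)
  ultimately have \<xi>: "norm \<xi> = 1" using LIMSEQ_unique by blast
  have "(\<lambda>k. norm (h (z k))) \<longlonglongrightarrow> sup_disk h"
  proof (rule tendsto_sandwich[OF _ _ _ tendsto_const])
    show "(\<lambda>k. sup_disk h - ?e k) \<longlonglongrightarrow> sup_disk h" using tendsto_diff[OF tendsto_const[of "sup_disk h"] e0] by simp
  qed (use z norm_le_sup_disk[OF h] in auto)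
  then have "((\<lambda>k. norm (h (z k))) \<circ> r) \<longlonglongrightarrow> sup_disk h" by (rule LIMSEQ_subseq_LIMSEQ[OF _ r(1)])
  then show ?thesis using that[of "z \<circ> r" \<xi>] z(1) r(2) \<xi> by (simp add: o_def)
qed

context disk_space
begin

lemma Hinf_mult:
  assumes "h \<in> Hinf" "f \<in> X"
  shows "(\<lambda>z. h z * f z) \<in> X" "N (\<lambda>z. h z * f z) \<le> sup_disk h * N f"
  using mult_X[OF assms(2) _ norm_le_sup_disk[OF assms(1)] sup_disk_nonneg[OF assms(1)]] assms(1)
  by (auto simp: Hinf_def)

text \<open>Peak functions along a boundary sequence for \<open>h\<close> attain the trivial upper
  bound. Stating the lemma for an operator \<open>T\<close> covers both the single multipliers and
  the integrated one.\<close>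

lemma wn_sup_Hinf:
  assumes h: "h \<in> Hinf" and T: "\<And>f. f \<in> X \<Longrightarrow> T f = (\<lambda>z. h z * f z)"
  shows "wn_sup X N T = ennreal (sup_disk h)"
proof (rule antisym)
  show "wn_sup X N T \<le> ennreal (sup_disk h)"
    unfolding wn_sup_def
  proof (intro SUP_least)
    fix f assume f: "f \<in> W0_sphere X N"
    then have fX: "\<And>n. f n \<in> X" "\<And>n. N (f n) = 1" by (auto simp: W0_sphere_def weakly_null_def)
    have "limsup (\<lambda>n. ennreal (N (T (f n)))) \<le> limsup (\<lambda>n. ennreal (sup_disk h))"
      using Hinf_mult(2)[OF h fX(1)] fX T by (intro Limsup_mono always_eventually allI ennreal_leI) simp
    then show "limsup (\<lambda>n. ennreal (N (T (f n)))) \<le> ennreal (sup_disk h)"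
      by (simp add: Limsup_const)
  qed
  obtain a \<xi> where a: "\<And>k. norm (a k) < 1" "a \<longlonglongrightarrow> \<xi>" "norm \<xi> = 1"
    "(\<lambda>k. norm (h (a k))) \<longlonglongrightarrow> sup_disk h" using Hinf_boundary_sequence[OF h] by metis
  obtain \<phi> \<kappa> m where \<phi>: "\<And>k. \<phi> k \<in> X" "\<And>k. N (\<phi> k) = 1"
    "\<And>k. \<exists>B. \<forall>z. norm z < 1 \<longrightarrow> norm (\<phi> k z) \<le> B"
    "concentrates \<phi> \<xi>" "\<kappa> \<longlonglongrightarrow> 1" "\<And>k. 0 < \<kappa> k"
    "\<And>k h. (\<lambda>z. h z * \<phi> k z) \<in> X \<Longrightarrow> \<kappa> k * norm (h (a (k + m))) \<le> N (\<lambda>z. h z * \<phi> k z)"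
    using peak_sequence[OF a(1-3)] by blast
  have "\<phi> \<in> W0_sphere X N"
    unfolding W0_sphere_def using concentrates_imp_weakly_null[OF \<phi>(1) _ \<phi>(4) a(3) \<phi>(3)] \<phi>(2) by auto
  then have "limsup (\<lambda>k. ennreal (N (T (\<phi> k)))) \<le> wn_sup X N T"
    unfolding wn_sup_def by (rule SUP_upper)
  moreover have "(\<lambda>k. \<kappa> k * norm (h (a (k + m)))) \<longlonglongrightarrow> 1 * sup_disk h"
    by (intro tendsto_mult \<phi>(5) LIMSEQ_ignore_initial_segment[OF a(4)])
  then have "(\<lambda>k. ennreal (\<kappa> k * norm (h (a (k + m))))) \<longlonglongrightarrow> ennreal (sup_disk h)"
    by simp
  then have "ennreal (sup_disk h) = limsup (\<lambda>k. ennreal (\<kappa> k * norm (h (a (k + m)))))"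
    using lim_imp_Limsup[of sequentially] by fastforce
  moreover have "\<dots> \<le> limsup (\<lambda>k. ennreal (N (T (\<phi> k))))"
    using \<phi>(7)[OF Hinf_mult(1)[OF h \<phi>(1)]] T \<phi>(1) by (intro Limsup_mono always_eventually allI ennreal_leI) simp
  ultimately show "ennreal (sup_disk h) \<le> wn_sup X N T" by (metis order_trans)
qed

text \<open>A gliding hump: signs are chosen so that the partial sums do not cancel at the points where
  \<open>G\<close> is large.\<close>
lemma multiplier_bounded:
  assumes Q: "\<And>f. f \<in> X \<Longrightarrow> \<exists>q. \<forall>z. norm z < 1 \<longrightarrow> norm (G z * f z) \<le> D z * q"
  shows "\<exists>B. \<forall>z. norm z < 1 \<longrightarrow> norm (G z) \<le> B"
proof (rule ccontr)
  assume "\<not> ?thesis"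
  \<comment> \<open>The power of 3 compensates the damping of the n-th hump; the extra factor
    \<open>n\<close> is what produces the contradiction.\<close>
  then have "\<forall>n::nat. \<exists>z. norm z < 1 \<and> real n * 3 ^ n < norm (G z)" by (metis not_le)
  then obtain w where w: "\<And>n. norm (w n) < 1" "\<And>n. real n * 3 ^ n < norm (G (w n))" by metis
  have "\<forall>n. \<exists>f. f \<in> X \<and> N f \<le> 1 \<and> 3 / 4 * D (w n) \<le> norm (f (w n))"
  proof
    fix n
    show "\<exists>f. f \<in> X \<and> N f \<le> 1 \<and> 3 / 4 * D (w n) \<le> norm (f (w n))"
      by (rule D_approx[OF w(1), of "3 / 4" n]) auto
  qed
  then obtain f where f: "\<And>n. f n \<in> X" "\<And>n. N (f n) \<le> 1" "\<And>n. 3 / 4 * D (w n) \<le> norm (f n (w n))" by metis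
  \<comment> \<open>Whatever the value \<open>u\<close> of the partial sum at \<open>w n\<close> and
    the new term \<open>v\<close> are, one of \<open>u + v\<close> and \<open>u - v\<close> has
    modulus at least that of \<open>v\<close>.\<close>
  define \<sigma> where "\<sigma> = (\<lambda>n u. if norm ((1 / 3) ^ n * f n (w n)) \<le> norm (u (w n) + (1 / 3) ^ n * f n (w n)) then 1 else - 1 :: complex)"
  define x where "x = rec_nat (\<lambda>z. 0) (\<lambda>n u z. u z + \<sigma> n u * (1 / 3) ^ n * f n z)"
  have x0: "x 0 = (\<lambda>z. 0)" by (simp add: x_def)
  have xS: "x (Suc n) = (\<lambda>z. x n z + \<sigma> n (x n) * (1 / 3) ^ n * f n z)" for n by (simp add: x_def)
  have \<sigma>: "norm (\<sigma> n u) = 1" for n u by (simp add: \<sigma>_def)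
  have hump: "norm ((1 / 3) ^ n * f n (w n)) \<le> norm (x (Suc n) (w n))" for n
  proof -
    let ?u = "x n (w n)" let ?v = "(1 / 3) ^ n * f n (w n)"
    have "norm (?v + ?v) \<le> norm (?u + ?v) + norm (?u - ?v)"
      using norm_triangle_ineq4[of "?u + ?v" "?u - ?v"] by (simp add: algebra_simps)
    then have "2 * norm ?v \<le> norm (?u + ?v) + norm (?u - ?v)"
      by (metis mult_2 norm_mult norm_numeral)
    then show ?thesis unfolding xS \<sigma>_def by (auto simp: mult.assoc)
  qed
  have xX: "x n \<in> X \<and> N (x n) \<le> (3 - 3 * (1 / 3) ^ n) / 2" for n
  proof (induction n)
    case 0 then show ?case using zero_X x0 by simp
  next
    case (Suc n)
    have "N (\<lambda>z. (\<sigma> n (x n) * (1 / 3) ^ n) * f n z) = (1 / 3) ^ n * N (f n)"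
      using scale_X(2)[OF f(1), of "\<sigma> n (x n) * (1 / 3) ^ n" n] \<sigma> by (simp add: norm_mult norm_power norm_divide)
    also have "\<dots> \<le> (1 / 3) ^ n * 1" using f(2) by (intro mult_left_mono) auto
    finally have "N (x (Suc n)) \<le> N (x n) + (1 / 3) ^ n" "x (Suc n) \<in> X"
      using add_X[OF conjunct1[OF Suc] scale_X(1)[OF f(1), of "\<sigma> n (x n) * (1 / 3) ^ n" n]]
      unfolding xS by linarith+
    then show ?case using Suc by simp
  qed
  have diff: "norm (\<sigma> n (x n) * (1 / 3) ^ n * f n z) \<le> (1 / 3) ^ n * D z" if "norm z < 1" for n z
    using D_upper[OF that f(1,2)] \<sigma> by (simp add: norm_mult norm_power norm_divide divide_right_mono power_divide)
  have xsum: "x n z = (\<Sum>i<n. \<sigma> i (x i) * (1 / 3) ^ i * f i z)" for n z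
    by (induction n) (auto simp: x0 xS)
  define F where "F = (\<lambda>z. \<Sum>i. \<sigma> i (x i) * (1 / 3) ^ i * f i z)"
  \<comment> \<open>\<open>D\<close> majorises the humps, so the series converges uniformly wherever
    \<open>D\<close> is bounded: on singletons, which gives the values of \<open>F\<close>, and on
    small closed disks, which gives holomorphy.\<close>
  have unif: "uniform_limit A x F sequentially"
    if "\<And>z. z \<in> A \<Longrightarrow> norm z < 1 \<and> D z \<le> c" for A c
  proof -
    have "uniform_limit A (\<lambda>n z. \<Sum>i<n. \<sigma> i (x i) * (1 / 3) ^ i * f i z) F sequentially"
      unfolding F_def
    proof (rule Weierstrass_m_test)
      show "summable (\<lambda>n. (1 / 3) ^ n * c)" by (intro summable_mult2 summable_geometric) auto
      show "norm (\<sigma> n (x n) * (1 / 3) ^ n * f n z) \<le> (1 / 3) ^ n * c" if "z \<in> A" for n z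
        using \<open>\<And>z. z \<in> A \<Longrightarrow> norm z < 1 \<and> D z \<le> c\<close>[OF that]
        by (intro order_trans[OF diff mult_left_mono]) auto
    qed
    then show ?thesis unfolding xsum[symmetric] .
  qed
  have lim: "(\<lambda>n. x n z) \<longlonglongrightarrow> F z" if "norm z < 1" for z
    using tendsto_uniform_limitI[OF unif[of "{z}" "D z"], of z] that by auto
  have Fhol: "F holomorphic_on ball 0 1"
  proof (rule holomorphic_uniform_sequence[OF open_ball])
    show "x n holomorphic_on ball 0 1" for n using xX holo_X by blast
    fix z0 :: complex assume z0: "z0 \<in> ball 0 1"
    obtain C s where C: "0 < C" "0 \<le> s" "\<forall>f\<in>X. \<forall>z. norm z < 1 \<longrightarrow> norm (f z) \<le> C * (1 - norm z) powr (- s) * N f"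
      using growth by blast
    define d where "d = (1 - norm z0) / 2"
    have d: "0 < d" "norm z0 + d < 1" "1 - norm z0 - d = d" using z0 by (auto simp: d_def field_simps)
    have "norm z < 1 \<and> D z \<le> C * d powr (- s)" if "z \<in> cball z0 d" for z
    proof
      have nz: "norm z \<le> norm z0 + d" using that norm_triangle_ineq2[of z z0] by (simp add: dist_norm norm_minus_commute)
      then show z1: "norm z < 1" using d by linarith
      show "D z \<le> C * d powr (- s)"
      proof (rule D_least)
        fix u assume u: "u \<in> X" "N u \<le> 1"
        have "norm (u z) \<le> C * (1 - norm z) powr (- s) * N u" using C u z1 by blast
        also have "\<dots> \<le> C * d powr (- s) * 1"
          using C u nz d N_nonneg by (intro mult_mono powr_mono2') auto
        finally show "norm (u z) \<le> C * d powr (- s)" by simp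
      qed
    qed
    then have "uniform_limit (cball z0 d) x F sequentially" by (rule unif)
    moreover have "cball z0 d \<subseteq> ball 0 1"
    proof
      fix z assume "z \<in> cball z0 d"
      then have "norm z \<le> norm z0 + d" using norm_triangle_ineq2[of z z0] by (simp add: dist_norm norm_minus_commute)
      then show "z \<in> ball 0 1" using d by simp
    qed
    ultimately show "\<exists>d>0. cball z0 d \<subseteq> ball 0 1 \<and> uniform_limit (cball z0 d) x F sequentially"
      using d(1) by blast
  qed
  have Nx: "N (x n) \<le> 3 / 2" for n
  proof -
    have "(3 - 3 * (1 / 3) ^ n) / 2 \<le> (3 / 2 :: real)" by simp
    then show ?thesis using xX[of n] by linarith
  qed
  have FX: "F \<in> X" by (rule limit_X[OF conjunct1[OF xX] Nx lim Fhol])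
  then obtain q where q: "\<And>z. norm z < 1 \<Longrightarrow> norm (G z * F z) \<le> D z * q" using Q by blast
  have tail: "norm (x (Suc n + m) z - x (Suc n) z) \<le> D z * ((1 / 3) ^ n - (1 / 3) ^ (n + m)) / 2" if "norm z < 1" for n m z
  proof (induction m)
    case (Suc m)
    have "norm (x (Suc n + Suc m) z - x (Suc n) z) \<le> norm (x (Suc n + m) z - x (Suc n) z) + (1 / 3) ^ (Suc n + m) * D z"
      using diff[OF that, of "Suc n + m"] norm_triangle_ineq[of "x (Suc n + m) z - x (Suc n) z" "\<sigma> (Suc n + m) (x (Suc n + m)) * (1 / 3) ^ (Suc n + m) * f (Suc n + m) z"]
      by (simp add: xS add_diff_eq diff_add_eq)
    also have "\<dots> \<le> D z * ((1 / 3) ^ n - (1 / 3) ^ (n + m)) / 2 + (1 / 3) ^ (Suc n + m) * D z"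
      using Suc by simp
    also have "\<dots> = D z * ((1 / 3) ^ n - (1 / 3) ^ (n + Suc m)) / 2" by (simp add: field_simps)
    finally show ?case .
  qed simp
  have "real n \<le> 4 * q" for n
  proof -
    let ?z = "w n"
    have Dp: "0 < D ?z" using D_pos[OF w(1)] .
    have "(\<lambda>m. x (Suc n + m) ?z) \<longlonglongrightarrow> F ?z"
      using LIMSEQ_ignore_initial_segment[OF lim[OF w(1)[of n]], of "Suc n"] by (simp add: add.commute)
    then have "(\<lambda>m. norm (x (Suc n + m) ?z - x (Suc n) ?z)) \<longlonglongrightarrow> norm (F ?z - x (Suc n) ?z)"
      by (intro tendsto_intros)
    moreover have "norm (x (Suc n + m) ?z - x (Suc n) ?z) \<le> D ?z * (1 / 3) ^ n / 2" for m
    proof -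
      have "D ?z * ((1 / 3) ^ n - (1 / 3) ^ (n + m)) \<le> D ?z * (1 / 3) ^ n"
        using Dp by (intro mult_left_mono) auto
      then show ?thesis using tail[OF w(1), of n m n] by linarith
    qed
    ultimately have "norm (F ?z - x (Suc n) ?z) \<le> D ?z * (1 / 3) ^ n / 2"
      by (intro LIMSEQ_le_const2) auto
    moreover have "(1 / 3) ^ n * (3 / 4 * D ?z) \<le> norm (x (Suc n) ?z)"
    proof -
      have "(1 / 3) ^ n * (3 / 4 * D ?z) \<le> (1 / 3) ^ n * norm (f n ?z)"
        using f(3) by (intro mult_left_mono) auto
      also have "\<dots> = norm ((1 / 3) ^ n * f n ?z)" by (simp add: norm_mult norm_power norm_divide)
      finally show ?thesis using hump by (meson order_trans)
    qed
    \<comment> \<open>In units of \<open>(1 / 3) ^ n * D (w n)\<close> the partial sum including the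
      n-th hump has modulus at least 3/4 at \<open>w n\<close>, and all later humps together at most
      1/2, since the geometric tail of ratio 1/3 sums to 1/2. A quarter remains.\<close>
    ultimately have "(1 / 3) ^ n * D ?z / 4 \<le> norm (F ?z)"
      using norm_triangle_ineq3[of "F ?z" "x (Suc n) ?z"] by (simp add: algebra_simps)
    then have "norm (G ?z) * ((1 / 3) ^ n * D ?z / 4) \<le> norm (G ?z) * norm (F ?z)" by (intro mult_left_mono) auto
    also have "\<dots> \<le> D ?z * q" using q[OF w(1)] by (simp add: norm_mult)
    finally have "D ?z * (norm (G ?z) * (1 / 3) ^ n / 4) \<le> D ?z * q" by (simp add: mult_ac)
    then have "norm (G ?z) * (1 / 3) ^ n \<le> 4 * q" using Dp by simp
    moreover have "real n * 3 ^ n * (1 / 3) ^ n \<le> norm (G ?z) * (1 / 3) ^ n"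
      using w(2)[of n] by (intro mult_right_mono) auto
    moreover have "real n * 3 ^ n * (1 / 3) ^ n = real n" by (simp add: power_divide)
    ultimately show ?thesis by linarith
  qed
  then show False using reals_Archimedean2[of "4 * q"] by (meson not_le)
qed

end

section \<open>The integral of a family of multipliers\<close>

lemma set_nn_integral_eq_integral:
  fixes f :: "'a::euclidean_space \<Rightarrow> real"
  assumes "\<And>x. x \<in> S \<Longrightarrow> 0 \<le> f x" "f integrable_on S"
  shows "(\<integral>\<^sup>+x\<in>S. ennreal (f x) \<partial>lborel) = ennreal (integral S f)"
proof -
  have "(\<integral>\<^sup>+x\<in>S. ennreal (f x) \<partial>lborel) = (\<integral>\<^sup>+x. ennreal (indicator S x * f x) \<partial>lborel)"
    by (intro nn_integral_cong) (auto simp: indicator_def)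
  also have "\<dots> = ennreal (integral S f)"
    using nn_integral_has_integral_lebesgue[OF assms(1) integrable_integral[OF assms(2)]] by simp
  finally show ?thesis .
qed

locale multiplier_family = disk_space +
  fixes g :: "real \<Rightarrow> complex \<Rightarrow> complex"
  assumes gH: "\<And>t. 0 < t \<Longrightarrow> t < 1 \<Longrightarrow> g t \<in> Hinf"
    and W: "W_cond X N g"
begin

definition G :: "complex \<Rightarrow> complex" where
  "G z = integral {0<..<1} (\<lambda>t. g t z)"

text \<open>True at every point, even where the integral over \<open>t\<close> does not exist: both
  sides then have the default value 0.\<close>

lemma int_mult_op_eq: "int_mult_op g f = (\<lambda>z. G z * f z)"
  by (simp add: int_mult_op_def mult_op_def G_def)

lemma mult_op_X: "0 < t \<Longrightarrow> t < 1 \<Longrightarrow> f \<in> X \<Longrightarrow> mult_op (g t) f \<in> X"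
  unfolding mult_op_def by (rule Hinf_mult(1)[OF gH])

lemma norm_integrable: "f \<in> X \<Longrightarrow> (\<lambda>t. N (mult_op (g t) f)) integrable_on {0<..<1}"
  using W unfolding W_cond_def by blast

lemma norm_nonneg: "f \<in> X \<Longrightarrow> 0 < t \<Longrightarrow> t < 1 \<Longrightarrow> 0 \<le> N (mult_op (g t) f)"
  using N_nonneg mult_op_X by blast

lemma diff_tendsto:
  assumes "f \<in> X" "0 < t" "t < 1"
  shows "((\<lambda>u. N (\<lambda>z. mult_op (g u) f z - mult_op (g t) f z)) \<longlongrightarrow> 0) (at t within {0<..<1})"
  using W assms unfolding W_cond_def by auto

lemma norm_continuous: "f \<in> X \<Longrightarrow> continuous_on {0<..<1} (\<lambda>t. N (mult_op (g t) f))"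
  unfolding continuous_on
proof
  fix t :: real assume f: "f \<in> X" and "t \<in> {0<..<1}"
  then have t: "0 < t" "t < 1" by auto
  have "((\<lambda>u. N (mult_op (g u) f) - N (mult_op (g t) f)) \<longlongrightarrow> 0) (at t within {0<..<1})"
  proof (rule Lim_null_comparison[OF _ diff_tendsto[OF f t]])
    show "\<forall>\<^sub>F u in at t within {0<..<1}. norm (N (mult_op (g u) f) - N (mult_op (g t) f))
        \<le> N (\<lambda>z. mult_op (g u) f z - mult_op (g t) f z)"
      unfolding eventually_at_filter
      by (rule always_eventually) (use diff_X(3)[OF mult_op_X[OF _ _ f] mult_op_X[OF t f]] in auto)
  qed
  then show "((\<lambda>u. N (mult_op (g u) f)) \<longlongrightarrow> N (mult_op (g t) f)) (at t within {0<..<1})"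
    by (rule LIM_zero_cancel)
qed

lemma g_X: "0 < t \<Longrightarrow> t < 1 \<Longrightarrow> g t \<in> X"
  using mult_op_X[OF _ _ const_X[of 1]] by (simp add: mult_op_def)

text \<open>The constant 1 lies in \<open>X\<close>, so the hypothesis applied to it says that
  \<open>g t\<close> itself varies continuously in norm; evaluations pass this on to single
  points.\<close>

lemma g_continuous:
  assumes z: "norm z < 1" shows "continuous_on {0<..<1} (\<lambda>t. g t z)"
  unfolding continuous_on
proof
  fix t :: real assume "t \<in> {0<..<1}"
  then have t: "0 < t" "t < 1" by auto
  have lim: "((\<lambda>u. D z * N (\<lambda>z. g u z - g t z)) \<longlongrightarrow> D z * 0) (at t within {0<..<1})"
    using diff_tendsto[OF const_X[of 1] t] by (intro tendsto_intros) (simp add: mult_op_def)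
  have "((\<lambda>u. g u z - g t z) \<longlongrightarrow> 0) (at t within {0<..<1})"
  proof (rule Lim_null_comparison)
    show "\<forall>\<^sub>F u in at t within {0<..<1}. norm (g u z - g t z) \<le> D z * N (\<lambda>z. g u z - g t z)"
      unfolding eventually_at_filter
      by (rule always_eventually) (use evaluation_le_D[OF z diff_X(1)[OF g_X g_X[OF t]]] in auto)
  qed (use lim in simp)
  then show "((\<lambda>u. g u z) \<longlongrightarrow> g t z) (at t within {0<..<1})"
    by (rule LIM_zero_cancel)
qed

lemma norm_g_mult_le:
  assumes "norm z < 1" "f \<in> X" "0 < t" "t < 1"
  shows "norm (g t z * f z) \<le> D z * N (mult_op (g t) f)"
  using evaluation_le_D[OF assms(1) mult_op_X[OF assms(3,4,2)]] by (simp add: mult_op_def)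

lemma g_abs_integrable:
  assumes z: "norm z < 1" shows "(\<lambda>t. g t z) absolutely_integrable_on {0<..<1}"
proof (rule measurable_bounded_by_integrable_imp_absolutely_integrable)
  show "(\<lambda>t. g t z) \<in> borel_measurable (lebesgue_on {0<..<1})"
    by (intro continuous_imp_measurable_on_sets_lebesgue g_continuous z) auto
  show "(\<lambda>t. D z * N (mult_op (g t) (\<lambda>z. 1))) integrable_on {0<..<1}"
    by (intro integrable_on_mult_right norm_integrable const_X)
  show "norm (g t z) \<le> D z * N (mult_op (g t) (\<lambda>z. 1))" if "t \<in> {0<..<1}" for t
    using norm_g_mult_le[OF z const_X[of 1], of t] that by simp
qed auto

lemma norm_G_le_nn:
  assumes z: "norm z < 1"
  shows "ennreal (norm (G z)) \<le> (\<integral>\<^sup>+t\<in>{0<..<1}. ennreal (norm (g t z)) \<partial>lborel)"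
proof -
  have i: "(\<lambda>t. norm (g t z)) integrable_on {0<..<1}" "(\<lambda>t. g t z) integrable_on {0<..<1}"
    using g_abs_integrable[OF z] by (auto simp: absolutely_integrable_on_def)
  have "norm (G z) \<le> integral {0<..<1} (\<lambda>t. norm (g t z))"
    unfolding G_def by (rule integral_norm_bound_integral[OF i(2,1)]) auto
  then show ?thesis
    by (subst set_nn_integral_eq_integral[OF _ i(1)]) (auto intro: ennreal_leI)
qed

lemma norm_G_mult_le:
  assumes z: "norm z < 1" and f: "f \<in> X"
  shows "norm (G z * f z) \<le> D z * integral {0<..<1} (\<lambda>t. N (mult_op (g t) f))"
proof -
  have i: "(\<lambda>t. g t z * f z) integrable_on {0<..<1}"
    using g_abs_integrable[OF z] by (intro integrable_on_mult_left) (auto simp: absolutely_integrable_on_def)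
  have "norm (integral {0<..<1} (\<lambda>t. g t z * f z)) \<le> integral {0<..<1} (\<lambda>t. D z * N (mult_op (g t) f))"
    using norm_g_mult_le[OF z f]
    by (intro integral_norm_bound_integral i integrable_on_mult_right norm_integrable f) auto
  then show ?thesis by (simp add: G_def)
qed

text \<open>Differentiation under the integral by dominated convergence of difference quotients. A
  dominating function is called for because \<open>g t\<close> may become unbounded as
  \<open>t\<close> approaches 0 or 1; only integrability of its norm is given.\<close>

lemma G_holomorphic: "G holomorphic_on ball 0 1"
proof -
  obtain C s where C: "0 < C" "0 \<le> s" "\<forall>f\<in>X. \<forall>z. norm z < 1 \<longrightarrow> norm (f z) \<le> C * (1 - norm z) powr (- s) * N f"
    using growth by blast
  have "\<exists>G'. (G has_field_derivative G') (at z0)" if "z0 \<in> ball 0 1" for z0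
  proof -
    define d where "d = (1 - norm z0) / 2"
    have d: "0 < d" "norm z0 + d < 1" "1 - norm z0 - d = d" using that by (auto simp: d_def field_simps)
    \<comment> \<open>A bound for \<open>g t\<close> on the whole of \<open>ball z0 d\<close>, whose
      points keep distance at least \<open>d\<close> from the unit circle; integrable in
      \<open>t\<close> by the hypothesis for the constant function 1.\<close>
    define B where "B = (\<lambda>t. C * d powr (- s) * N (mult_op (g t) (\<lambda>z. 1)))"
    have nz: "norm z < norm z0 + d" if "z \<in> ball z0 d" for z
      using that norm_triangle_ineq2[of z z0] by (simp add: dist_norm norm_minus_commute)
    have sub: "ball z0 d \<subseteq> ball 0 1" using nz d by force
    have gB: "norm (g t z) \<le> B t" if "z \<in> ball z0 d" "t \<in> {0<..<1}" for t z
    proof -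
      have "norm (g t z) \<le> C * (1 - norm z) powr (- s) * N (g t)"
        using C g_X[of t] that nz[OF that(1)] d by auto
      also have "\<dots> \<le> C * d powr (- s) * N (g t)"
        using C nz[OF that(1)] d N_nonneg[OF g_X[of t]] that
        by (intro mult_right_mono mult_left_mono powr_mono2') auto
      finally show ?thesis by (simp add: B_def mult_op_def)
    qed
    have ghol: "g t holomorphic_on ball z0 d" if "t \<in> {0<..<1}" for t
      using holo_X[OF g_X[of t]] that sub by (auto intro: holomorphic_on_subset)
    have gi: "(\<lambda>t. g t z) integrable_on {0<..<1}" if "z \<in> ball z0 d" for z
      using g_abs_integrable[of z] that sub by (auto simp: absolutely_integrable_on_def)
    have "((\<lambda>z. (G z - G z0) / (z - z0)) \<longlongrightarrow> integral {0<..<1} (\<lambda>t. deriv (g t) z0)) (at z0 within ball z0 d)"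
      unfolding tendsto_at_iff_sequentially
    proof (intro allI impI)
      fix w :: "nat \<Rightarrow> complex"
      assume w: "\<forall>i. w i \<in> ball z0 d - {z0}" "w \<longlonglongrightarrow> z0"
      have eq: "((\<lambda>z. (G z - G z0) / (z - z0)) \<circ> w) = (\<lambda>k. integral {0<..<1} (\<lambda>t. (g t (w k) - g t z0) / (w k - z0)))"
      proof
        fix k
        have "integral {0<..<1} (\<lambda>t. (g t (w k) - g t z0) / (w k - z0)) = integral {0<..<1} (\<lambda>t. g t (w k) - g t z0) / (w k - z0)"
          by (rule integral_divide)
        also have "\<dots> = (G (w k) - G z0) / (w k - z0)"
          unfolding G_def using w d by (subst integral_diff[OF gi gi]) auto
        finally show "((\<lambda>z. (G z - G z0) / (z - z0)) \<circ> w) k = integral {0<..<1} (\<lambda>t. (g t (w k) - g t z0) / (w k - z0))"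
          by (simp only: o_def)
      qed
      show "((\<lambda>z. (G z - G z0) / (z - z0)) \<circ> w) \<longlonglongrightarrow> integral {0<..<1} (\<lambda>t. deriv (g t) z0)"
        unfolding eq
      proof (rule dominated_convergence(2))
        show "(\<lambda>t. (g t (w k) - g t z0) / (w k - z0)) integrable_on {0<..<1}" for k
          using w d by (intro integrable_on_divide integrable_diff gi) auto
        show "(\<lambda>t. 2 * B t / d) integrable_on {0<..<1}"
          unfolding B_def by (intro integrable_on_divide integrable_on_mult_right norm_integrable const_X)
        show "norm ((g t (w k) - g t z0) / (w k - z0)) \<le> 2 * B t / d" if t: "t \<in> {0<..<1}" for k t
        proof -
          have wk: "w k \<in> ball z0 d" "w k \<noteq> z0" using w by auto
          have "norm (g t (w k) - g t z0) \<le> 2 * B t * norm (w k - z0) / d"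
            by (rule holomorphic_lipschitz_center[OF ghol[OF t] gB[OF _ t] wk(1) d(1)])
          then show ?thesis using wk(2) d by (simp add: norm_divide field_simps)
        qed
        show "(\<lambda>k. (g t (w k) - g t z0) / (w k - z0)) \<longlonglongrightarrow> deriv (g t) z0" if t: "t \<in> {0<..<1}" for t
        proof -
          have "(g t has_field_derivative deriv (g t) z0) (at z0)"
            using holomorphic_derivI[OF ghol[OF t] open_ball] d by simp
          then have "((\<lambda>z. (g t z - g t z0) / (z - z0)) \<longlongrightarrow> deriv (g t) z0) (at z0)"
            by (simp add: has_field_derivative_iff)
          moreover have "filterlim w (at z0) sequentially"
            using w by (auto simp: filterlim_at)
          ultimately show ?thesis by (rule filterlim_compose)
        qed
      qed
    qed
    then have "(G has_field_derivative integral {0<..<1} (\<lambda>t. deriv (g t) z0)) (at z0 within ball z0 d)"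
      by (simp add: has_field_derivative_iff)
    then show ?thesis using at_within_open[of z0 "ball z0 d"] d by auto
  qed
  then show ?thesis by (metis holomorphic_on_open open_ball)
qed

abbreviation "S t \<equiv> sup_disk (g t)"

text \<open>By continuity of each \<open>g t\<close> the supremum may be taken over a countable
  dense set of points, and for each point the dependence on \<open>t\<close> is continuous.\<close>

lemma S_measurable: "(\<lambda>t. ennreal (S t) * indicator {0<..<1} t) \<in> borel_measurable borel"
proof -
  obtain A :: "complex set" where A: "countable A" "A \<subseteq> ball 0 1" "ball 0 1 \<subseteq> closure A"
    using separable by metis
  have A0: "A \<noteq> {}" using A(3) by auto
  have eq: "ennreal (S t) * indicator {0<..<1} t = (SUP z\<in>A. ennreal (norm (g t z)) * indicator {0<..<1} t)" for t
  proof (cases "t \<in> {0<..<1}")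
    case True
    then have t: "g t \<in> Hinf" using gH by simp
    have "norm (g t z) \<le> c" if c: "\<And>a. a \<in> A \<Longrightarrow> norm (g t a) \<le> c" and z: "norm z < 1" for z c
    proof -
      have cont: "continuous_on (ball 0 1) (\<lambda>z. norm (g t z))"
        using t by (auto simp: Hinf_def intro!: continuous_intros holomorphic_on_imp_continuous_on)
      obtain a where a: "\<And>n. a n \<in> A" "a \<longlonglongrightarrow> z"
        using A(3) z by (force simp: closure_sequential)
      have "(\<lambda>n. norm (g t (a n))) \<longlonglongrightarrow> norm (g t z)"
        using continuous_on_tendsto_compose[OF cont a(2)] subsetD[OF A(2) a(1)] z by auto
      then show ?thesis using c a(1) by (intro LIMSEQ_le_const2) auto
    qed
    note dense = this
    have "ennreal (S t) = (SUP z\<in>A. ennreal (norm (g t z)))"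
    proof (rule antisym)
      have "norm (g t z) \<le> enn2real (SUP z\<in>A. ennreal (norm (g t z)))" if "norm z < 1" for z
      proof (rule dense[OF _ that])
        have "(SUP z\<in>A. ennreal (norm (g t z))) \<le> ennreal (S t)"
          using A(2) norm_le_sup_disk[OF t] by (intro SUP_least ennreal_leI) auto
        then have fin: "(SUP z\<in>A. ennreal (norm (g t z))) < top"
          by (rule order_le_less_trans) simp
        fix a assume "a \<in> A"
        then have "ennreal (norm (g t a)) \<le> (SUP z\<in>A. ennreal (norm (g t z)))" by (rule SUP_upper)
        then have "enn2real (ennreal (norm (g t a))) \<le> enn2real (SUP z\<in>A. ennreal (norm (g t z)))"
          by (intro enn2real_mono fin)
        then show "norm (g t a) \<le> enn2real (SUP z\<in>A. ennreal (norm (g t z)))" by simp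
      qed
      then have "S t \<le> enn2real (SUP z\<in>A. ennreal (norm (g t z)))"
        unfolding sup_disk_def by (intro cSUP_least) auto
      then have "ennreal (S t) \<le> ennreal (enn2real (SUP z\<in>A. ennreal (norm (g t z))))" by (rule ennreal_leI)
      also have "\<dots> \<le> (SUP z\<in>A. ennreal (norm (g t z)))"
        by (metis ennreal_enn2real_if linorder_linear top.extremum zero_le)
      finally show "ennreal (S t) \<le> (SUP z\<in>A. ennreal (norm (g t z)))" .
      show "(SUP z\<in>A. ennreal (norm (g t z))) \<le> ennreal (S t)"
        using A(2) norm_le_sup_disk[OF t] by (intro SUP_least ennreal_leI) auto
    qed
    then show ?thesis using True by simp
  qed (use A0 in auto)
  have m: "(\<lambda>t. ennreal (norm (g t z)) * indicator {0<..<1} t) \<in> borel_measurable borel" if "z \<in> A" for z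
  proof -
    have "(\<lambda>t. indicator {0<..<1} t *\<^sub>R g t z) \<in> borel_measurable borel"
      using that A(2) by (intro borel_measurable_continuous_on_indicator g_continuous) auto
    then have "(\<lambda>t. ennreal (norm (indicator {0<..<1} t *\<^sub>R g t z))) \<in> borel_measurable borel" by measurable
    also have "(\<lambda>t. ennreal (norm (indicator {0<..<1} t *\<^sub>R g t z))) = (\<lambda>t. ennreal (norm (g t z)) * indicator {0<..<1} t)"
      by (auto simp: indicator_def)
    finally show ?thesis .
  qed
  show ?thesis unfolding eq by (rule borel_measurable_SUP[OF A(1) m])
qed

lemma wn_sup_mult: "0 < t \<Longrightarrow> t < 1 \<Longrightarrow> wn_sup X N (mult_op (g t)) = ennreal (S t)"
  by (rule wn_sup_Hinf[OF gH]) (auto simp: mult_op_def)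

definition R :: ennreal where
  "R = (\<integral>\<^sup>+t\<in>{0<..<1}. wn_sup X N (mult_op (g t)) \<partial>lborel)"

lemma R_eq: "R = (\<integral>\<^sup>+t\<in>{0<..<1}. ennreal (S t) \<partial>lborel)"
  unfolding R_def by (intro nn_integral_cong) (auto simp: indicator_def wn_sup_mult)

lemma norm_G_le_R: assumes z: "norm z < 1" shows "ennreal (norm (G z)) \<le> R"
proof -
  have "(\<integral>\<^sup>+t\<in>{0<..<1}. ennreal (norm (g t z)) \<partial>lborel) \<le> R"
    unfolding R_eq
  proof (rule nn_integral_mono)
    fix t :: real
    show "ennreal (norm (g t z)) * indicator {0<..<1} t \<le> ennreal (S t) * indicator {0<..<1} t"
      using norm_le_sup_disk[OF gH z, of t] by (cases "t \<in> {0<..<1}") (auto intro: ennreal_leI)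
  qed
  then show ?thesis using norm_G_le_nn[OF z] by (rule order_trans[rotated])
qed

lemma G_Hinf: "G \<in> Hinf"
proof -
  have "\<exists>B. \<forall>z. norm z < 1 \<longrightarrow> norm (G z) \<le> B"
  proof (rule multiplier_bounded)
    fix f assume f: "f \<in> X"
    show "\<exists>q. \<forall>z. norm z < 1 \<longrightarrow> norm (G z * f z) \<le> D z * q"
      using norm_G_mult_le[OF _ f] by blast
  qed
  then obtain B where "\<And>z. norm z < 1 \<Longrightarrow> norm (G z) \<le> B" by blast
  then have "\<forall>z\<in>ball 0 1. norm (G z) \<le> B" by simp
  then show ?thesis using G_holomorphic unfolding Hinf_def by blast
qed

lemma wn_sup_int: "wn_sup X N (int_mult_op g) = ennreal (sup_disk G)"
  by (rule wn_sup_Hinf[OF G_Hinf]) (simp add: int_mult_op_eq)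

lemma wn_sup_int_le: "wn_sup X N (int_mult_op g) \<le> R"
proof (cases "R = top")
  case False
  then have fin: "R < top" by (simp add: less_top)
  have "norm (G z) \<le> enn2real R" if "norm z < 1" for z
    using enn2real_mono[OF norm_G_le_R[OF that] fin] by simp
  then have "sup_disk G \<le> enn2real R" unfolding sup_disk_def by (intro cSUP_least) auto
  then have "ennreal (sup_disk G) \<le> ennreal (enn2real R)" by (rule ennreal_leI)
  then show ?thesis using fin by (simp add: wn_sup_int)
qed simp

lemma nn_norm_eq:
  assumes "f \<in> X"
  shows "(\<integral>\<^sup>+t\<in>{0<..<1}. ennreal (N (mult_op (g t) f)) \<partial>lborel) = ennreal (integral {0<..<1} (\<lambda>t. N (mult_op (g t) f)))"
  using norm_nonneg[OF assms] by (intro set_nn_integral_eq_integral norm_integrable assms) auto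

section \<open>The case of equality\<close>

definition extremal :: "(nat \<Rightarrow> complex \<Rightarrow> complex) \<Rightarrow> bool" where
  "extremal \<phi> \<longleftrightarrow> weakly_null X N \<phi> \<and> (\<forall>n. N (\<phi> n) = 1) \<and>
     (\<exists>L. (\<lambda>n. N (int_mult_op g (\<phi> n))) \<longlonglongrightarrow> L \<and>
          (\<lambda>n. integral {0<..<1} (\<lambda>t. N (mult_op (g t) (\<phi> n)))) \<longlonglongrightarrow> L) \<and>
     (AE t in lborel. t \<in> {0<..<1} \<longrightarrow>
        liminf (\<lambda>n. ennreal (N (mult_op (g t) (\<phi> n)))) = wn_sup X N (mult_op (g t)))"

text \<open>Fatou's lemma bounds \<open>R\<close> by the common limit \<open>L\<close>, so that
  \<open>R\<close> is finite. In turn \<open>\<phi>\<close> itself competes in the supremum on the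
  right, which is therefore at least \<open>L\<close>.\<close>

lemma extremal_imp_le:
  assumes "extremal \<phi>" shows "R \<le> wn_sup X N (int_mult_op g)"
proof -
  obtain L where L: "(\<lambda>n. N (int_mult_op g (\<phi> n))) \<longlonglongrightarrow> L"
    "(\<lambda>n. integral {0<..<1} (\<lambda>t. N (mult_op (g t) (\<phi> n)))) \<longlonglongrightarrow> L"
    and wn: "weakly_null X N \<phi>" "\<And>n. N (\<phi> n) = 1"
    and ae: "AE t in lborel. t \<in> {0<..<1} \<longrightarrow>
        liminf (\<lambda>n. ennreal (N (mult_op (g t) (\<phi> n)))) = wn_sup X N (mult_op (g t))"
    using assms unfolding extremal_def by blast
  have X: "\<And>n. \<phi> n \<in> X" using wn by (simp add: weakly_null_def)
  let ?u = "\<lambda>n t. ennreal (N (mult_op (g t) (\<phi> n))) * indicator {0<..<1} t"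
  have m: "?u n \<in> borel_measurable lborel" for n
  proof -
    have "(\<lambda>t. indicator {0<..<1} t *\<^sub>R N (mult_op (g t) (\<phi> n))) \<in> borel_measurable borel"
      by (intro borel_measurable_continuous_on_indicator norm_continuous X) auto
    then have "(\<lambda>t. ennreal (indicator {0<..<1} t *\<^sub>R N (mult_op (g t) (\<phi> n)))) \<in> borel_measurable borel" by measurable
    also have "(\<lambda>t. ennreal (indicator {0<..<1} t *\<^sub>R N (mult_op (g t) (\<phi> n)))) = ?u n"
      by (auto simp: indicator_def)
    finally show ?thesis by simp
  qed
  have "R = (\<integral>\<^sup>+t. liminf (\<lambda>n. ?u n t) \<partial>lborel)"
    unfolding R_def
  proof (rule nn_integral_cong_AE)
    show "AE t in lborel. wn_sup X N (mult_op (g t)) * indicator {0<..<1} t = liminf (\<lambda>n. ?u n t)"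
      using ae by eventually_elim (auto simp: indicator_def Liminf_const)
  qed
  also have "\<dots> \<le> liminf (\<lambda>n. integral\<^sup>N lborel (?u n))" by (rule nn_integral_liminf[OF m])
  also have "\<dots> = liminf (\<lambda>n. ennreal (integral {0<..<1} (\<lambda>t. N (mult_op (g t) (\<phi> n)))))"
    using nn_norm_eq[OF X] by simp
  also have "\<dots> = ennreal L" using L(2) by (intro lim_imp_Liminf tendsto_ennrealI) auto
  also have "\<dots> = limsup (\<lambda>n. ennreal (N (int_mult_op g (\<phi> n))))"
    using L(1) by (intro lim_imp_Limsup[symmetric] tendsto_ennrealI) auto
  also have "\<dots> \<le> wn_sup X N (int_mult_op g)"
    unfolding wn_sup_def using wn by (intro SUP_upper) (auto simp: W0_sphere_def)
  finally show ?thesis .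
qed

lemma concentrates_imp_approx_eval_map:
  assumes "\<And>k. \<phi> k \<in> X" "\<And>k. N (\<phi> k) = 1" "concentrates \<phi> \<xi>" "norm \<xi> = 1"
  shows "approx_eval_map X N \<phi>"
  unfolding approx_eval_map_def
proof (intro conjI exI[of _ \<xi>] allI impI assms)
  fix \<epsilon> :: real assume \<epsilon>: "0 < \<epsilon>"
  show "(\<lambda>n. SUP z\<in>ball 0 1 - ball \<xi> \<epsilon>. ennreal (norm (\<phi> n z))) \<longlonglongrightarrow> 0"
  proof (rule order_tendstoI)
    fix c :: ennreal assume "0 < c"
    then obtain d where d: "0 < d" "d < c" using dense by blast
    then have dt: "d < top" using less_top order_less_le_trans top_greatest by blast
    define \<delta> where "\<delta> = enn2real d"
    have \<delta>: "0 < \<delta>" "ennreal \<delta> = d" using d dt by (auto simp: \<delta>_def enn2real_positive_iff)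
    have "\<forall>\<^sub>F k in sequentially. \<forall>z. norm z < 1 \<longrightarrow> \<epsilon> \<le> dist \<xi> z \<longrightarrow> norm (\<phi> k z) \<le> \<delta>"
      using assms(3) \<epsilon> \<delta>(1) unfolding concentrates_def by blast
    then show "\<forall>\<^sub>F n in sequentially. (SUP z\<in>ball 0 1 - ball \<xi> \<epsilon>. ennreal (norm (\<phi> n z))) < c"
    proof eventually_elim
      case (elim k)
      have "(SUP z\<in>ball 0 1 - ball \<xi> \<epsilon>. ennreal (norm (\<phi> k z))) \<le> ennreal \<delta>"
        using elim by (intro SUP_least ennreal_leI) auto
      then show ?case using d \<delta>(2) by simp
    qed
  qed simp
qed

lemma equality_imp_extremal:
  assumes eq: "wn_sup X N (int_mult_op g) = R"
  shows "\<exists>\<phi>. extremal \<phi> \<and> approx_eval_map X N \<phi>"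
proof -
  define \<Gamma> where "\<Gamma> = sup_disk G"
  have \<Gamma>0: "0 \<le> \<Gamma>" using sup_disk_nonneg[OF G_Hinf] by (simp add: \<Gamma>_def)
  \<comment> \<open>Boundedness of \<open>G\<close> enters here: \<open>R\<close> is finite, so the
    functions of \<open>t\<close> below are integrable and can be subtracted.\<close>
  have R: "R = ennreal \<Gamma>" using eq by (simp add: wn_sup_int \<Gamma>_def)
  obtain a \<xi> where a: "\<And>k. norm (a k) < 1" "a \<longlonglongrightarrow> \<xi>" "norm \<xi> = 1"
    "(\<lambda>k. norm (G (a k))) \<longlonglongrightarrow> \<Gamma>" using Hinf_boundary_sequence[OF G_Hinf] unfolding \<Gamma>_def by metis
  obtain \<psi> \<kappa> m where \<psi>: "\<And>k. \<psi> k \<in> X" "\<And>k. N (\<psi> k) = 1"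
    "\<And>k. \<exists>B. \<forall>z. norm z < 1 \<longrightarrow> norm (\<psi> k z) \<le> B"
    "concentrates \<psi> \<xi>" "\<kappa> \<longlonglongrightarrow> 1" "\<And>k. 0 < \<kappa> k"
    "\<And>k h. (\<lambda>z. h z * \<psi> k z) \<in> X \<Longrightarrow> \<kappa> k * norm (h (a (k + m))) \<le> N (\<lambda>z. h z * \<psi> k z)"
    using peak_sequence[OF a(1-3)] by blast
  define b where "b = (\<lambda>k. a (k + m))"
  have b: "\<And>k. norm (b k) < 1" "(\<lambda>k. norm (G (b k))) \<longlonglongrightarrow> \<Gamma>"
    using a(1) LIMSEQ_ignore_initial_segment[OF a(4), of m] by (auto simp: b_def)
  let ?i = "indicator {0<..<1} :: real \<Rightarrow> real"
  have gle: "norm (g t (b k)) \<le> S t" if "0 < t" "t < 1" for t k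
    using norm_le_sup_disk[OF gH[OF that] b(1)] .
  have S_int: "integrable lborel (\<lambda>t. ?i t * S t)" and S_eq: "(\<integral>t. ?i t * S t \<partial>lborel) = \<Gamma>"
  proof -
    have e: "(\<lambda>t. ennreal (?i t * S t)) = (\<lambda>t. ennreal (S t) * indicator {0<..<1} t)"
      by (auto simp: indicator_def)
    have "(\<lambda>t. enn2real (ennreal (S t) * indicator {0<..<1} t)) \<in> borel_measurable borel"
      using S_measurable by measurable
    also have "(\<lambda>t. enn2real (ennreal (S t) * indicator {0<..<1} t)) = (\<lambda>t. ?i t * S t)"
      using sup_disk_nonneg[OF gH] by (auto simp: indicator_def)
    finally have m: "(\<lambda>t. ?i t * S t) \<in> borel_measurable lborel" by simp
    have "(\<integral>\<^sup>+t. ennreal (?i t * S t) \<partial>lborel) = ennreal \<Gamma>"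
      unfolding e using R R_eq by simp
    moreover have "AE t in lborel. 0 \<le> ?i t * S t"
      using sup_disk_nonneg[OF gH] by (intro AE_I2) (auto simp: indicator_def)
    ultimately show "integrable lborel (\<lambda>t. ?i t * S t)" "(\<integral>t. ?i t * S t \<partial>lborel) = \<Gamma>"
      using nn_integral_eq_integrable[OF m _ \<Gamma>0] by auto
  qed
  have g_int: "integrable lborel (\<lambda>t. ?i t * norm (g t (b k)))" for k
  proof (rule Bochner_Integration.integrable_bound[OF S_int])
    have "(\<lambda>t. ?i t *\<^sub>R norm (g t (b k))) \<in> borel_measurable borel"
      using g_continuous[OF b(1)] by (intro borel_measurable_continuous_on_indicator continuous_intros) auto
    then show "(\<lambda>t. ?i t * norm (g t (b k))) \<in> borel_measurable lborel" by simp
    show "AE t in lborel. norm (?i t * norm (g t (b k))) \<le> norm (?i t * S t)"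
      using gle sup_disk_nonneg[OF gH] by (intro AE_I2) (auto simp: indicator_def)
  qed
  have G_le: "norm (G (b k)) \<le> (\<integral>t. ?i t * norm (g t (b k)) \<partial>lborel)" for k
  proof -
    have "ennreal (norm (G (b k))) \<le> (\<integral>\<^sup>+t. ennreal (?i t * norm (g t (b k))) \<partial>lborel)"
    proof -
      have "(\<lambda>t. ennreal (?i t * norm (g t (b k)))) = (\<lambda>t. ennreal (norm (g t (b k))) * indicator {0<..<1} t)"
        by (auto simp: indicator_def)
      then show ?thesis using norm_G_le_nn[OF b(1)[of k]] by simp
    qed
    also have "\<dots> = ennreal (\<integral>t. ?i t * norm (g t (b k)) \<partial>lborel)"
      by (intro nn_integral_eq_integral g_int AE_I2) (auto simp: indicator_def)
    finally show ?thesis by (subst (asm) ennreal_le_iff) (auto intro!: integral_nonneg_AE)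
  qed
  \<comment> \<open>This deficit is nonnegative, and its integral is at most
    \<open>\<Gamma> - norm (G (b k))\<close>, which tends to 0. Hence it converges to 0 in the
    mean.\<close>
  define u where "u = (\<lambda>k t. ?i t * S t - ?i t * norm (g t (b k)))"
  have "(\<lambda>k. \<integral>t. norm (u k t) \<partial>lborel) \<longlonglongrightarrow> 0"
  proof (rule tendsto_sandwich[OF _ _ tendsto_const])
    show "\<forall>\<^sub>F k in sequentially. (\<integral>t. norm (u k t) \<partial>lborel) \<le> \<Gamma> - norm (G (b k))"
    proof (intro always_eventually allI)
      fix k
      have "(\<integral>t. norm (u k t) \<partial>lborel) = (\<integral>t. u k t \<partial>lborel)"
        using gle by (intro Bochner_Integration.integral_cong) (auto simp: u_def indicator_def)
      also have "\<dots> = \<Gamma> - (\<integral>t. ?i t * norm (g t (b k)) \<partial>lborel)"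
        unfolding u_def using S_int g_int S_eq by simp
      finally show "(\<integral>t. norm (u k t) \<partial>lborel) \<le> \<Gamma> - norm (G (b k))" using G_le[of k] by linarith
    qed
    show "(\<lambda>k. \<Gamma> - norm (G (b k))) \<longlonglongrightarrow> 0" using tendsto_diff[OF tendsto_const[of \<Gamma>] b(2)] by simp
  qed auto
  \<comment> \<open>The subsequence does not depend on \<open>t\<close>, and concentration at
    \<open>\<xi>\<close> passes to it.\<close>
  then obtain r where r: "strict_mono r" "AE t in lborel. (\<lambda>n. u (r n) t) \<longlonglongrightarrow> 0"
    using tendsto_L1_AE_subseq[of lborel u] S_int g_int unfolding u_def by auto
  define \<phi> where "\<phi> = \<psi> \<circ> r"
  have \<phi>: "\<And>k. \<phi> k \<in> X" "\<And>k. N (\<phi> k) = 1" "\<And>k. \<exists>B. \<forall>z. norm z < 1 \<longrightarrow> norm (\<phi> k z) \<le> B"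
    using \<psi> by (auto simp: \<phi>_def)
  have conc: "concentrates \<phi> \<xi>"
    using \<psi>(4) eventually_subseq[OF r(1)] unfolding concentrates_def \<phi>_def o_def by blast
  define \<mu> where "\<mu> = (\<lambda>k. \<kappa> (r k))"
  define c where "c = (\<lambda>k. b (r k))"
  have \<mu>: "\<mu> \<longlonglongrightarrow> 1" "\<And>k. 0 < \<mu> k" using LIMSEQ_subseq_LIMSEQ[OF \<psi>(5) r(1)] \<psi>(6) by (auto simp: \<mu>_def o_def)
  have c: "\<And>k. norm (c k) < 1" "(\<lambda>k. norm (G (c k))) \<longlonglongrightarrow> \<Gamma>"
    using LIMSEQ_subseq_LIMSEQ[OF b(2) r(1)] b(1) by (auto simp: c_def o_def)
  have peak: "\<mu> k * norm (h (c k)) \<le> N (\<lambda>z. h z * \<phi> k z)" if "(\<lambda>z. h z * \<phi> k z) \<in> X" for h k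
    using \<psi>(7) that by (simp add: \<mu>_def c_def b_def \<phi>_def)
  have low: "(\<lambda>k. \<mu> k * norm (G (c k))) \<longlonglongrightarrow> \<Gamma>" using tendsto_mult[OF \<mu>(1) c(2)] by simp
  have N_le: "N (mult_op (g t) (\<phi> k)) \<le> S t" if "0 < t" "t < 1" for t k
    using Hinf_mult(2)[OF gH[OF that] \<phi>(1)[of k]] \<phi>(2) by (simp add: mult_op_def)
  have N_ge: "\<mu> k * norm (g t (c k)) \<le> N (mult_op (g t) (\<phi> k))" if "0 < t" "t < 1" for t k
    using peak[OF Hinf_mult(1)[OF gH[OF that] \<phi>(1)]] by (simp add: mult_op_def)
  have "(\<lambda>n. N (int_mult_op g (\<phi> n))) \<longlonglongrightarrow> \<Gamma>"
  proof (rule tendsto_sandwich[OF _ _ low tendsto_const]; intro always_eventually allI)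
    fix k
    show "\<mu> k * norm (G (c k)) \<le> N (int_mult_op g (\<phi> k))"
      unfolding int_mult_op_eq by (rule peak[OF Hinf_mult(1)[OF G_Hinf \<phi>(1)]])
    show "N (int_mult_op g (\<phi> k)) \<le> \<Gamma>"
      unfolding int_mult_op_eq using Hinf_mult(2)[OF G_Hinf \<phi>(1)[of k]] \<phi>(2) by (simp add: \<Gamma>_def)
  qed
  \<comment> \<open>Both limits equal \<open>\<Gamma>\<close>. This integral lies below that of
    \<open>S\<close>, which is \<open>\<Gamma>\<close>, and above \<open>\<mu> n\<close> times the
    integral of \<open>norm (g t (c n))\<close>, which is at least
    \<open>\<mu> n * norm (G (c n))\<close>.\<close>
  moreover have "(\<lambda>n. integral {0<..<1} (\<lambda>t. N (mult_op (g t) (\<phi> n)))) \<longlonglongrightarrow> \<Gamma>"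
  proof (rule tendsto_sandwich[OF _ _ low tendsto_const]; intro always_eventually allI)
    fix k
    have I0: "0 \<le> integral {0<..<1} (\<lambda>t. N (mult_op (g t) (\<phi> k)))"
      using norm_nonneg[OF \<phi>(1)] by (intro Henstock_Kurzweil_Integration.integral_nonneg norm_integrable \<phi>(1)) auto
    have "ennreal (integral {0<..<1} (\<lambda>t. N (mult_op (g t) (\<phi> k)))) \<le> R"
      unfolding nn_norm_eq[OF \<phi>(1), symmetric] R_eq
      using N_le by (intro nn_integral_mono) (auto simp: indicator_def intro: ennreal_leI)
    then show "integral {0<..<1} (\<lambda>t. N (mult_op (g t) (\<phi> k))) \<le> \<Gamma>"
      unfolding R using \<Gamma>0 by simp
    have "ennreal (\<mu> k * norm (G (c k))) \<le> ennreal (\<mu> k) * (\<integral>\<^sup>+t\<in>{0<..<1}. ennreal (norm (g t (c k))) \<partial>lborel)"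
      using norm_G_le_nn[OF c(1)] \<mu>(2)[of k] by (simp add: ennreal_mult mult_left_mono)
    also have "\<dots> = (\<integral>\<^sup>+t. ennreal (\<mu> k) * (ennreal (norm (g t (c k))) * indicator {0<..<1} t) \<partial>lborel)"
    proof (rule nn_integral_cmult[symmetric])
      have "(\<lambda>t. ennreal (?i t * norm (g t (b (r k))))) \<in> borel_measurable lborel"
        using g_int[of "r k"] by measurable
      also have "(\<lambda>t. ennreal (?i t * norm (g t (b (r k))))) = (\<lambda>t. ennreal (norm (g t (c k))) * indicator {0<..<1} t)"
        by (auto simp: indicator_def c_def)
      finally show "(\<lambda>t. ennreal (norm (g t (c k))) * indicator {0<..<1} t) \<in> borel_measurable lborel" .
    qed
    also have "\<dots> \<le> (\<integral>\<^sup>+t\<in>{0<..<1}. ennreal (N (mult_op (g t) (\<phi> k))) \<partial>lborel)"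
      using N_ge \<mu>(2)[of k] by (intro nn_integral_mono) (auto simp: indicator_def ennreal_mult[symmetric] intro: ennreal_leI)
    finally show "\<mu> k * norm (G (c k)) \<le> integral {0<..<1} (\<lambda>t. N (mult_op (g t) (\<phi> k)))"
      unfolding nn_norm_eq[OF \<phi>(1)] using I0 by simp
  qed
  moreover have "AE t in lborel. t \<in> {0<..<1} \<longrightarrow>
        liminf (\<lambda>n. ennreal (N (mult_op (g t) (\<phi> n)))) = wn_sup X N (mult_op (g t))"
    using r(2)
  proof eventually_elim
    case (elim t)
    show ?case
    proof
      assume "t \<in> {0<..<1}"
      then have t: "0 < t" "t < 1" by auto
      have "(\<lambda>n. S t - norm (g t (c n))) \<longlonglongrightarrow> 0" using elim t by (simp add: u_def c_def)
      then have "(\<lambda>n. S t - (S t - norm (g t (c n)))) \<longlonglongrightarrow> S t - 0" by (intro tendsto_intros)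
      then have "(\<lambda>n. \<mu> n * norm (g t (c n))) \<longlonglongrightarrow> 1 * S t" by (intro tendsto_mult \<mu>(1)) simp
      then have l: "(\<lambda>n. \<mu> n * norm (g t (c n))) \<longlonglongrightarrow> S t" by simp
      have "(\<lambda>n. N (mult_op (g t) (\<phi> n))) \<longlonglongrightarrow> S t"
        by (rule tendsto_sandwich[OF _ _ l tendsto_const]; intro always_eventually allI N_ge[OF t] N_le[OF t])
      then show "liminf (\<lambda>n. ennreal (N (mult_op (g t) (\<phi> n)))) = wn_sup X N (mult_op (g t))"
        unfolding wn_sup_mult[OF t] by (intro lim_imp_Liminf tendsto_ennrealI) auto
    qed
  qed
  moreover have "weakly_null X N \<phi>"
    using \<phi>(2) by (intro concentrates_imp_weakly_null[OF \<phi>(1) _ conc a(3) \<phi>(3)]) simp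
  ultimately have "extremal \<phi>" using \<phi>(2) unfolding extremal_def by (intro conjI exI[of _ \<Gamma>]) auto
  then show ?thesis using concentrates_imp_approx_eval_map[OF \<phi>(1,2) conc a(3)] by blast
qed

lemma equality_characterization:
  "wn_sup X N (int_mult_op g) \<le> R \<and> (wn_sup X N (int_mult_op g) = R \<longleftrightarrow> (\<exists>\<phi>. extremal \<phi>)) \<and>
   (wn_sup X N (int_mult_op g) = R \<longrightarrow> (\<exists>\<phi>. extremal \<phi> \<and> approx_eval_map X N \<phi>))"
  using wn_sup_int_le extremal_imp_le equality_imp_extremal by (meson antisym)

end

section \<open>Integral means and rotation invariance\<close>

lemma integral_periodic_shift:
  fixes k :: "real \<Rightarrow> real"
  assumes cont: "continuous_on UNIV k" and per: "\<And>x. k (x + 2 * pi) = k x" and s: "0 \<le> s" "s \<le> 2 * pi"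
  shows "integral {0..2*pi} (\<lambda>x. k (x + s)) = integral {0..2*pi} k"
proof -
  have int: "k integrable_on {a..b}" for a b
    using cont by (intro integrable_continuous_interval continuous_on_subset[OF cont]) auto
  have shift: "integral {a..b} (\<lambda>x. k (x + c)) = integral {a + c..b + c} k" for a b c
    using has_integral_affinity'[OF integrable_integral[OF int[of "a + c" "b + c", unfolded cbox_interval[symmetric]]], of 1 c]
    by (simp add: integral_unique)
  have "integral {0..2*pi} (\<lambda>x. k (x + s)) = integral {s..2*pi + s} k"
    using shift[of 0 "2 * pi" s] by simp
  also have "\<dots> = integral {s..2*pi} k + integral {2*pi..2*pi + s} k"
    using s int by (intro Henstock_Kurzweil_Integration.integral_combine[symmetric]) auto
  also have "integral {2*pi..2*pi + s} k = integral {0..s} k"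
    using shift[of 0 s "2 * pi"] per by (simp add: add.commute)
  also have "integral {s..2*pi} k + integral {0..s} k = integral {0..2*pi} k"
    using s int by (subst add.commute) (intro Henstock_Kurzweil_Integration.integral_combine, auto)
  finally show ?thesis .
qed

text \<open>Indexed by a point \<open>w\<close> of the circle and not by the radius, so that it is
  itself a function on the disk that can be integrated over area. It is left unnormalised.\<close>

definition circle_mean :: "real \<Rightarrow> (complex \<Rightarrow> complex) \<Rightarrow> complex \<Rightarrow> real" where
  "circle_mean p f w = integral {0..2*pi} (\<lambda>\<theta>. norm (f (w * cis \<theta>)) powr p)"

lemma circle_continuous:
  assumes "f holomorphic_on ball 0 R" "norm w < R" "0 < p"
  shows "continuous_on UNIV (\<lambda>\<theta>. f (w * cis \<theta>))" "continuous_on UNIV (\<lambda>\<theta>. norm (f (w * cis \<theta>)) powr p)"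
proof -
  show c: "continuous_on UNIV (\<lambda>\<theta>. f (w * cis \<theta>))"
  proof (rule continuous_on_compose2[OF holomorphic_on_imp_continuous_on[OF assms(1)]])
    show "continuous_on UNIV (\<lambda>\<theta>. w * cis \<theta>)" by (intro continuous_intros)
  qed (use assms in \<open>auto simp: norm_mult\<close>)
  show "continuous_on UNIV (\<lambda>\<theta>. norm (f (w * cis \<theta>)) powr p)"
    using assms by (intro continuous_on_powr' continuous_intros c) auto
qed

lemma circle_mean_rotate:
  assumes f: "f holomorphic_on ball 0 R" and w: "norm w < R" and p: "0 < p"
  shows "circle_mean p f w = circle_mean p f (of_real (norm w))"
proof -
  define s where "s = Arg2pi w"
  have s: "0 \<le> s" "s \<le> 2 * pi" "w = of_real (norm w) * cis s"
    using Arg2pi[of w] by (auto simp: s_def is_Arg_def cis_conv_exp)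
  let ?k = "\<lambda>x. norm (f (of_real (norm w) * cis x)) powr p"
  have "circle_mean p f w = integral {0..2*pi} (\<lambda>x. ?k (x + s))"
    unfolding circle_mean_def by (subst s(3)) (simp add: cis_mult mult.assoc add.commute)
  also have "\<dots> = integral {0..2*pi} ?k"
  proof (rule integral_periodic_shift[OF _ _ s(1,2)])
    show "continuous_on UNIV ?k" using w by (intro circle_continuous(2)[OF f] p) simp
    show "?k (x + 2 * pi) = ?k x" for x by (simp add: cis_mult[symmetric])
  qed
  finally show ?thesis by (simp add: circle_mean_def)
qed

text \<open>Pairing \<open>f\<close> on circles with the function that norms it on the circle through \<open>w\<close>
  gives a holomorphic function, to which the maximum principle applies.\<close>
lemma circle_mean_mono:
  assumes f: "f holomorphic_on ball 0 R" and w: "norm w \<le> norm w'" "norm w' < R" and p: "1 < p"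
  shows "circle_mean p f w \<le> circle_mean p f w'"
proof (cases "norm w' = 0")
  case True
  then show ?thesis using w by simp
next
  case False
  \<comment> \<open>The duality map of the p-th power: its product with \<open>z\<close> is
    \<open>norm z powr p\<close>, and its modulus is \<open>norm z powr (p - 1)\<close>. It is
    continuous at 0 because \<open>p > 1\<close>.\<close>
  define \<psi> where "\<psi> = (\<lambda>z::complex. cnj (sgn z) * of_real (norm z powr (p - 1)))"
  have n\<psi>: "norm (\<psi> z) = norm z powr (p - 1)" for z
    by (cases "z = 0") (auto simp: \<psi>_def norm_mult norm_sgn)
  have z\<psi>: "z * \<psi> z = of_real (norm z powr p)" for z
  proof (cases "z = 0")
    case False
    have "z * cnj (sgn z) = of_real (norm z)"
      using False complex_norm_square[of z] by (simp add: sgn_eq field_simps power2_eq_square)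
    then have "z * \<psi> z = of_real (norm z * norm z powr (p - 1))" by (simp add: \<psi>_def mult.assoc[symmetric])
    then show ?thesis using False by (simp add: powr_mult_base)
  qed (use p in auto)
  have cont\<psi>: "continuous_on UNIV \<psi>"
    unfolding continuous_on_eq_continuous_at[OF open_UNIV]
  proof
    fix z :: complex
    show "isCont \<psi> z"
    proof (cases "z = 0")
      case True
      have "((\<lambda>z::complex. norm z powr (p - 1)) \<longlongrightarrow> norm (0::complex) powr (p - 1)) (at 0)"
        using p by (intro tendsto_powr' tendsto_intros) auto
      then have "((\<lambda>z. norm (\<psi> z)) \<longlongrightarrow> 0) (at 0)" unfolding n\<psi> by simp
      then have "(\<psi> \<longlongrightarrow> 0) (at 0)" by (rule tendsto_norm_zero_cancel)
      then show ?thesis using True by (simp add: isCont_def \<psi>_def)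
    next
      case False
      then show ?thesis unfolding \<psi>_def sgn_eq by (intro continuous_intros) auto
    qed
  qed
  define c where "c = (\<lambda>\<theta>. \<psi> (f (w * cis \<theta>)))"
  have cont_c: "continuous_on UNIV c"
    unfolding c_def using w p by (intro continuous_on_compose2[OF cont\<psi> circle_continuous(1)[OF f, of w 1]]) auto
  define h where "h = (\<lambda>\<zeta>. integral (cbox 0 (2*pi)) (\<lambda>\<theta>. f (\<zeta> * cis \<theta>) * c \<theta>))"
  have in_ball: "\<zeta> * cis \<theta> \<in> ball 0 R" if "\<zeta> \<in> ball 0 R" for \<zeta> \<theta> using that by (simp add: norm_mult)
  have cont_prod: "continuous_on (ball 0 R \<times> cbox 0 (2*pi)) (\<lambda>x. u (fst x * cis (snd x)))"
    if "u holomorphic_on ball 0 R" for u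
    by (rule continuous_on_compose2[OF holomorphic_on_imp_continuous_on[OF that]])
      (auto intro!: continuous_intros simp: norm_mult)
  have hol_h: "h holomorphic_on ball 0 R"
    unfolding h_def
  proof (rule leibniz_rule_holomorphic[where fx = "\<lambda>\<zeta> \<theta>. deriv f (\<zeta> * cis \<theta>) * cis \<theta> * c \<theta>"])
    fix \<zeta> :: complex and \<theta> :: real assume \<zeta>: "\<zeta> \<in> ball 0 R"
    have "(f has_field_derivative deriv f (\<zeta> * cis \<theta>)) (at (\<zeta> * cis \<theta>))"
      by (rule holomorphic_derivI[OF f open_ball in_ball[OF \<zeta>]])
    then have "((\<lambda>\<zeta>. f (\<zeta> * cis \<theta>)) has_field_derivative deriv f (\<zeta> * cis \<theta>) * cis \<theta>) (at \<zeta>)"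
      by (rule DERIV_chain2) (auto intro!: derivative_eq_intros)
    then show "((\<lambda>\<zeta>. f (\<zeta> * cis \<theta>) * c \<theta>) has_field_derivative deriv f (\<zeta> * cis \<theta>) * cis \<theta> * c \<theta>) (at \<zeta> within ball 0 R)"
      by (rule has_field_derivative_at_within[OF DERIV_cmult_right])
  next
    fix \<zeta> :: complex assume "\<zeta> \<in> ball 0 R"
    then show "(\<lambda>\<theta>. f (\<zeta> * cis \<theta>) * c \<theta>) integrable_on cbox 0 (2*pi)"
      using circle_continuous(1)[OF f, of \<zeta> 1]
      by (intro integrable_continuous continuous_intros continuous_on_subset[OF cont_c]) (auto intro: continuous_on_subset)
  next
    have "continuous_on (ball 0 R \<times> cbox 0 (2*pi)) (\<lambda>x. deriv f (fst x * cis (snd x)) * cis (snd x) * c (snd x))"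
      using holomorphic_deriv[OF f open_ball]
      by (intro continuous_intros cont_prod continuous_on_compose2[OF cont_c]) auto
    then show "continuous_on (ball 0 R \<times> cbox 0 (2*pi)) (\<lambda>(\<zeta>, \<theta>). deriv f (\<zeta> * cis \<theta>) * cis \<theta> * c \<theta>)"
      by (simp add: case_prod_unfold)
  qed auto
  have int: "(\<lambda>\<theta>. norm (f (\<zeta> * cis \<theta>)) powr p) integrable_on {0..2*pi}" if "norm \<zeta> < R" for \<zeta>
    using circle_continuous(2)[OF f that, of p] p
    by (intro integrable_continuous_interval) (auto intro: continuous_on_subset)
  have "h w = of_real (circle_mean p f w)"
    using integral_unique[OF has_integral_linear[OF integrable_integral[OF int[of w]] bounded_linear_of_real[where 'a = complex]]] w
    by (simp add: h_def c_def z\<psi> circle_mean_def o_def)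
  \<comment> \<open>On the larger circle Young's inequality bounds \<open>h\<close>. The bound
    contains the mean through \<open>w\<close> again, but with weight \<open>1 - 1 / p\<close> below
    1, so it can be absorbed on the left afterwards.\<close>
  moreover have "norm (h w) \<le> circle_mean p f w' / p + (1 - 1 / p) * circle_mean p f w"
  proof (rule maximum_modulus_frontier[of h "cball 0 (norm w')"])
    show "h holomorphic_on interior (cball 0 (norm w'))"
      using w by (intro holomorphic_on_subset[OF hol_h]) auto
    show "continuous_on (closure (cball 0 (norm w'))) h"
      using w by (intro continuous_on_subset[OF holomorphic_on_imp_continuous_on[OF hol_h]]) auto
    fix \<zeta> :: complex assume "\<zeta> \<in> frontier (cball (0::complex) (norm w'))"
    then have \<zeta>: "norm \<zeta> = norm w'" using False by simp
    define q where "q = p / (p - 1)"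
    have q: "1 < q" "1 / p + 1 / q = 1" "(p - 1) * q = p" using p by (auto simp: q_def field_simps)
    have "norm (h \<zeta>) \<le> integral (cbox 0 (2*pi)) (\<lambda>\<theta>. norm (f (\<zeta> * cis \<theta>)) powr p / p + norm (f (w * cis \<theta>)) powr p / q)"
      unfolding h_def
    proof (rule integral_norm_bound_integral)
      show "(\<lambda>\<theta>. f (\<zeta> * cis \<theta>) * c \<theta>) integrable_on cbox 0 (2*pi)"
        using circle_continuous(1)[OF f, of \<zeta> 1] \<zeta> w
        by (intro integrable_continuous continuous_intros continuous_on_subset[OF cont_c]) (auto intro: continuous_on_subset)
      show "(\<lambda>\<theta>. norm (f (\<zeta> * cis \<theta>)) powr p / p + norm (f (w * cis \<theta>)) powr p / q) integrable_on cbox 0 (2*pi)"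
        using int[of \<zeta>] int[of w] \<zeta> w by (intro integrable_add integrable_on_divide) auto
      fix \<theta>
      show "norm (f (\<zeta> * cis \<theta>) * c \<theta>) \<le> norm (f (\<zeta> * cis \<theta>)) powr p / p + norm (f (w * cis \<theta>)) powr p / q"
        using Youngs_inequality[OF p q(1,2), of "norm (f (\<zeta> * cis \<theta>))" "norm (c \<theta>)"]
        by (simp add: norm_mult c_def n\<psi> powr_powr q(3))
    qed
    also have "\<dots> = circle_mean p f \<zeta> / p + circle_mean p f w / q"
      using int[of \<zeta>] int[of w] \<zeta> w unfolding circle_mean_def
      by (subst integral_add) (auto intro: integrable_on_divide)
    also have "circle_mean p f \<zeta> = circle_mean p f w'"
      using circle_mean_rotate[OF f, of \<zeta> p] circle_mean_rotate[OF f w(2), of p] \<zeta> w p by simp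
    finally show "norm (h \<zeta>) \<le> circle_mean p f w' / p + (1 - 1 / p) * circle_mean p f w"
    proof -
      have "1 - 1 / p = 1 / q" using q(2) by linarith
      then show ?thesis if "norm (h \<zeta>) \<le> circle_mean p f w' / p + circle_mean p f w / q" using that by simp
    qed
  qed (use w in auto)
  ultimately have "circle_mean p f w \<le> circle_mean p f w' / p + (1 - 1 / p) * circle_mean p f w"
    using norm_ge_zero[of "h w"] by (simp add: abs_le_iff)
  then have "circle_mean p f w / p \<le> circle_mean p f w' / p" by (simp add: algebra_simps)
  then show ?thesis using p by (simp add: divide_le_cancel)
qed

lemma nn_circle_mean:
  assumes "f holomorphic_on ball 0 R" "norm w < R" "1 < p"
  shows "(\<integral>\<^sup>+\<theta>\<in>{0..2*pi}. ennreal (norm (f (w * cis \<theta>)) powr p) \<partial>lborel) = ennreal (circle_mean p f w)"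
  unfolding circle_mean_def
proof (rule set_nn_integral_eq_integral)
  show "(\<lambda>\<theta>. norm (f (w * cis \<theta>)) powr p) integrable_on {0..2*pi}"
    using circle_continuous(2)[OF assms(1,2), of p] assms(3)
    by (intro integrable_continuous_interval) (auto intro: continuous_on_subset)
qed auto

section \<open>Area measure: rotation invariance, averaging over circles, and the submean
  inequality\<close>

lemma complex_pair_measurable [measurable]:
  "(\<lambda>p. Complex (fst p) (snd p)) \<in> borel_measurable (lborel \<Otimes>\<^sub>M lborel :: (real \<times> real) measure)"
proof -
  have "(\<lambda>p::real\<times>real. Complex (fst p) (snd p)) \<in> borel_measurable borel"
    unfolding complex_eq by (intro borel_measurable_continuous_onI continuous_intros)
  then show ?thesis by (simp add: lborel_prod)
qed

text \<open>Boxes determine Lebesgue measure. The product form makes Tonelli's theorem available in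
  both orders of integration.\<close>

lemma lborel_complex: "distr (lborel \<Otimes>\<^sub>M lborel) borel (\<lambda>(x, y). Complex x y) = lborel"
proof (rule lborel_eqI[symmetric])
  have meas: "(\<lambda>(x, y). Complex x y) \<in> borel_measurable (lborel \<Otimes>\<^sub>M lborel :: (real \<times> real) measure)"
    using complex_pair_measurable by (simp add: case_prod_unfold)
  fix l u :: complex
  assume le: "\<And>b. b \<in> Basis \<Longrightarrow> l \<bullet> b \<le> u \<bullet> b"
  then have le': "Re l \<le> Re u" "Im l \<le> Im u"
    using le[of 1] le[of \<i>] by (auto simp: Basis_complex_def)
  have "(\<lambda>(x, y). Complex x y) -` box l u \<inter> space (lborel \<Otimes>\<^sub>M lborel) = box (Re l) (Re u) \<times> box (Im l) (Im u)"
    by (auto simp: box_def Basis_complex_def space_pair_measure)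
  then have "emeasure (distr (lborel \<Otimes>\<^sub>M lborel) borel (\<lambda>(x, y). Complex x y)) (box l u)
     = emeasure (lborel \<Otimes>\<^sub>M lborel) (box (Re l) (Re u) \<times> box (Im l) (Im u))"
    using meas by (subst emeasure_distr) auto
  also have "\<dots> = ennreal (Re u - Re l) * ennreal (Im u - Im l)"
    using le' by (subst lborel.emeasure_pair_measure_Times) auto
  also have "\<dots> = (\<Prod>b\<in>Basis. (u - l) \<bullet> b)"
    using le' by (simp add: Basis_complex_def ennreal_mult)
  finally show "emeasure (distr (lborel \<Otimes>\<^sub>M lborel) borel (\<lambda>(x, y). Complex x y)) (box l u) = ennreal (\<Prod>b\<in>Basis. (u - l) \<bullet> b)" .
qed simp

lemma nn_integral_complex:
  assumes [measurable]: "u \<in> borel_measurable borel"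
  shows "(\<integral>\<^sup>+z. u z \<partial>lborel) = (\<integral>\<^sup>+x. \<integral>\<^sup>+y. u (Complex x y) \<partial>lborel \<partial>lborel)"
    and "(\<integral>\<^sup>+z. u z \<partial>lborel) = (\<integral>\<^sup>+y. \<integral>\<^sup>+x. u (Complex x y) \<partial>lborel \<partial>lborel)"
proof -
  have m: "(\<lambda>p. u (Complex (fst p) (snd p))) \<in> borel_measurable (lborel \<Otimes>\<^sub>M lborel)"
    by (rule measurable_compose[OF complex_pair_measurable]) simp
  have "(\<integral>\<^sup>+z. u z \<partial>lborel) = (\<integral>\<^sup>+z. u z \<partial>distr (lborel \<Otimes>\<^sub>M lborel) borel (\<lambda>(x, y). Complex x y))"
    by (simp add: lborel_complex)
  also have "\<dots> = (\<integral>\<^sup>+p. u (Complex (fst p) (snd p)) \<partial>(lborel \<Otimes>\<^sub>M lborel))"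
    using complex_pair_measurable by (subst nn_integral_distr) (auto simp: case_prod_unfold)
  finally have eq: "(\<integral>\<^sup>+z. u z \<partial>lborel) = (\<integral>\<^sup>+p. u (Complex (fst p) (snd p)) \<partial>(lborel \<Otimes>\<^sub>M lborel))" .
  show "(\<integral>\<^sup>+z. u z \<partial>lborel) = (\<integral>\<^sup>+x. \<integral>\<^sup>+y. u (Complex x y) \<partial>lborel \<partial>lborel)"
    unfolding eq using lborel.nn_integral_fst[OF m] by simp
  show "(\<integral>\<^sup>+z. u z \<partial>lborel) = (\<integral>\<^sup>+y. \<integral>\<^sup>+x. u (Complex x y) \<partial>lborel \<partial>lborel)"
    unfolding eq using lborel_pair.nn_integral_snd[OF m] by simp
qed

lemma measurable_compose_Complex:
  fixes a b :: "'x::topological_space \<Rightarrow> real"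
  assumes "u \<in> borel_measurable borel" "continuous_on UNIV a" "continuous_on UNIV b"
  shows "(\<lambda>z. u (Complex (a z) (b z))) \<in> borel_measurable borel"
proof (rule measurable_compose[OF borel_measurable_continuous_onI assms(1)])
  show "continuous_on UNIV (\<lambda>z. Complex (a z) (b z))"
    unfolding complex_eq using assms by (intro continuous_intros)
qed

text \<open>On each line parallel to the relevant axis a shear is a translation, so Tonelli's
  theorem reduces the claim to translation invariance on the real line.\<close>

lemma nn_integral_shear:
  fixes u :: "complex \<Rightarrow> ennreal"
  assumes [measurable]: "u \<in> borel_measurable borel"
  shows "(\<integral>\<^sup>+z. u (Complex (Re z + t * Im z) (Im z)) \<partial>lborel) = (\<integral>\<^sup>+z. u z \<partial>lborel)" (is "?A = _")
    and "(\<integral>\<^sup>+z. u (Complex (Re z) (Im z + t * Re z)) \<partial>lborel) = (\<integral>\<^sup>+z. u z \<partial>lborel)" (is "?B = _")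
proof -
  have shift: "(\<integral>\<^sup>+x. v (x + c) \<partial>lborel) = (\<integral>\<^sup>+x. v x \<partial>lborel)" if "v \<in> borel_measurable borel"
    for v :: "real \<Rightarrow> ennreal" and c
    using nn_integral_real_affine[OF that, of 1 c] by (simp add: add.commute)
  note cm = measurable_compose_Complex[OF assms]
  have "?A = (\<integral>\<^sup>+y. \<integral>\<^sup>+x. u (Complex (x + t * y) y) \<partial>lborel \<partial>lborel)"
    by (subst nn_integral_complex(2)) (auto intro!: cm continuous_intros)
  also have "\<dots> = (\<integral>\<^sup>+y. \<integral>\<^sup>+x. u (Complex x y) \<partial>lborel \<partial>lborel)"
    by (intro nn_integral_cong shift cm continuous_intros)
  also have "\<dots> = (\<integral>\<^sup>+z. u z \<partial>lborel)" by (rule nn_integral_complex(2)[symmetric]) simp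
  finally show "?A = (\<integral>\<^sup>+z. u z \<partial>lborel)" .
  have "?B = (\<integral>\<^sup>+x. \<integral>\<^sup>+y. u (Complex x (y + t * x)) \<partial>lborel \<partial>lborel)"
    by (subst nn_integral_complex(1)) (auto intro!: cm continuous_intros)
  also have "\<dots> = (\<integral>\<^sup>+x. \<integral>\<^sup>+y. u (Complex x y) \<partial>lborel \<partial>lborel)"
    by (intro nn_integral_cong shift cm continuous_intros)
  also have "\<dots> = (\<integral>\<^sup>+z. u z \<partial>lborel)" by (rule nn_integral_complex(1)[symmetric]) simp
  finally show "?B = (\<integral>\<^sup>+z. u z \<partial>lborel)" .
qed

text \<open>A rotation other than by \<open>\<pi>\<close> is a product of three shears.\<close>
lemma nn_integral_rotate:
  fixes u :: "complex \<Rightarrow> ennreal"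
  assumes u: "u \<in> borel_measurable borel" and c: "norm c = 1"
  shows "(\<integral>\<^sup>+z. u (c * z) \<partial>lborel) = (\<integral>\<^sup>+z. u z \<partial>lborel)"
proof -
  have rot: "(\<integral>\<^sup>+z. v (d * z) \<partial>lborel) = (\<integral>\<^sup>+z. v z \<partial>lborel)"
    if v: "v \<in> borel_measurable borel" and d: "norm d = 1" "d \<noteq> -1" for v :: "complex \<Rightarrow> ennreal" and d
  proof -
    have sq: "(Re d)\<^sup>2 + (Im d)\<^sup>2 = 1" using d(1) by (metis cmod_power2 power_one)
    have ne: "1 + Re d \<noteq> 0"
    proof
      assume "1 + Re d = 0"
      then have "Re d = -1" by simp
      with sq have "d = -1" by (auto simp: complex_eq_iff)
      with d show False by simp
    qed
    \<comment> \<open>The tangent of half the rotation angle; the three shears have parameters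
      \<open>- \<tau>\<close>, \<open>Im d\<close> and \<open>- \<tau>\<close>.\<close>
    define \<tau> where "\<tau> = Im d / (1 + Re d)"
    have t1: "Im d * \<tau> = 1 - Re d"
      using sq ne by (simp add: \<tau>_def field_simps power2_eq_square)
    then have r1: "1 - Im d * \<tau> = Re d" by simp
    have t2: "\<tau> * (1 + Re d) = Im d" using ne by (simp add: \<tau>_def)
    define A where "A = (\<lambda>z. Complex (Re z + (- \<tau>) * Im z) (Im z))"
    define B where "B = (\<lambda>z. Complex (Re z) (Im z + Im d * Re z))"
    have cont: "A \<in> borel_measurable borel" "B \<in> borel_measurable borel"
      unfolding A_def B_def complex_eq by (intro borel_measurable_continuous_onI continuous_intros)+
    have "d * z = A (B (A z))" for z
    proof (rule complex_eqI)
      have "Re (A (B (A z))) = Re z * (1 - Im d * \<tau>) - Im z * (\<tau> * (1 + (1 - Im d * \<tau>)))"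
        by (simp add: A_def B_def algebra_simps)
      also have "\<dots> = Re z * Re d - Im z * Im d" unfolding r1 t2 ..
      also have "\<dots> = Re (d * z)" by (simp add: mult.commute)
      finally show "Re (d * z) = Re (A (B (A z)))" by simp
      have "Im (A (B (A z))) = Im z * (1 - Im d * \<tau>) + Im d * Re z"
        by (simp add: A_def B_def algebra_simps)
      also have "\<dots> = Im (d * z)" unfolding r1 by (simp add: mult.commute)
      finally show "Im (d * z) = Im (A (B (A z)))" by simp
    qed
    then have "(\<integral>\<^sup>+z. v (d * z) \<partial>lborel) = (\<integral>\<^sup>+z. v (A (B (A z))) \<partial>lborel)" by simp
    also have "\<dots> = (\<integral>\<^sup>+z. v (A (B z)) \<partial>lborel)"
    proof -
      have "(\<lambda>z. v (A (B z))) \<in> borel_measurable borel" using v cont by measurable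
      from nn_integral_shear(1)[OF this, of "- \<tau>"] show ?thesis by (simp add: A_def)
    qed
    also have "\<dots> = (\<integral>\<^sup>+z. v (A z) \<partial>lborel)"
    proof -
      have "(\<lambda>z. v (A z)) \<in> borel_measurable borel" using v cont by measurable
      from nn_integral_shear(2)[OF this, of "Im d"] show ?thesis by (simp add: B_def)
    qed
    also have "\<dots> = (\<integral>\<^sup>+z. v z \<partial>lborel)"
      using nn_integral_shear(1)[OF v, of "- \<tau>"] by (simp add: A_def)
    finally show ?thesis .
  qed
  show ?thesis
  proof (cases "c = -1")
    case True
    \<comment> \<open>The half turn, for which the tangent is infinite, is a quarter turn applied
      twice.\<close>
    have i: "norm \<i> = 1" "\<i> \<noteq> -1" by (auto simp: complex_eq_iff)
    have m: "(\<lambda>z. u (\<i> * z)) \<in> borel_measurable borel" using u by measurable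
    have "(\<integral>\<^sup>+z. u (c * z) \<partial>lborel) = (\<integral>\<^sup>+z. u (\<i> * (\<i> * z)) \<partial>lborel)" using True by (simp add: mult.assoc[symmetric])
    also have "\<dots> = (\<integral>\<^sup>+z. u z \<partial>lborel)" using rot[OF m i] rot[OF u i] by simp
    finally show ?thesis .
  qed (use rot[OF u c] in auto)
qed

text \<open>This replaces polar coordinates: every rotation preserves the area integral, so
  averaging over the angle does too.\<close>

lemma nn_integral_rotation_average:
  fixes u :: "complex \<Rightarrow> ennreal"
  assumes [measurable]: "u \<in> borel_measurable borel"
  shows "(\<integral>\<^sup>+z. (\<integral>\<^sup>+\<theta>\<in>{0..2*pi}. u (z * cis \<theta>) \<partial>lborel) \<partial>lborel) = ennreal (2 * pi) * (\<integral>\<^sup>+z. u z \<partial>lborel)"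
proof -
  have "(\<lambda>p. u (snd p * cis (fst p)) * indicator {0..2*pi} (fst p)) \<in> borel_measurable (lborel \<Otimes>\<^sub>M lborel :: (real \<times> complex) measure)"
  proof -
    have "(\<lambda>p::real\<times>complex. snd p * cis (fst p)) \<in> borel_measurable borel"
      by (intro borel_measurable_continuous_onI continuous_intros)
    then have "(\<lambda>p. u (snd p * cis (fst p))) \<in> borel_measurable (lborel \<Otimes>\<^sub>M lborel :: (real \<times> complex) measure)"
      by (simp add: lborel_prod)
    then show ?thesis by measurable
  qed
  then have m: "(\<lambda>(\<theta>, z). u (z * cis \<theta>) * indicator {0..2*pi} \<theta>) \<in> borel_measurable (lborel \<Otimes>\<^sub>M lborel)"
    by (simp add: case_prod_unfold)
  have "(\<integral>\<^sup>+z. (\<integral>\<^sup>+\<theta>\<in>{0..2*pi}. u (z * cis \<theta>) \<partial>lborel) \<partial>lborel) = (\<integral>\<^sup>+\<theta>. \<integral>\<^sup>+z. u (z * cis \<theta>) * indicator {0..2*pi} \<theta> \<partial>lborel \<partial>lborel)"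
    using lborel_pair.Fubini'[OF m] by simp
  also have "\<dots> = (\<integral>\<^sup>+\<theta>. (\<integral>\<^sup>+z. u z \<partial>lborel) * indicator {0..2*pi} \<theta> \<partial>lborel)"
  proof (rule nn_integral_cong)
    fix \<theta> :: real
    have "(\<integral>\<^sup>+z. u (z * cis \<theta>) \<partial>lborel) = (\<integral>\<^sup>+z. u z \<partial>lborel)"
      using nn_integral_rotate[of u "cis \<theta>"] by (simp add: mult.commute)
    moreover have "(\<lambda>z. u (z * cis \<theta>)) \<in> borel_measurable borel" by measurable
    ultimately show "(\<integral>\<^sup>+z. u (z * cis \<theta>) * indicator {0..2*pi} \<theta> \<partial>lborel) = (\<integral>\<^sup>+z. u z \<partial>lborel) * indicator {0..2*pi} \<theta>"
      by (simp add: nn_integral_multc)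
  qed
  also have "\<dots> = ennreal (2 * pi) * (\<integral>\<^sup>+z. u z \<partial>lborel)"
    by (simp add: nn_integral_cmult_indicator mult.commute)
  finally show ?thesis .
qed

text \<open>A radial weight factors out of the average over rotations. Inequalities between circle
  means thus become inequalities between weighted area integrals.\<close>

lemma radial_average:
  assumes f: "f holomorphic_on ball 0 R" and p: "1 < p"
    and k: "k \<in> borel_measurable borel" "\<And>z \<theta>. k (z * cis \<theta>) = k z"
  shows "ennreal (2 * pi) * (\<integral>\<^sup>+z. (ennreal (norm (f z) powr p) * indicator (ball 0 R) z) * k z \<partial>lborel)
    = (\<integral>\<^sup>+z. (ennreal (circle_mean p f z) * indicator (ball 0 R) z) * k z \<partial>lborel)"
proof -
  define u where "u = (\<lambda>z. (ennreal (norm (f z) powr p) * indicator (ball 0 R) z) * k z)"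
  have "u \<in> borel_measurable borel"
    unfolding u_def using measurable_powr_ball[OF f, of p] k(1) by measurable
  then have "ennreal (2 * pi) * (\<integral>\<^sup>+z. u z \<partial>lborel) = (\<integral>\<^sup>+z. (\<integral>\<^sup>+\<theta>\<in>{0..2*pi}. u (z * cis \<theta>) \<partial>lborel) \<partial>lborel)"
    by (rule nn_integral_rotation_average[symmetric])
  also have "\<dots> = (\<integral>\<^sup>+z. (ennreal (circle_mean p f z) * indicator (ball 0 R) z) * k z \<partial>lborel)"
  proof (rule nn_integral_cong)
    fix z :: complex
    show "(\<integral>\<^sup>+\<theta>\<in>{0..2*pi}. u (z * cis \<theta>) \<partial>lborel) = (ennreal (circle_mean p f z) * indicator (ball 0 R) z) * k z"
    proof (cases "norm z < R")
      case True
      have "continuous_on UNIV (\<lambda>\<theta>. norm (f (z * cis \<theta>)) powr p)"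
        using circle_continuous(2)[OF f True] p by simp
      then have "(\<lambda>\<theta>. norm (f (z * cis \<theta>)) powr p) \<in> borel_measurable borel"
        by (rule borel_measurable_continuous_onI)
      then have "(\<lambda>\<theta>. ennreal (norm (f (z * cis \<theta>)) powr p) * indicator {0..2*pi} \<theta>) \<in> borel_measurable lborel"
        by measurable
      then have "(\<integral>\<^sup>+\<theta>\<in>{0..2*pi}. ennreal (norm (f (z * cis \<theta>)) powr p) \<partial>lborel) * k z
        = (\<integral>\<^sup>+\<theta>. (ennreal (norm (f (z * cis \<theta>)) powr p) * indicator {0..2*pi} \<theta>) * k z \<partial>lborel)"
        by (rule nn_integral_multc[symmetric])
      also have "\<dots> = (\<integral>\<^sup>+\<theta>\<in>{0..2*pi}. u (z * cis \<theta>) \<partial>lborel)"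
        using True k(2) by (intro nn_integral_cong) (simp add: u_def norm_mult mult_ac)
      finally show ?thesis using True nn_circle_mean[OF f True p] by simp
    qed (simp add: u_def norm_mult)
  qed
  finally show ?thesis by (simp add: u_def)
qed

lemma emeasure_disk: "0 \<le> r \<Longrightarrow> emeasure lborel (ball (c::complex) r) = ennreal (pi * r\<^sup>2)"
  by (simp add: emeasure_ball unit_ball_vol_2)

lemma ennreal_mult_left_cancel_le:
  "0 < c \<Longrightarrow> ennreal c * a \<le> ennreal c * b \<Longrightarrow> a \<le> b"
proof -
  assume c: "0 < c" and le: "ennreal c * a \<le> ennreal c * b"
  have eq: "ennreal (1 / c) * (ennreal c * x) = x" for x
    using c by (simp add: mult.assoc[symmetric] ennreal_mult[symmetric])
  show ?thesis using mult_left_mono[OF le, of "ennreal (1 / c)"] unfolding eq by simp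
qed

text \<open>The circle mean of the translate \<open>F\<close> through its centre is
  \<open>2 * pi * norm (f z) powr p\<close>, and circle means increase with the radius; integrating
  over \<open>ball 0 R\<close> gives the claim.\<close>

lemma area_submean:
  assumes f: "f holomorphic_on ball 0 1" and z: "norm z < 1" and R: "0 < R" "R \<le> 1 - norm z" and p: "1 < p"
  shows "ennreal (norm (f z) powr p) * ennreal (pi * R\<^sup>2) \<le> (\<integral>\<^sup>+w\<in>ball z R. ennreal (norm (f w) powr p) \<partial>lborel)"
proof (rule ennreal_mult_left_cancel_le[of "2 * pi"])
  define F where "F = (\<lambda>w. f (z + w))"
  have F: "F holomorphic_on ball 0 R"
  proof -
    have "(f \<circ> (\<lambda>w. z + w)) holomorphic_on ball 0 R"
    proof (rule holomorphic_on_compose_gen[OF _ f])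
      show "(\<lambda>w. z + w) ` ball 0 R \<subseteq> ball 0 1"
      proof (rule image_subsetI)
        fix w :: complex assume "w \<in> ball 0 R"
        then show "z + w \<in> ball 0 1" using R norm_triangle_ineq[of z w] by simp
      qed
    qed (intro holomorphic_intros)
    then show ?thesis by (simp add: F_def o_def)
  qed
  have "ennreal (2 * pi) * (ennreal (norm (f z) powr p) * ennreal (pi * R\<^sup>2))
      = (\<integral>\<^sup>+w. ennreal (circle_mean p F 0) * indicator (ball (0::complex) R) w \<partial>lborel)"
  proof -
    have "circle_mean p F 0 = 2 * pi * norm (f z) powr p" by (simp add: circle_mean_def F_def)
    note e = this
    have "(\<integral>\<^sup>+w. ennreal (circle_mean p F 0) * indicator (ball (0::complex) R) w \<partial>lborel)
        = ennreal (2 * pi * norm (f z) powr p) * ennreal (pi * R\<^sup>2)"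
      unfolding e by (subst nn_integral_cmult_indicator) (simp_all add: emeasure_disk[OF less_imp_le[OF R(1)]])
    then show ?thesis by (simp add: ennreal_mult mult.assoc)
  qed
  also have "\<dots> \<le> (\<integral>\<^sup>+w. (ennreal (circle_mean p F w) * indicator (ball 0 R) w) * 1 \<partial>lborel)"
    using circle_mean_mono[OF F, of 0 _ p] p
    by (intro nn_integral_mono) (auto simp: indicator_def intro: ennreal_leI)
  also have "\<dots> = ennreal (2 * pi) * (\<integral>\<^sup>+w. (ennreal (norm (F w) powr p) * indicator (ball 0 R) w) * 1 \<partial>lborel)"
    by (rule radial_average[OF F p, symmetric]) auto
  also have "(\<integral>\<^sup>+w. (ennreal (norm (F w) powr p) * indicator (ball 0 R) w) * 1 \<partial>lborel) = (\<integral>\<^sup>+w\<in>ball z R. ennreal (norm (f w) powr p) \<partial>lborel)"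
  proof -
    define v where "v = (\<lambda>w. ennreal (norm (F w) powr p) * indicator (ball 0 R) w)"
    have v: "v \<in> borel_measurable borel" unfolding v_def by (rule measurable_powr_ball[OF F])
    have "(\<integral>\<^sup>+w. v w \<partial>lborel) = (\<integral>\<^sup>+w. v w \<partial>distr lborel borel ((+) (- z)))"
      by (simp add: lborel_distr_plus)
    also have "\<dots> = (\<integral>\<^sup>+w. v (- z + w) \<partial>lborel)"
      using v by (subst nn_integral_distr) auto
    also have "\<dots> = (\<integral>\<^sup>+w\<in>ball z R. ennreal (norm (f w) powr p) \<partial>lborel)"
      by (intro nn_integral_cong) (auto simp: v_def F_def indicator_def dist_norm norm_minus_commute)
    finally show ?thesis by (simp add: v_def)
  qed
  finally show "ennreal (2 * pi) * (ennreal (norm (f z) powr p) * ennreal (pi * R\<^sup>2))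
    \<le> ennreal (2 * pi) * (\<integral>\<^sup>+w\<in>ball z R. ennreal (norm (f w) powr p) \<partial>lborel)" .
qed simp

section \<open>Weighted Bergman spaces\<close>

definition Ap_weight :: "real \<Rightarrow> complex \<Rightarrow> ennreal" where
  "Ap_weight \<alpha> z = ennreal ((\<alpha> + 1) * (1 - (norm z)\<^sup>2) powr \<alpha> / pi)"

definition Ap_measure :: "real \<Rightarrow> complex measure" where
  "Ap_measure \<alpha> = density lborel (Ap_weight \<alpha>)"

lemma Ap_weight_measurable [measurable]: "Ap_weight \<alpha> \<in> borel_measurable borel"
  unfolding Ap_weight_def by measurable

lemma Ap_mass_eq:
  assumes f: "f holomorphic_on ball 0 1"
  shows "Lp_mass p {()} (\<lambda>_. Ap_measure \<alpha>) f
    = (\<integral>\<^sup>+z. (ennreal (norm (f z) powr p) * indicator (ball 0 1) z) * Ap_weight \<alpha> z \<partial>lborel)"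
  unfolding Lp_mass_def Ap_measure_def using measurable_powr_ball[OF f, of p]
  by (simp add: nn_integral_density mult.commute)

lemma Ap_mass_integrand:
  assumes f: "f holomorphic_on ball 0 1" and \<alpha>: "-1 < \<alpha>"
  shows "Lp_mass p {()} (\<lambda>_. Ap_measure \<alpha>) f = (\<integral>\<^sup>+z\<in>ball 0 1. ennreal (Ap_integrand p \<alpha> f z) \<partial>lborel)"
  unfolding Ap_mass_eq[OF f]
proof (rule nn_integral_cong)
  fix z :: complex
  show "(ennreal (norm (f z) powr p) * indicator (ball 0 1) z) * Ap_weight \<alpha> z
    = ennreal (Ap_integrand p \<alpha> f z) * indicator (ball 0 1) z"
    using \<alpha> by (auto simp: Ap_weight_def Ap_integrand_def indicator_def ennreal_mult[symmetric])
qed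

lemma Ap_integrand_nonneg: "-1 < \<alpha> \<Longrightarrow> 0 \<le> Ap_integrand p \<alpha> f z"
  by (simp add: Ap_integrand_def)

lemma integrable_on_iff_nn_integral_finite:
  fixes h :: "'a::euclidean_space \<Rightarrow> real"
  assumes nonneg: "\<And>x. 0 \<le> h x" and m: "(\<lambda>x. ennreal (h x) * indicator S x) \<in> borel_measurable borel"
  shows "h integrable_on S \<longleftrightarrow> (\<integral>\<^sup>+x\<in>S. ennreal (h x) \<partial>lborel) < \<infinity>"
proof
  assume "h integrable_on S"
  then show "(\<integral>\<^sup>+x\<in>S. ennreal (h x) \<partial>lborel) < \<infinity>"
    using set_nn_integral_eq_integral[of S h] nonneg by simp
next
  assume fin: "(\<integral>\<^sup>+x\<in>S. ennreal (h x) \<partial>lborel) < \<infinity>"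
  define u where "u = (\<lambda>x. if x \<in> S then h x else 0)"
  have u: "(\<lambda>x. ennreal (h x) * indicator S x) = (\<lambda>x. ennreal (u x))"
    by (auto simp: u_def)
  have "(\<lambda>x. enn2real (ennreal (u x))) \<in> borel_measurable borel" using m unfolding u by measurable
  moreover have "(\<lambda>x. enn2real (ennreal (u x))) = u" using nonneg by (auto simp: u_def)
  ultimately have "u \<in> borel_measurable borel" by simp
  moreover obtain r where "0 \<le> r" "(\<integral>\<^sup>+x. ennreal (u x) \<partial>lborel) = ennreal r"
    using fin unfolding u by (cases "\<integral>\<^sup>+x. ennreal (u x) \<partial>lborel") auto
  ultimately have "(u has_integral r) UNIV"
    using nonneg by (intro nn_integral_has_integral) (auto simp: u_def)
  then have "(h has_integral r) S" unfolding u_def by (simp only: has_integral_restrict_UNIV)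
  then show "h integrable_on S" by (rule has_integral_integrable)
qed

lemma Ap_space_eq:
  assumes \<alpha>: "-1 < \<alpha>"
  shows "Ap_space p \<alpha> = {f. f holomorphic_on ball 0 1 \<and> Lp_mass p {()} (\<lambda>_. Ap_measure \<alpha>) f < \<infinity>}"
proof -
  have "Ap_integrand p \<alpha> f integrable_on ball 0 1 \<longleftrightarrow> Lp_mass p {()} (\<lambda>_. Ap_measure \<alpha>) f < \<infinity>"
    if f: "f holomorphic_on ball 0 1" for f
    unfolding Ap_mass_integrand[OF f \<alpha>]
  proof (rule integrable_on_iff_nn_integral_finite)
    have "(\<lambda>z. (ennreal (norm (f z) powr p) * indicator (ball 0 1) z) * Ap_weight \<alpha> z) \<in> borel_measurable borel"
      using measurable_powr_ball[OF f, of p] by measurable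
    also have "(\<lambda>z. (ennreal (norm (f z) powr p) * indicator (ball 0 1) z) * Ap_weight \<alpha> z)
      = (\<lambda>z. ennreal (Ap_integrand p \<alpha> f z) * indicator (ball 0 1) z)"
      using \<alpha> by (auto simp: fun_eq_iff Ap_weight_def Ap_integrand_def indicator_def ennreal_mult[symmetric])
    finally show "(\<lambda>z. ennreal (Ap_integrand p \<alpha> f z) * indicator (ball 0 1) z) \<in> borel_measurable borel" .
  qed (rule Ap_integrand_nonneg[OF \<alpha>])
  then show ?thesis unfolding Ap_space_def by blast
qed

lemma Ap_norm_eq:
  assumes \<alpha>: "-1 < \<alpha>" and "f \<in> Ap_space p \<alpha>"
  shows "Ap_norm p \<alpha> f = enn2real (Lp_mass p {()} (\<lambda>_. Ap_measure \<alpha>) f) powr (1 / p)"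
proof -
  have f: "f holomorphic_on ball 0 1" "Ap_integrand p \<alpha> f integrable_on ball 0 1"
    using assms by (auto simp: Ap_space_def)
  have "Lp_mass p {()} (\<lambda>_. Ap_measure \<alpha>) f = ennreal (integral (ball 0 1) (Ap_integrand p \<alpha> f))"
    unfolding Ap_mass_integrand[OF f(1) \<alpha>]
    using Ap_integrand_nonneg[OF \<alpha>] f(2) by (intro set_nn_integral_eq_integral) auto
  moreover have "0 \<le> integral (ball 0 1) (Ap_integrand p \<alpha> f)"
    using Ap_integrand_nonneg[OF \<alpha>] f(2) by (intro Henstock_Kurzweil_Integration.integral_nonneg) auto
  ultimately show ?thesis by (simp add: Ap_norm_def)
qed

text \<open>The disk is cut into the annuli \<open>1 - (norm z)\<^sup>2 \<in> {(1/2)^(n+1)<..(1/2)^n}\<close>, of area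
  at most \<open>pi * (1/2)^n\<close>.\<close>
lemma Ap_weight_finite:
  assumes \<alpha>: "-1 < \<alpha>"
  shows "(\<integral>\<^sup>+z\<in>ball 0 1. Ap_weight \<alpha> z \<partial>lborel) < \<infinity>"
proof -
  \<comment> \<open>A nonpositive exponent makes the power decrease in
    \<open>1 - (norm z)\<^sup>2\<close>, so on an annulus it is bounded by its value at the lower
    end of the range. Passing from \<open>\<alpha>\<close> to \<open>\<beta>\<close> only enlarges
    the power, as the base is at most 1.\<close>
  define \<beta> where "\<beta> = min \<alpha> 0"
  have \<beta>: "-1 < \<beta>" "\<beta> \<le> 0" "\<beta> \<le> \<alpha>" using \<alpha> by (auto simp: \<beta>_def)
  \<comment> \<open>All points with \<open>1 - (norm z)\<^sup>2\<close> at most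
    \<open>(1/2)^n\<close>, hence more than the annulus. Overlaps are harmless in an upper bound,
    and the area is a difference of two disks.\<close>
  define A where "A = (\<lambda>n::nat. ball (0::complex) 1 - ball 0 (sqrt (1 - (1/2)^n)))"
  define c where "c = (\<lambda>n::nat. (\<alpha> + 1) * ((1/2)^Suc n) powr \<beta> / pi)"
  have c0: "0 \<le> c n" for n using \<alpha> by (simp add: c_def)
  have area: "emeasure lborel (A n) = ennreal (pi * (1/2)^n)" for n
  proof -
    have le: "(1/2)^n \<le> (1::real)" by (simp add: power_le_one)
    have "emeasure lborel (A n) = emeasure lborel (ball (0::complex) 1) - emeasure lborel (ball (0::complex) (sqrt (1 - (1/2)^n)))"
      unfolding A_def using le
      by (intro emeasure_Diff) (auto simp: emeasure_disk real_sqrt_le_1_iff intro!: subset_ball)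
    also have "\<dots> = ennreal (pi * 1\<^sup>2) - ennreal (pi * (sqrt (1 - (1/2)^n))\<^sup>2)"
      using le by (simp only: emeasure_disk zero_le_one real_sqrt_ge_zero diff_ge_0_iff_ge)
    also have "\<dots> = ennreal (pi * 1\<^sup>2 - pi * (sqrt (1 - (1/2)^n))\<^sup>2)"
      by (rule ennreal_minus) simp
    also have "pi * 1\<^sup>2 - pi * (sqrt (1 - (1/2)^n))\<^sup>2 = pi * (1/2)^n"
      using le by (simp add: algebra_simps)
    finally show ?thesis .
  qed
  have "(\<integral>\<^sup>+z\<in>ball 0 1. Ap_weight \<alpha> z \<partial>lborel) \<le> (\<integral>\<^sup>+z. (\<Sum>n. ennreal (c n) * indicator (A n) z) \<partial>lborel)"
  proof (rule nn_integral_mono)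
    fix z :: complex
    show "Ap_weight \<alpha> z * indicator (ball 0 1) z \<le> (\<Sum>n. ennreal (c n) * indicator (A n) z)"
    proof (cases "norm z < 1")
      case True
      define x where "x = 1 - (norm z)\<^sup>2"
      have x: "0 < x" "x \<le> 1" using True by (auto simp: x_def power_less_one_iff abs_square_less_1)
      have "\<exists>n. (1/2)^n < x" using x by (intro real_arch_pow_inv) auto
      define m where "m = (LEAST n. (1/2)^n < x)"
      have m: "(1/2)^m < x" unfolding m_def using \<open>\<exists>n. (1/2)^n < x\<close> by (rule LeastI_ex)
      have "m \<noteq> 0" using m x by (metis not_le power_0)
      then obtain n where n: "m = Suc n" by (cases m) auto
      have xn: "x \<le> (1/2)^n" using not_less_Least[of n "\<lambda>n. (1/2)^n < x"] n unfolding m_def by auto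
      have "sqrt (1 - (1/2)^n) \<le> norm z"
        using xn by (intro real_le_lsqrt) (auto simp: x_def)
      then have zA: "z \<in> A n" using True by (simp add: A_def)
      have "x powr \<alpha> \<le> x powr \<beta>" using x \<beta> by (intro powr_mono') auto
      also have "\<dots> \<le> ((1/2)^Suc n) powr \<beta>" using m x \<beta> n by (intro powr_mono2') auto
      finally have "(\<alpha> + 1) * x powr \<alpha> / pi \<le> c n"
        unfolding c_def using \<alpha> by (intro divide_right_mono mult_left_mono) auto
      then have "Ap_weight \<alpha> z * indicator (ball 0 1) z \<le> ennreal (c n) * indicator (A n) z"
        using True zA by (simp add: Ap_weight_def x_def ennreal_leI)
      also have "\<dots> \<le> (\<Sum>n. ennreal (c n) * indicator (A n) z)"
      proof -
        define F where "F = (\<lambda>k. ennreal (c k) * indicator (A k) z)"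
        have "F n \<le> suminf F" using sum_le_suminf[of F "{n}"] by simp
        then show ?thesis by (simp only: F_def)
      qed
      finally show ?thesis .
    qed simp
  qed
  also have "\<dots> = (\<Sum>n. ennreal (c n) * ennreal (pi * (1/2)^n))"
  proof -
    have [measurable]: "A n \<in> sets borel" for n by (auto simp: A_def)
    show ?thesis by (subst nn_integral_suminf) (auto simp: nn_integral_cmult_indicator area)
  qed
  also have "\<dots> = (\<Sum>n. ennreal (c n * (pi * (1/2)^n)))" using c0 by (simp add: ennreal_mult)
  also have "\<dots> < \<infinity>"
  proof -
    \<comment> \<open>The ratio of the resulting geometric series, below 1 because
      \<open>\<beta> > -1\<close>.\<close>
    define q where "q = (1/2) powr (\<beta> + 1)"
    have q: "0 < q" "q < 1" unfolding q_def using \<beta> powr_less_mono2[of "\<beta> + 1" "1/2" 1] by auto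
    have "c n * (pi * (1/2)^n) = (\<alpha> + 1) * (1/2) powr \<beta> * q ^ n" for n
    proof -
      have "((1/2)^Suc n) powr \<beta> * (1/2)^n = (1/2) powr \<beta> * q ^ n"
      proof -
        have half: "(1/2::real) ^ k = (1/2) powr (real k)" for k by (simp add: powr_realpow)
        have "((1/2)^Suc n) powr \<beta> * (1/2)^n = (1/2) powr (real (Suc n) * \<beta> + real n)"
          unfolding half powr_powr powr_add ..
        also have "real (Suc n) * \<beta> + real n = \<beta> + (\<beta> + 1) * real n" by (simp add: algebra_simps)
        also have "(1/2::real) powr (\<beta> + (\<beta> + 1) * real n) = (1/2) powr \<beta> * q ^ n"
          using powr_realpow[OF q(1), of n] unfolding q_def by (simp only: powr_add[of _ \<beta> "(\<beta> + 1) * real n"] powr_powr)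
        finally show ?thesis .
      qed
      then show ?thesis by (simp add: c_def mult_ac)
    qed
    then have "summable (\<lambda>n. c n * (pi * (1/2)^n))"
      using q by (auto intro!: summable_mult summable_geometric)
    then show ?thesis using c0 by (subst suminf_ennreal2) auto
  qed
  finally show ?thesis .
qed

text \<open>Small mass near \<open>\<xi>\<close> is continuity from above of a finite measure. The
  evaluation bound applies \<open>area_submean\<close> on a disk where the weight is bounded below.
  Dilations contract because circle means increase with the radius and the weight is radial.\<close>

lemma disk_space_Ap:
  assumes p: "1 < p" and \<alpha>: "-1 < \<alpha>"
  shows "disk_space p {()} (\<lambda>_. Ap_measure \<alpha>) (Ap_norm p \<alpha>)"
proof
  have em: "emeasure (Ap_measure \<alpha>) A = (\<integral>\<^sup>+z\<in>A. Ap_weight \<alpha> z \<partial>lborel)" if "A \<in> sets borel" for A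
    unfolding Ap_measure_def using that by (subst emeasure_density) auto
  show sets: "sets (Ap_measure \<alpha>) = sets borel" by (simp add: Ap_measure_def)
  have fin: "emeasure (Ap_measure \<alpha>) (ball 0 1) < \<infinity>"
    using Ap_weight_finite[OF \<alpha>] by (simp add: em)
  then show "\<exists>K::real. \<forall>i\<in>{()}. emeasure (Ap_measure \<alpha>) (ball 0 1) \<le> ennreal K"
    by (intro exI[of _ "enn2real (emeasure (Ap_measure \<alpha>) (ball 0 1))"]) simp
  show "\<exists>\<epsilon>>0. \<forall>i\<in>{()}. emeasure (Ap_measure \<alpha>) (ball 0 1 \<inter> ball \<xi> \<epsilon>) \<le> ennreal \<eta>"
    if \<xi>: "norm \<xi> = 1" and \<eta>: "0 < \<eta>" for \<xi> \<eta>
  proof -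
    let ?A = "\<lambda>n::nat. ball 0 1 \<inter> ball \<xi> (1 / real (Suc n))"
    have "(\<lambda>n. emeasure (Ap_measure \<alpha>) (?A n)) \<longlonglongrightarrow> emeasure (Ap_measure \<alpha>) (\<Inter>n. ?A n)"
    proof (rule Lim_emeasure_decseq)
      show "range ?A \<subseteq> sets (Ap_measure \<alpha>)" by (auto simp: sets)
      show "decseq ?A"
        unfolding decseq_def by (intro allI impI Int_mono subset_ball order_refl) (simp add: frac_le)
      show "emeasure (Ap_measure \<alpha>) (?A n) \<noteq> \<infinity>" for n
        using fin emeasure_mono[of "?A n" "ball 0 1" "Ap_measure \<alpha>"] by (auto simp: sets top_unique)
    qed
    also have "(\<Inter>n. ?A n) = {}"
    proof (rule ccontr)
      assume "(\<Inter>n. ?A n) \<noteq> {}"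
      then obtain z where z: "\<And>n. z \<in> ?A n" by blast
      have "dist \<xi> z = 0"
      proof (rule ccontr)
        assume "dist \<xi> z \<noteq> 0"
        then obtain n where "1 / real (Suc n) < dist \<xi> z"
          using nat_approx_posE[of "dist \<xi> z"] by auto
        then show False using z[of n] by auto
      qed
      then show False using z[of 0] \<xi> by simp
    qed
    finally have "(\<lambda>n. emeasure (Ap_measure \<alpha>) (?A n)) \<longlonglongrightarrow> 0" by simp
    then have "\<forall>\<^sub>F n in sequentially. emeasure (Ap_measure \<alpha>) (?A n) < ennreal \<eta>"
      using \<eta> by (intro order_tendstoD(2)) auto
    then obtain n where "emeasure (Ap_measure \<alpha>) (?A n) < ennreal \<eta>"
      using eventually_happens'[OF sequentially_bot] by blast
    then show ?thesis by (intro exI[of _ "1 / real (Suc n)"]) auto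
  qed
  show "\<exists>C s. 0 < C \<and> (\<forall>f z. f holomorphic_on ball 0 1 \<longrightarrow> z \<in> ball 0 1 \<longrightarrow>
      ennreal (norm (f z) powr p) \<le> ennreal (C * (1 - norm z) powr (- s)) * Lp_mass p {()} (\<lambda>_. Ap_measure \<alpha>) f)"
  proof (intro exI conjI allI impI)
    \<comment> \<open>\<open>\<bar>\<alpha>\<bar>\<close> accounts for the smallest weight on
      \<open>ball z R\<close> and 2 for the area of that disk.\<close>
    define s where "s = \<bar>\<alpha>\<bar> + 2"
    show "0 < 2 powr s / (\<alpha> + 1)" using \<alpha> by simp
    fix f and z :: complex
    assume f: "f holomorphic_on ball 0 1" and "z \<in> ball 0 1"
    then have z: "norm z < 1" by simp
    define R where "R = (1 - norm z) / 2"
    have R: "0 < R" "R < 1" "R \<le> 1 - norm z" using z norm_ge_zero[of z] unfolding R_def by (auto simp del: norm_ge_zero)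
    define k where "k = (\<alpha> + 1) * R powr \<bar>\<alpha>\<bar> / pi"
    have k: "0 < k" using R \<alpha> by (simp add: k_def)
    \<comment> \<open>On \<open>ball z R\<close>, of radius half the distance to the boundary,
      \<open>1 - (norm w)\<^sup>2\<close> lies between \<open>R\<close> and 1. Its power with
      exponent \<open>\<alpha>\<close> is then at least \<open>R powr \<bar>\<alpha>\<bar>\<close>,
      whatever the sign of \<open>\<alpha>\<close>.\<close>
    have weight: "ennreal k \<le> Ap_weight \<alpha> w" if "w \<in> ball z R" for w
    proof -
      have "norm w < norm z + R" using that norm_triangle_ineq2[of w z] by (simp add: dist_norm norm_minus_commute)
      then have w: "norm w < 1 - R" by (simp add: R_def field_simps)
      have w1: "(norm w)\<^sup>2 \<le> norm w" using w R mult_left_le[of "norm w" "norm w"] by (simp add: power2_eq_square)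
      define x where "x = 1 - (norm w)\<^sup>2"
      have x: "R \<le> x" "x \<le> 1" using w1 w by (auto simp: x_def)
      have "R powr \<bar>\<alpha>\<bar> \<le> x powr \<bar>\<alpha>\<bar>" using x R by (intro powr_mono2) auto
      also have "\<dots> \<le> x powr \<alpha>" using x R by (intro powr_mono') auto
      finally show ?thesis
        unfolding k_def Ap_weight_def x_def using \<alpha> by (intro ennreal_leI divide_right_mono mult_left_mono) auto
    qed
    have sub: "ball z R \<subseteq> ball 0 1"
    proof
      fix w assume "w \<in> ball z R"
      then have "norm w < norm z + R" using norm_triangle_ineq2[of w z] by (simp add: dist_norm norm_minus_commute)
      then show "w \<in> ball 0 1" using R by simp
    qed
    have "ennreal k * (ennreal (norm (f z) powr p) * ennreal (pi * R\<^sup>2))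
        \<le> ennreal k * (\<integral>\<^sup>+w\<in>ball z R. ennreal (norm (f w) powr p) \<partial>lborel)"
      by (intro mult_left_mono area_submean[OF f z R(1,3) p]) auto
    also have "\<dots> = (\<integral>\<^sup>+w. ennreal k * (ennreal (norm (f w) powr p) * indicator (ball z R) w) \<partial>lborel)"
    proof (rule nn_integral_cmult[symmetric])
      have [measurable]: "ball z R \<in> sets borel" by simp
      have "(\<lambda>w. (ennreal (norm (f w) powr p) * indicator (ball 0 1) w) * indicator (ball z R) w) \<in> borel_measurable lborel"
        using measurable_powr_ball[OF f, of p] by measurable
      also have "(\<lambda>w. (ennreal (norm (f w) powr p) * indicator (ball 0 1) w) * indicator (ball z R) w) = (\<lambda>w. ennreal (norm (f w) powr p) * indicator (ball z R) w)"
        using sub by (auto simp: indicator_def fun_eq_iff)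
      finally show "(\<lambda>w. ennreal (norm (f w) powr p) * indicator (ball z R) w) \<in> borel_measurable lborel" .
    qed
    also have "\<dots> \<le> Lp_mass p {()} (\<lambda>_. Ap_measure \<alpha>) f"
      unfolding Ap_mass_eq[OF f]
    proof (rule nn_integral_mono)
      fix w
      show "ennreal k * (ennreal (norm (f w) powr p) * indicator (ball z R) w) \<le> (ennreal (norm (f w) powr p) * indicator (ball 0 1) w) * Ap_weight \<alpha> w"
        using weight[of w] subsetD[OF sub, of w]
        by (cases "w \<in> ball z R") (auto simp: mult.commute[of _ "Ap_weight \<alpha> w"] intro: mult_right_mono)
    qed
    finally have "ennreal (k * pi * R\<^sup>2) * ennreal (norm (f z) powr p) \<le> Lp_mass p {()} (\<lambda>_. Ap_measure \<alpha>) f"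
      using k by (simp add: ennreal_mult mult_ac)
    then have "ennreal (1 / (k * pi * R\<^sup>2)) * (ennreal (k * pi * R\<^sup>2) * ennreal (norm (f z) powr p)) \<le> ennreal (1 / (k * pi * R\<^sup>2)) * Lp_mass p {()} (\<lambda>_. Ap_measure \<alpha>) f"
      by (rule mult_left_mono) simp
    moreover have "ennreal (1 / (k * pi * R\<^sup>2)) * (ennreal (k * pi * R\<^sup>2) * ennreal (norm (f z) powr p)) = ennreal (norm (f z) powr p)"
      using k R by (simp add: ennreal_mult[symmetric] mult.assoc[symmetric])
    moreover have "1 / (k * pi * R\<^sup>2) = 2 powr s / (\<alpha> + 1) * (1 - norm z) powr (- s)"
    proof -
      have "R powr s = R powr \<bar>\<alpha>\<bar> * R\<^sup>2" using R by (simp add: s_def powr_add powr_numeral)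
      moreover have "R powr s = (1 - norm z) powr s / 2 powr s" using z by (simp add: R_def powr_divide)
      ultimately have "k * pi * R\<^sup>2 = (\<alpha> + 1) * ((1 - norm z) powr s / 2 powr s)" by (simp add: k_def)
      then show ?thesis using z \<alpha> by (simp add: powr_minus divide_inverse mult_ac)
    qed
    ultimately show "ennreal (norm (f z) powr p) \<le> ennreal (2 powr s / (\<alpha> + 1) * (1 - norm z) powr (- s)) * Lp_mass p {()} (\<lambda>_. Ap_measure \<alpha>) f"
      by simp
  qed
  show "Lp_mass p {()} (\<lambda>_. Ap_measure \<alpha>) (\<lambda>z. f (of_real \<rho> * z)) \<le> Lp_mass p {()} (\<lambda>_. Ap_measure \<alpha>) f"
    if f: "f holomorphic_on ball 0 1" and \<rho>: "0 < \<rho>" "\<rho> < 1" for f \<rho>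
  proof (rule ennreal_mult_left_cancel_le[of "2 * pi"])
    let ?f = "\<lambda>z. f (of_real \<rho> * z)"
    have \<rho>z: "norm (of_real \<rho> * z) \<le> norm z" for z :: complex
      using \<rho> by (simp add: norm_mult mult_left_le_one_le)
    have hol: "?f holomorphic_on ball 0 1" by (rule holomorphic_dilation[OF f \<rho>])
    have rad: "Ap_weight \<alpha> (z * cis \<theta>) = Ap_weight \<alpha> z" for z \<theta> by (simp add: Ap_weight_def norm_mult)
    have mono: "circle_mean p ?f z \<le> circle_mean p f z" if "norm z < 1" for z
      using circle_mean_mono[OF f \<rho>z that p] by (simp add: circle_mean_def mult.assoc)
    have "(\<integral>\<^sup>+z. (ennreal (circle_mean p ?f z) * indicator (ball 0 1) z) * Ap_weight \<alpha> z \<partial>lborel)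
      \<le> (\<integral>\<^sup>+z. (ennreal (circle_mean p f z) * indicator (ball 0 1) z) * Ap_weight \<alpha> z \<partial>lborel)"
    proof (rule nn_integral_mono)
      fix z :: complex
      show "(ennreal (circle_mean p ?f z) * indicator (ball 0 1) z) * Ap_weight \<alpha> z
        \<le> (ennreal (circle_mean p f z) * indicator (ball 0 1) z) * Ap_weight \<alpha> z"
        using mono[of z] by (cases "norm z < 1") (auto intro: mult_right_mono ennreal_leI)
    qed
    then show "ennreal (2 * pi) * Lp_mass p {()} (\<lambda>_. Ap_measure \<alpha>) ?f \<le> ennreal (2 * pi) * Lp_mass p {()} (\<lambda>_. Ap_measure \<alpha>) f"
      unfolding Ap_mass_eq[OF hol] Ap_mass_eq[OF f]
        radial_average[OF hol p Ap_weight_measurable rad] radial_average[OF f p Ap_weight_measurable rad] .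
  qed simp
  show "Ap_norm p \<alpha> f = enn2real (Lp_mass p {()} (\<lambda>_. Ap_measure \<alpha>) f) powr (1 / p)"
    if "f holomorphic_on ball 0 1" "Lp_mass p {()} (\<lambda>_. Ap_measure \<alpha>) f < \<infinity>" for f
    using that by (intro Ap_norm_eq \<alpha>) (simp add: Ap_space_eq[OF \<alpha>])
qed (rule p)

section \<open>Hardy spaces\<close>

definition circle_measure :: "real \<Rightarrow> complex measure" where
  "circle_measure r = distr (density lborel (\<lambda>\<theta>. ennreal (1 / (2 * pi)) * indicator {0..2*pi} \<theta>)) borel
     (\<lambda>\<theta>. of_real r * cis \<theta>)"

lemma circle_map_measurable: "(\<lambda>\<theta>. of_real r * cis \<theta>) \<in> borel_measurable borel"
  by (intro borel_measurable_continuous_onI continuous_intros)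

lemma nn_integral_circle_measure:
  assumes u: "u \<in> borel_measurable borel"
  shows "(\<integral>\<^sup>+z. u z \<partial>circle_measure r) = ennreal (1 / (2 * pi)) * (\<integral>\<^sup>+\<theta>\<in>{0..2*pi}. u (of_real r * cis \<theta>) \<partial>lborel)"
proof -
  have m: "(\<lambda>\<theta>. u (of_real r * cis \<theta>)) \<in> borel_measurable borel"
    by (rule measurable_compose[OF circle_map_measurable u])
  have "(\<integral>\<^sup>+z. u z \<partial>circle_measure r) = (\<integral>\<^sup>+\<theta>. ennreal (1 / (2 * pi)) * indicator {0..2*pi} \<theta> * u (of_real r * cis \<theta>) \<partial>lborel)"
    unfolding circle_measure_def using u m circle_map_measurable[of r]
    by (simp add: nn_integral_distr nn_integral_density)
  also have "\<dots> = (\<integral>\<^sup>+\<theta>. ennreal (1 / (2 * pi)) * (u (of_real r * cis \<theta>) * indicator {0..2*pi} \<theta>) \<partial>lborel)"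
    by (intro nn_integral_cong) (simp add: mult_ac)
  also have "\<dots> = ennreal (1 / (2 * pi)) * (\<integral>\<^sup>+\<theta>\<in>{0..2*pi}. u (of_real r * cis \<theta>) \<partial>lborel)"
    using m by (intro nn_integral_cmult) auto
  finally show ?thesis .
qed

lemma Hp_mean_eq: "Hp_mean p f r = circle_mean p f (of_real r) / (2 * pi)"
  by (simp add: Hp_mean_def circle_mean_def)

lemma Hp_mean_nonneg:
  assumes "f holomorphic_on ball 0 1" "0 < r" "r < 1" "1 < p"
  shows "0 \<le> Hp_mean p f r"
proof -
  have "(\<lambda>\<theta>. norm (f (of_real r * cis \<theta>)) powr p) integrable_on {0..2*pi}"
    using circle_continuous(2)[OF assms(1), of "of_real r" p] assms
    by (intro integrable_continuous_interval) (auto intro: continuous_on_subset)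
  then show ?thesis
    unfolding Hp_mean_def by (intro divide_nonneg_nonneg Henstock_Kurzweil_Integration.integral_nonneg) auto
qed

lemma Hp_mean_mono:
  assumes "f holomorphic_on ball 0 1" "0 < r" "r \<le> r'" "r' < 1" "1 < p"
  shows "Hp_mean p f r \<le> Hp_mean p f r'"
  unfolding Hp_mean_eq using assms by (intro divide_right_mono circle_mean_mono[OF assms(1)]) auto

lemma nn_integral_Hp_mean:
  assumes f: "f holomorphic_on ball 0 1" and r: "0 < r" "r < 1" and p: "1 < p"
  shows "(\<integral>\<^sup>+z\<in>ball 0 1. ennreal (norm (f z) powr p) \<partial>circle_measure r) = ennreal (Hp_mean p f r)"
proof -
  have "(\<integral>\<^sup>+z\<in>ball 0 1. ennreal (norm (f z) powr p) \<partial>circle_measure r)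
    = ennreal (1 / (2 * pi)) * (\<integral>\<^sup>+\<theta>\<in>{0..2*pi}. ennreal (norm (f (of_real r * cis \<theta>)) powr p) \<partial>lborel)"
    using r by (subst nn_integral_circle_measure[OF measurable_powr_ball[OF f]]) (simp add: norm_mult)
  also have "\<dots> = ennreal (1 / (2 * pi)) * ennreal (circle_mean p f (of_real r))"
    using nn_circle_mean[OF f, of "of_real r" p] r p by simp
  also have "\<dots> = ennreal (Hp_mean p f r)"
    by (simp add: Hp_mean_eq ennreal_mult'[symmetric])
  finally show ?thesis .
qed

abbreviation "Hp_mass p \<equiv> Lp_mass p {0<..<1} circle_measure"

lemma Hp_mass_eq:
  assumes "f holomorphic_on ball 0 1" "1 < p"
  shows "Hp_mass p f = (SUP r\<in>{0<..<1}. ennreal (Hp_mean p f r))"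
  unfolding Lp_mass_def using assms by (intro SUP_cong refl nn_integral_Hp_mean) auto

text \<open>The means increase with the radius, so their left limit at 1 is their supremum. In
  \<open>ennreal\<close> this covers the infinite case, too.\<close>

lemma Hp_mass_tendsto:
  assumes f: "f holomorphic_on ball 0 1" and p: "1 < p"
  shows "((\<lambda>r. ennreal (Hp_mean p f r)) \<longlongrightarrow> Hp_mass p f) (at_left 1)"
proof (rule order_tendstoI)
  have ev: "\<forall>\<^sub>F r in at_left (1::real). r \<in> {a<..<1}" if "a < 1" for a
    using that by (rule eventually_at_left_real)
  fix c assume "c < Hp_mass p f"
  then obtain r0 where r0: "r0 \<in> {0<..<1}" "c < ennreal (Hp_mean p f r0)"
    unfolding Hp_mass_eq[OF f p] less_SUP_iff by blast
  from ev[of r0] r0(1) have "\<forall>\<^sub>F r in at_left (1::real). r \<in> {r0<..<1}" by simp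
  then show "\<forall>\<^sub>F r in at_left 1. c < ennreal (Hp_mean p f r)"
  proof eventually_elim
    case (elim r)
    then have "Hp_mean p f r0 \<le> Hp_mean p f r" using r0 by (intro Hp_mean_mono[OF f _ _ _ p]) auto
    then show ?case using r0(2) ennreal_leI order_less_le_trans by blast
  qed
next
  fix c assume c: "Hp_mass p f < c"
  have "\<forall>\<^sub>F r in at_left (1::real). r \<in> {0<..<1}" by (rule eventually_at_left_real) simp
  then show "\<forall>\<^sub>F r in at_left 1. ennreal (Hp_mean p f r) < c"
  proof eventually_elim
    case (elim r)
    have "ennreal (Hp_mean p f r) \<le> Hp_mass p f" unfolding Hp_mass_eq[OF f p] using elim by (rule SUP_upper)
    then show ?case using c by (rule order_le_less_trans)
  qed
qed

lemma Hp_mean_tendsto: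
  assumes f: "f holomorphic_on ball 0 1" and p: "1 < p" and fin: "Hp_mass p f < \<infinity>"
  shows "(Hp_mean p f \<longlongrightarrow> enn2real (Hp_mass p f)) (at_left 1)"
proof -
  have "((\<lambda>r. enn2real (ennreal (Hp_mean p f r))) \<longlongrightarrow> enn2real (Hp_mass p f)) (at_left 1)"
    using Hp_mass_tendsto[OF f p] fin by (intro tendsto_enn2real) auto
  moreover have "\<forall>\<^sub>F r in at_left 1. enn2real (ennreal (Hp_mean p f r)) = Hp_mean p f r"
  proof -
    have "\<forall>\<^sub>F r in at_left (1::real). r \<in> {0<..<1}" by (rule eventually_at_left_real) simp
    then show ?thesis by eventually_elim (use Hp_mean_nonneg[OF f _ _ p] in auto)
  qed
  ultimately show ?thesis using tendsto_cong by fast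
qed

text \<open>The means always converge to \<open>Hp_mass p f\<close> in \<open>ennreal\<close>; by
  uniqueness of limits, a real limit exists only if this value is finite.\<close>

lemma Hp_space_eq:
  assumes p: "1 < p"
  shows "Hp_space p = {f. f holomorphic_on ball 0 1 \<and> Hp_mass p f < \<infinity>}"
proof -
  have "(\<exists>L. (Hp_mean p f \<longlongrightarrow> L) (at_left 1)) \<longleftrightarrow> Hp_mass p f < \<infinity>" if f: "f holomorphic_on ball 0 1" for f
  proof
    assume "\<exists>L. (Hp_mean p f \<longlongrightarrow> L) (at_left 1)"
    then obtain L where "(Hp_mean p f \<longlongrightarrow> L) (at_left 1)" by blast
    then have "((\<lambda>r. ennreal (Hp_mean p f r)) \<longlongrightarrow> ennreal L) (at_left 1)" by (rule tendsto_ennrealI)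
    from tendsto_unique[OF _ this Hp_mass_tendsto[OF f p]] have "Hp_mass p f = ennreal L"
      using trivial_limit_at_left_real by metis
    then show "Hp_mass p f < \<infinity>" by simp
  next
    assume "Hp_mass p f < \<infinity>"
    then show "\<exists>L. (Hp_mean p f \<longlongrightarrow> L) (at_left 1)" using Hp_mean_tendsto[OF f p] by auto
  qed
  then show ?thesis unfolding Hp_space_def by blast
qed

lemma Hp_norm_eq:
  assumes "f holomorphic_on ball 0 1" "1 < p" "Hp_mass p f < \<infinity>"
  shows "Hp_norm p f = enn2real (Hp_mass p f) powr (1 / p)"
  unfolding Hp_norm_def using tendsto_Lim[OF trivial_limit_at_left_real Hp_mean_tendsto[OF assms]] by simp

lemma finite_cis_fibre: "finite {\<theta>\<in>{0..2*pi}. cis \<theta> = \<xi>}"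
proof -
  have "{\<theta>\<in>{0..2*pi}. cis \<theta> = \<xi>} \<subseteq> {Arg2pi \<xi>, 2 * pi}"
  proof
    fix \<theta> assume \<theta>: "\<theta> \<in> {\<theta>\<in>{0..2*pi}. cis \<theta> = \<xi>}"
    then show "\<theta> \<in> {Arg2pi \<xi>, 2 * pi}"
      using Arg2pi_unique[of 1 \<theta> \<xi>] by (cases "\<theta> = 2 * pi") (auto simp: cis_conv_exp)
  qed
  then show ?thesis by (rule finite_subset) simp
qed

text \<open>If \<open>of_real r * cis \<theta>\<close> is within distance d of \<open>\<xi>\<close>,
  then \<open>1 - r < d\<close>, so \<open>cis \<theta>\<close> is within \<open>2 * d\<close>. One
  set of angles therefore bounds all circles at once, and these sets shrink to a finite set; hence
  the radii 1 and 2 over \<open>Suc n\<close>.\<close>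

lemma circle_measure_small:
  assumes \<xi>: "norm \<xi> = 1" and \<eta>: "0 < \<eta>"
  shows "\<exists>\<epsilon>>0. \<forall>r\<in>{0<..<1}. emeasure (circle_measure r) (ball 0 1 \<inter> ball \<xi> \<epsilon>) \<le> ennreal \<eta>"
proof -
  let ?A = "\<lambda>n::nat. {0..2*pi} \<inter> (\<lambda>\<theta>. cis \<theta>) -` ball \<xi> (2 / real (Suc n))"
  have meas: "?A n \<in> sets lborel" for n
  proof -
    have "cis \<in> borel_measurable borel" by (intro borel_measurable_continuous_onI continuous_intros)
    then have "cis -` ball \<xi> (2 / real (Suc n)) \<in> sets borel" by (rule measurable_sets_borel) simp
    then show ?thesis by auto
  qed
  have "(\<lambda>n. emeasure lborel (?A n)) \<longlonglongrightarrow> emeasure lborel (\<Inter>n. ?A n)"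
  proof (rule Lim_emeasure_decseq)
    show "range ?A \<subseteq> sets lborel" using meas by blast
    show "decseq ?A"
      unfolding decseq_def by (intro allI impI Int_mono vimage_mono subset_ball order_refl) (simp add: frac_le)
    show "emeasure lborel (?A n) \<noteq> \<infinity>" for n
      using emeasure_bounded_finite[of "?A n"] bounded_subset[OF bounded_closed_interval] by force
  qed
  also have "emeasure lborel (\<Inter>n. ?A n) = 0"
  proof -
    have "(\<Inter>n. ?A n) \<subseteq> {\<theta>\<in>{0..2*pi}. cis \<theta> = \<xi>}"
    proof
      fix \<theta> assume \<theta>: "\<theta> \<in> (\<Inter>n. ?A n)"
      have "dist \<xi> (cis \<theta>) = 0"
      proof (rule ccontr)
        assume "dist \<xi> (cis \<theta>) \<noteq> 0"
        then obtain n where "1 / real (Suc n) < dist \<xi> (cis \<theta>) / 2"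
          using nat_approx_posE[of "dist \<xi> (cis \<theta>) / 2"] by auto
        moreover have "\<theta> \<in> ?A n" using \<theta> by blast
        ultimately show False by auto
      qed
      then show "\<theta> \<in> {\<theta>\<in>{0..2*pi}. cis \<theta> = \<xi>}" using \<theta> by auto
    qed
    then have "finite (\<Inter>n. ?A n)" using finite_cis_fibre by (rule finite_subset)
    then show ?thesis by (intro emeasure_lborel_countable countable_finite)
  qed
  finally have "\<forall>\<^sub>F n in sequentially. emeasure lborel (?A n) < ennreal (2 * pi * \<eta>)"
    using \<eta> by (intro order_tendstoD(2)) auto
  then obtain n where n: "emeasure lborel (?A n) < ennreal (2 * pi * \<eta>)"
    using eventually_happens'[OF sequentially_bot] by blast
  have "emeasure (circle_measure r) (ball 0 1 \<inter> ball \<xi> (1 / real (Suc n))) \<le> ennreal \<eta>" if r: "0 < r" "r < 1" for r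
  proof -
    let ?B = "ball 0 1 \<inter> ball \<xi> (1 / real (Suc n)) :: complex set"
    have "emeasure (circle_measure r) ?B = (\<integral>\<^sup>+z. indicator ?B z \<partial>circle_measure r)"
      by (rule nn_integral_indicator[symmetric]) (auto simp: circle_measure_def)
    also have "\<dots> = ennreal (1 / (2 * pi)) * (\<integral>\<^sup>+\<theta>\<in>{0..2*pi}. indicator ?B (of_real r * cis \<theta>) \<partial>lborel)"
      by (rule nn_integral_circle_measure) (intro borel_measurable_indicator borel_open open_Int open_ball)
    also have "\<dots> \<le> ennreal (1 / (2 * pi)) * (\<integral>\<^sup>+\<theta>. indicator (?A n) \<theta> \<partial>lborel)"
    proof (intro mult_left_mono nn_integral_mono)
      fix \<theta> :: real
      have "cis \<theta> \<in> ball \<xi> (2 / real (Suc n))" if "of_real r * cis \<theta> \<in> ball \<xi> (1 / real (Suc n))"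
      proof -
        have d: "dist \<xi> (of_real r * cis \<theta>) < 1 / real (Suc n)" using that by simp
        have "1 - r = norm \<xi> - norm (of_real r * cis \<theta>)" using \<xi> r by (simp add: norm_mult)
        also have "\<dots> \<le> dist \<xi> (of_real r * cis \<theta>)" unfolding dist_norm by (rule norm_triangle_ineq2)
        finally have r1: "1 - r < 1 / real (Suc n)" using d by linarith
        have "dist (of_real r * cis \<theta>) (cis \<theta>) = norm (of_real (r - 1) * cis \<theta>)"
          by (simp add: dist_norm algebra_simps)
        also have "\<dots> = 1 - r" using r by (simp only: norm_mult norm_of_real norm_cis) simp
        finally have "dist \<xi> (cis \<theta>) < 1 / real (Suc n) + 1 / real (Suc n)"
          using dist_triangle[of \<xi> "cis \<theta>" "of_real r * cis \<theta>"] d r1 by linarith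
        then show ?thesis by simp
      qed
      then show "indicator ?B (of_real r * cis \<theta>) * indicator {0..2*pi} \<theta> \<le> (indicator (?A n) \<theta> :: ennreal)"
        by (auto simp: indicator_def)
    qed simp
    also have "\<dots> = ennreal (1 / (2 * pi)) * emeasure lborel (?A n)" by (simp only: nn_integral_indicator[OF meas])
    also have "\<dots> \<le> ennreal (1 / (2 * pi)) * ennreal (2 * pi * \<eta>)" using n by (intro mult_left_mono) auto
    also have "\<dots> = ennreal \<eta>" using \<eta> by (simp add: ennreal_mult[symmetric])
    finally show ?thesis .
  qed
  then show ?thesis by (intro exI[of _ "1 / real (Suc n)"]) auto
qed

lemma disk_space_Hp:
  assumes p: "1 < p"
  shows "disk_space p {0<..<1} circle_measure (Hp_norm p)"
proof
  show "sets (circle_measure r) = sets borel" for r by (simp add: circle_measure_def)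
  have "emeasure (circle_measure r) (ball 0 1) \<le> ennreal 1" if r: "r \<in> {0<..<1}" for r
  proof -
    have "emeasure (circle_measure r) (ball 0 1) = (\<integral>\<^sup>+z. indicator (ball 0 1) z \<partial>circle_measure r)"
      by (rule nn_integral_indicator[symmetric]) (auto simp: circle_measure_def)
    also have "\<dots> = (\<integral>\<^sup>+z\<in>ball 0 1. ennreal (norm ((\<lambda>_. 1) z :: complex) powr p) \<partial>circle_measure r)" by simp
    also have "\<dots> = ennreal (Hp_mean p (\<lambda>_. 1) r)" using r by (intro nn_integral_Hp_mean p) auto
    also have "\<dots> = ennreal 1" by (simp add: Hp_mean_def)
    finally show ?thesis by simp
  qed
  then show "\<exists>K::real. \<forall>r\<in>{0<..<1}. emeasure (circle_measure r) (ball 0 1) \<le> ennreal K" by blast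
  show "\<exists>C s. 0 < C \<and> (\<forall>f z. f holomorphic_on ball 0 1 \<longrightarrow> z \<in> ball 0 1 \<longrightarrow>
      ennreal (norm (f z) powr p) \<le> ennreal (C * (1 - norm z) powr (- s)) * Hp_mass p f)"
  proof (intro exI conjI allI impI)
    show "0 < (1::real)" by simp
    fix f and z :: complex
    assume f: "f holomorphic_on ball 0 1" and "z \<in> ball 0 1"
    then have z: "norm z < 1" by simp
    \<comment> \<open>The largest disk about \<open>z\<close> inside the unit disk; its area gives
      the exponent 2 of the evaluation bound.\<close>
    define R where "R = 1 - norm z"
    have R: "0 < R" "R \<le> 1 - norm z" using z by (auto simp: R_def)
    have mean: "ennreal (circle_mean p f w) \<le> ennreal (2 * pi) * Hp_mass p f" if w: "norm w < 1" for w
    proof -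
      \<comment> \<open>The supremum defining the mass runs over positive radii only; the maximum
        with 1/2 handles \<open>w = 0\<close>.\<close>
      define r where "r = max (norm w) (1 / 2)"
      have r: "0 < r" "r < 1" "norm w \<le> r" using w by (auto simp: r_def)
      have "circle_mean p f w \<le> circle_mean p f (of_real r)"
        using r by (intro circle_mean_mono[OF f _ _ p]) auto
      also have "\<dots> = 2 * pi * Hp_mean p f r" by (simp add: Hp_mean_eq)
      finally have "ennreal (circle_mean p f w) \<le> ennreal (2 * pi) * ennreal (Hp_mean p f r)"
        by (simp add: ennreal_mult'[symmetric] ennreal_leI)
      also have "\<dots> \<le> ennreal (2 * pi) * Hp_mass p f"
        unfolding Hp_mass_eq[OF f p] using r by (intro mult_left_mono SUP_upper) auto
      finally show ?thesis .
    qed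
    have sub: "ball z R \<subseteq> ball 0 1"
    proof
      fix w assume "w \<in> ball z R"
      then have "norm w < norm z + R" using norm_triangle_ineq2[of w z] by (simp add: dist_norm norm_minus_commute)
      then show "w \<in> ball 0 1" using R by simp
    qed
    have "ennreal (2 * pi) * (ennreal (norm (f z) powr p) * ennreal (pi * R\<^sup>2))
      \<le> ennreal (2 * pi) * (\<integral>\<^sup>+w\<in>ball z R. ennreal (norm (f w) powr p) \<partial>lborel)"
      by (intro mult_left_mono area_submean[OF f z R p]) auto
    also have "\<dots> \<le> ennreal (2 * pi) * (\<integral>\<^sup>+w. (ennreal (norm (f w) powr p) * indicator (ball 0 1) w) * 1 \<partial>lborel)"
      using sub by (intro mult_left_mono nn_integral_mono) (auto simp: indicator_def)
    also have "\<dots> = (\<integral>\<^sup>+w. (ennreal (circle_mean p f w) * indicator (ball 0 1) w) * 1 \<partial>lborel)"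
      by (rule radial_average[OF f p]) auto
    also have "\<dots> \<le> (\<integral>\<^sup>+w. (ennreal (2 * pi) * Hp_mass p f) * indicator (ball 0 1) (w::complex) \<partial>lborel)"
      using mean by (intro nn_integral_mono) (auto simp: indicator_def)
    also have "\<dots> = (ennreal (2 * pi) * Hp_mass p f) * ennreal (pi * 1\<^sup>2)"
      by (subst nn_integral_cmult_indicator) (simp_all only: emeasure_disk[OF zero_le_one] sets_lborel borel_open open_ball)
    also have "\<dots> = ennreal (2 * pi) * (ennreal pi * Hp_mass p f)" by (simp add: mult_ac)
    finally have "ennreal (norm (f z) powr p) * ennreal (pi * R\<^sup>2) \<le> ennreal pi * Hp_mass p f"
      by (rule ennreal_mult_left_cancel_le[rotated]) simp
    then have "ennreal pi * (ennreal (R\<^sup>2) * ennreal (norm (f z) powr p)) \<le> ennreal pi * Hp_mass p f"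
      by (simp add: ennreal_mult mult_ac)
    then have "ennreal (R\<^sup>2) * ennreal (norm (f z) powr p) \<le> Hp_mass p f"
      by (rule ennreal_mult_left_cancel_le[rotated]) simp
    then have "ennreal (1 / R\<^sup>2) * (ennreal (R\<^sup>2) * ennreal (norm (f z) powr p)) \<le> ennreal (1 / R\<^sup>2) * Hp_mass p f"
      by (rule mult_left_mono) simp
    moreover have "ennreal (1 / R\<^sup>2) * (ennreal (R\<^sup>2) * ennreal (norm (f z) powr p)) = ennreal (norm (f z) powr p)"
      using R by (simp add: ennreal_mult[symmetric] mult.assoc[symmetric])
    moreover have "1 / R\<^sup>2 = 1 * (1 - norm z) powr (- 2)"
      using R by (simp add: R_def powr_minus powr_numeral inverse_eq_divide)
    ultimately show "ennreal (norm (f z) powr p) \<le> ennreal (1 * (1 - norm z) powr (- 2)) * Hp_mass p f" by simp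
  qed
  show "Hp_mass p (\<lambda>z. f (of_real \<rho> * z)) \<le> Hp_mass p f"
    if f: "f holomorphic_on ball 0 1" and \<rho>: "0 < \<rho>" "\<rho> < 1" for f \<rho>
  proof -
    note hol = holomorphic_dilation[OF f \<rho>]
    show ?thesis
      unfolding Hp_mass_eq[OF hol p]
    proof (rule SUP_least)
      fix r :: real assume r: "r \<in> {0<..<1}"
      have "Hp_mean p (\<lambda>z. f (of_real \<rho> * z)) r = Hp_mean p f (\<rho> * r)" by (simp add: Hp_mean_def mult.assoc)
      also have "\<dots> \<le> Hp_mean p f r" using r \<rho> by (intro Hp_mean_mono[OF f _ _ _ p]) (auto simp: mult_left_le_one_le)
      finally have "ennreal (Hp_mean p (\<lambda>z. f (of_real \<rho> * z)) r) \<le> ennreal (Hp_mean p f r)" by (rule ennreal_leI)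
      also have "\<dots> \<le> Hp_mass p f" unfolding Hp_mass_eq[OF f p] using r by (rule SUP_upper)
      finally show "ennreal (Hp_mean p (\<lambda>z. f (of_real \<rho> * z)) r) \<le> Hp_mass p f" .
    qed
  qed
qed (use p circle_measure_small Hp_norm_eq in auto)

theorem theorem4p1:
  fixes p \<alpha> :: real and X :: "(complex \<Rightarrow> complex) set" and N :: "(complex \<Rightarrow> complex) \<Rightarrow> real"
    and g :: "real \<Rightarrow> complex \<Rightarrow> complex"
  assumes p: "1 < p" and \<alpha>: "\<alpha> > -1"
    and X: "(X = Hp_space p \<and> N = Hp_norm p) \<or> (X = Ap_space p \<alpha> \<and> N = Ap_norm p \<alpha>)"
    and gH: "\<forall>t\<in>{0<..<1}. g t \<in> Hinf"
    and W: "W_cond X N g"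
  defines "LHS \<equiv> wn_sup X N (int_mult_op g)"
    and "RHS \<equiv> (\<integral>\<^sup>+ t\<in>{0<..<1}. wn_sup X N (mult_op (g t)) \<partial>lborel)"
    and "P \<equiv> (\<lambda>\<phi>. weakly_null X N \<phi> \<and> (\<forall>n. N (\<phi> n) = 1) \<and>
               (\<exists>L. (\<lambda>n. N (int_mult_op g (\<phi> n))) \<longlonglongrightarrow> L \<and>
                    (\<lambda>n. integral {0<..<1} (\<lambda>t. N (mult_op (g t) (\<phi> n)))) \<longlonglongrightarrow> L) \<and>
               (AE t in lborel. t \<in> {0<..<1} \<longrightarrow>
                  liminf (\<lambda>n. ennreal (N (mult_op (g t) (\<phi> n)))) = wn_sup X N (mult_op (g t))))"
  shows "LHS \<le> RHS \<and> (LHS = RHS \<longleftrightarrow> (\<exists>\<phi>. P \<phi>)) \<and>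
         (LHS = RHS \<longrightarrow> (\<exists>\<phi>. P \<phi> \<and> approx_eval_map X N \<phi>))"
  using X
proof
  assume eq: "X = Hp_space p \<and> N = Hp_norm p"
  interpret disk_space p "{0<..<1}" circle_measure N
    using disk_space_Hp[OF p] eq by simp
  have X': "disk_space.X p {0<..<1} circle_measure = X"
    using eq Hp_space_eq[OF p] by (simp add: X_def)
  interpret multiplier_family p "{0<..<1}" circle_measure N g
    by unfold_locales (use gH W X' in auto)
  show ?thesis
    using equality_characterization unfolding R_def extremal_def X' LHS_def RHS_def P_def .
next
  assume eq: "X = Ap_space p \<alpha> \<and> N = Ap_norm p \<alpha>"
  interpret disk_space p "{()}" "\<lambda>_. Ap_measure \<alpha>" N
    using disk_space_Ap[OF p \<alpha>] eq by simp
  have X': "disk_space.X p {()} (\<lambda>_. Ap_measure \<alpha>) = X"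
    using eq Ap_space_eq[OF \<alpha>] by (simp add: X_def)
  interpret multiplier_family p "{()}" "\<lambda>_. Ap_measure \<alpha>" N g
    by unfold_locales (use gH W X' in auto)
  show ?thesis
    using equality_characterization unfolding R_def extremal_def X' LHS_def RHS_def P_def .
qed

end
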